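(* Let $k\ge1$ be an integer. There are an integer $m_0>0$ and a constant $C>0$ such that the following holds. There exists a functional $E_{2k}(u)$ of the form $$E_{2k}(u)=\|u\|_{H^{2k}}^2+R_{2k}(u),\qquad E_{2k}(0)=0,$$ with $$|R_{2k}(u)-R_{2k}(v)|\le C\|u-v\|_{H^{2k-1}}\bigl(1+\|u\|_{H^{2k-1}}^{m_0}+\|v\|_{H^{2k-1}}^{m_0}\bigr),$$ and moreover, for every $M\in\mathbb{N}\cup\{\infty\}$, there is a functional $F_{2k}^{(M)}(u)$ such that, for every initial datum $u_0\in H^{2k}(\mathbb{T})$, $$\frac{d}{dt}E_{2k}\bigl(\pi_M\Phi_M(t)(u_0)\bigr)=F^{(M)}_{2k}\bigl(\pi_M\Phi_M(t)(u_0)\bigr),$$ where $F^{(M)}_{2k}$ satisfies $$|F^{(M)}_{2k}(u)|\le C\bigl(1+\|u\|_{H^{2k-1}}^{m_0}\bigr)\quad\text{if }k\ge2,$$ and $$|F^{(M)}_{2}(u)|\le C\bigl(1+\|u\|_{H^{1}}^{m_0}\bigr)\bigl(1+\|\partial_xu\|_{L^4}^4\bigr)\quad\text{if }k=1.$$ The functional $E_{2k}$ and the constants $C,m_0$ do not depend on $M$.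
   Context: $\mathbb{T}$ is the one-dimensional torus $\mathbb{R}/2\pi\mathbb{Z}$; functions are complex-valued and functionals are real-valued; $E_{2k}$ and $F_{2k}^{(M)}$ are defined on $H^{2k}(\mathbb{T})$ and $R_{2k}$ on $H^{2k-1}(\mathbb{T})$. The norm is $\|u\|_{H^{2k}}=\|(1-\partial_x^2)^ku\|_{L^2}$. For an integer $M\ge0$, $\pi_M$ is the Dirichlet projector $\pi_M\bigl(\sum_{n\in\mathbb{Z}}c_ne^{inx}\bigr)=\sum_{|n|\le M}c_ne^{inx}$, and $\pi_\infty=\mathrm{Id}$. $\Phi_M(t)$ denotes the (global) flow of the truncated equation $$(i\partial_t+\partial_x^2)u=\pi_M\bigl(|\pi_Mu|^4\pi_Mu\bigr),\qquad u(0,x)=u_0(x),\qquad t\in\mathbb{R},\ x\in\mathbb{T};$$ for $M=\infty$ this is the defocusing quintic Schrödinger equation $(i\partial_t+\partial_x^2)u=|u|^4u$. *)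

theory Defs
  imports "HOL-Analysis.Analysis" "HOL-Library.Extended_Nat"
begin

text \<open>
  A function on the torus \<open>\<real>/2\<pi>\<int>\<close> is a \<open>2\<pi>\<close>-periodic function on the real line; integrals are taken
  over the fundamental domain \<open>[0, 2\<pi>]\<close> with (unnormalised) Lebesgue measure.
\<close>

abbreviation torus :: "real measure" where
  "torus \<equiv> lebesgue_on {0..2 * pi}"

definition Lp_norm :: "real \<Rightarrow> (real \<Rightarrow> complex) \<Rightarrow> real" where
  "Lp_norm p f = (LINT x|torus. cmod (f x) powr p) powr (1 / p)"

definition L2_torus :: "(real \<Rightarrow> complex) set" where
  "L2_torus = {f. f \<in> borel_measurable torus \<and> integrable torus (\<lambda>x. (cmod (f x))\<^sup>2)}"

definition fourier_coeff :: "(real \<Rightarrow> complex) \<Rightarrow> int \<Rightarrow> complex" where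
  "fourier_coeff u n =
     (1 / (2 * pi)) * (LINT x|torus. u x * exp (- (\<i> * of_int n * of_real x)))"

text \<open>
  \<open>is_bessel s u g\<close>: the function \<open>g\<close> is square integrable and represents \<open>(1 - \<partial>\<^sub>x\<^sup>2)\<^bsup>s/2\<^esup> u\<close>, the Fourier
  multiplier with symbol \<open>(1 + n\<^sup>2)\<^bsup>s/2\<^esup>\<close>.  Such a \<open>g\<close> is unique up to null sets, so the choice
  in \<open>bessel\<close> does not affect its \<open>L\<^sup>2\<close> norm.
\<close>

definition is_bessel :: "nat \<Rightarrow> (real \<Rightarrow> complex) \<Rightarrow> (real \<Rightarrow> complex) \<Rightarrow> bool" where
  "is_bessel s u g \<longleftrightarrow> g \<in> L2_torus \<and>
     (\<forall>n. fourier_coeff g n =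
        of_real ((1 + (real_of_int n)\<^sup>2) powr (real s / 2)) * fourier_coeff u n)"

definition bessel :: "nat \<Rightarrow> (real \<Rightarrow> complex) \<Rightarrow> real \<Rightarrow> complex" where
  "bessel s u = (SOME g. is_bessel s u g)"

text \<open>
  The Sobolev space of order \<open>s \<ge> 1\<close>.  Every element has exactly one continuous representative
  (Sobolev embedding in dimension one), and it is this representative that is used, so that functions
  equal almost everywhere are equal.  For \<open>s = 0\<close> the definition does not give \<open>L\<^sup>2\<close>; only
  orders \<open>s \<ge> 1\<close> are used.
\<close>

definition Hs :: "nat \<Rightarrow> (real \<Rightarrow> complex) set" where
  "Hs s = {u. continuous_on UNIV u \<and> (\<forall>x. u (x + 2 * pi) = u x) \<and> (\<exists>g. is_bessel s u g)}"

definition Hs_norm :: "nat \<Rightarrow> (real \<Rightarrow> complex) \<Rightarrow> real" where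
  "Hs_norm s u = Lp_norm 2 (bessel s u)"

definition dirichlet_proj :: "enat \<Rightarrow> (real \<Rightarrow> complex) \<Rightarrow> real \<Rightarrow> complex" where
  "dirichlet_proj M u = (case M of
       enat N \<Rightarrow> (\<lambda>x. \<Sum>n\<in>{- int N..int N}. fourier_coeff u n * exp (\<i> * of_int n * of_real x))
     | \<infinity> \<Rightarrow> u)"

definition nls_nonlinearity :: "enat \<Rightarrow> (real \<Rightarrow> complex) \<Rightarrow> real \<Rightarrow> complex" where
  "nls_nonlinearity M u = dirichlet_proj M
     (\<lambda>x. of_real (cmod (dirichlet_proj M u x) ^ 4) * dirichlet_proj M u x)"

text \<open>
  \<open>u\<close>, regarded as \<open>t \<mapsto> u(t)\<close>, is a global solution in \<open>C(\<real>; H\<^sup>s)\<close> with datum \<open>u\<^sub>0\<close> of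
  \[ (i \partial_t + \partial_x^2) u = \pi_M (|\pi_M u|^4 \pi_M u), \]
  that is, \<open>u t = \<Phi>\<^sub>M(t)(u\<^sub>0)\<close> for the flow \<open>\<Phi>\<^sub>M\<close>.  The equation holds in the sense of distributions on
  the torus: it is tested against every \<open>e\<^bsup>-inx\<^esup>\<close>, where \<open>\<partial>\<^sub>x\<^sup>2\<close> becomes multiplication by \<open>-n\<^sup>2\<close>.
\<close>

definition nls_solution ::
  "nat \<Rightarrow> enat \<Rightarrow> (real \<Rightarrow> complex) \<Rightarrow> (real \<Rightarrow> real \<Rightarrow> complex) \<Rightarrow> bool" where
  "nls_solution s M u\<^sub>0 u \<longleftrightarrow>
     u 0 = u\<^sub>0 \<and>
     (\<forall>t. u t \<in> Hs s) \<and>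
     (\<forall>t. ((\<lambda>\<tau>. Hs_norm s (u \<tau> - u t)) \<longlongrightarrow> 0) (at t)) \<and>
     (\<forall>t n. \<exists>D. ((\<lambda>\<tau>. fourier_coeff (u \<tau>) n) has_vector_derivative D) (at t) \<and>
        \<i> * D - (of_int n)\<^sup>2 * fourier_coeff (u t) n
          = fourier_coeff (nls_nonlinearity M (u t)) n)"

definition deriv_x :: "(real \<Rightarrow> complex) \<Rightarrow> real \<Rightarrow> complex" where
  "deriv_x u x = vector_derivative u (at x)"

end

theory Submission
  imports Defs
begin

text \<open>
  On the Fourier side the linear flow is diagonal, and since \<open>\<pi>\<^sub>M u\<close> is its own projection the time derivative of
  \<open>\<parallel>\<pi>\<^sub>M u\<parallel>\<^sup>2\<close> in \<open>H\<^sup>m\<close>, \<open>m = 2k\<close>, is a sextic form in \<open>\<pi>\<^sub>M u\<close> that does not involve \<open>M\<close>.  Its symbol is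
  \<open>\<psi> = \<Sum> \<plusminus> (1 + n\<^sub>j\<^sup>2)\<^sup>m\<close>.  A correction term which is a sextic form with symbol \<open>r\<close> changes it to
  \<open>\<psi> - \<Omega> r\<close>, with the resonance function \<open>\<Omega> = \<Sum> \<plusminus> n\<^sub>j\<^sup>2\<close>, plus terms of degree ten.  One chooses \<open>r\<close>
  such that the forms of \<open>r\<close> and \<open>\<psi> - \<Omega> r\<close> are controlled with one derivative less: for \<open>k \<ge> 2\<close> it suffices to divide the
  contribution of the two largest frequencies by theirs to \<open>\<Omega>\<close>; for \<open>k = 1\<close> a polynomial division leaves a form with exactly four
  derivatives on four different factors, bounded by \<open>\<parallel>u\<parallel>\<^sub>\<infinity>\<^sup>2\<close> times the fourth power of the \<open>L\<^sup>4\<close> norm of \<open>\<partial>\<^sub>x u\<close>.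
  The identities are proved for finitely many modes and passed to the limit.
\<close>

section \<open>Multilinear forms on zero-momentum tuples of frequencies\<close>

text \<open>For data in \<open>H^{2k}\<close> the equation only places the time derivative of
  \<open>u\<close> in \<open>H^{2k-2}\<close>, so the top norm cannot be differentiated directly. It
  is differentiated for the modes up to \<open>K\<close>, and \<open>K\<close> goes to infinity
  while \<open>M\<close> stays fixed. Cutting at \<open>K\<close> does not commute with the
  nonlinearity: the derivative contains the full quintic coefficients \<open>v\<close>, whereas the
  symmetrisation needs the closed expression \<open>qconv K\<close>. Their difference is the error
  in \<open>energy_trunc_derivative\<close>, and its smallness is obtained for large
  \<open>K\<close> and \<open>t\<close> near the base time together. The cutoff \<open>M\<close>
  survives only in the terms of degree ten, as an indicator of modes that can only decrease norms;
  this is why the constants are independent of \<open>M\<close>. Degree ten, five factors times a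
  quintic nonlinearity, is also the origin of \<open>m0 = 10\<close>. The symbol estimates of
  general order rest on one fact about zero-momentum tuples: the largest bracket is at most five
  times the second largest, so an excess of derivatives on one factor can be shared by two.\<close>

definition jap :: "int \<Rightarrow> real" where
  "jap n = sqrt (1 + (real_of_int n)\<^sup>2)"

lemma jap_ge_1: "1 \<le> jap n"
  by (simp add: jap_def)

lemma jap_pos [simp]: "0 < jap n" "0 \<le> jap n"
  using jap_ge_1[of n] by linarith+

lemma jap_sq: "(jap n)\<^sup>2 = 1 + (real_of_int n)\<^sup>2"
  by (simp add: jap_def)

lemma abs_le_jap: "\<bar>real_of_int n\<bar> \<le> jap n"
  unfolding jap_def by (rule real_le_rsqrt) simp

lemma jap_uminus [simp]: "jap (- n) = jap n"
  by (simp add: jap_def)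

lemma jap_add: "jap (a + b) \<le> jap a + jap b"
proof (rule power2_le_imp_le)
  have "real_of_int a * real_of_int b \<le> \<bar>real_of_int a\<bar> * \<bar>real_of_int b\<bar>"
    by (metis abs_ge_self abs_mult)
  also have "\<dots> \<le> jap a * jap b"
    by (intro mult_mono abs_le_jap) auto
  finally show "(jap (a + b))\<^sup>2 \<le> (jap a + jap b)\<^sup>2"
    by (simp add: power2_sum jap_sq)
qed (simp add: add_nonneg_nonneg)

lemma jap_sum: "finite I \<Longrightarrow> I \<noteq> {} \<Longrightarrow> jap (\<Sum>i\<in>I. f i) \<le> (\<Sum>i\<in>I. jap (f i))"
proof (induction rule: finite_ne_induct)
  case (insert x F)
  then show ?case using jap_add[of "f x" "sum f F"] by auto
qed auto

section \<open>Truncated Sobolev norms of coefficient sequences\<close>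

abbreviation freqs :: "nat \<Rightarrow> int set" where
  "freqs K \<equiv> {- int K..int K}"

definition hnorm :: "nat \<Rightarrow> nat \<Rightarrow> (int \<Rightarrow> complex) \<Rightarrow> real" where
  "hnorm K s a = L2_set (\<lambda>n. jap n ^ s * cmod (a n)) (freqs K)"

lemma hnorm_nonneg [simp]: "0 \<le> hnorm K s a"
  by (simp add: hnorm_def)

lemma hnorm_sq: "(hnorm K s a)\<^sup>2 = (\<Sum>n\<in>freqs K. (jap n ^ s * cmod (a n))\<^sup>2)"
  unfolding hnorm_def L2_set_def by (rule real_sqrt_pow2) (simp add: sum_nonneg)

lemma hnorm_mono_K: "K \<le> J \<Longrightarrow> hnorm K s a \<le> hnorm J s a"
  unfolding hnorm_def L2_set_def by (intro real_sqrt_le_mono sum_mono2) auto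

lemma hnorm_mono_s: "s \<le> s' \<Longrightarrow> hnorm K s a \<le> hnorm K s' a"
  unfolding hnorm_def
  by (intro L2_set_mono mult_right_mono power_increasing jap_ge_1) auto

lemma hnorm_mono: "(\<And>n. n \<in> (freqs K) \<Longrightarrow> cmod (a n) \<le> cmod (b n)) \<Longrightarrow> hnorm K s a \<le> hnorm K s b"
  unfolding hnorm_def by (intro L2_set_mono mult_left_mono) auto

lemma hnorm_cong: "(\<And>n. n \<in> (freqs K) \<Longrightarrow> cmod (a n) = cmod (b n)) \<Longrightarrow> hnorm K s a = hnorm K s b"
  unfolding hnorm_def by (intro L2_set_cong) auto

lemma hnorm_cnj [simp]: "hnorm K s (\<lambda>n. cnj (a n)) = hnorm K s a"
  by (rule hnorm_cong) simp

lemma hnorm_triangle: "hnorm K s (\<lambda>n. a n + b n) \<le> hnorm K s a + hnorm K s b"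
proof -
  have "hnorm K s (\<lambda>n. a n + b n) \<le> L2_set (\<lambda>n. jap n ^ s * cmod (a n) + jap n ^ s * cmod (b n)) (freqs K)"
    unfolding hnorm_def
    by (intro L2_set_mono) (simp_all add: norm_triangle_ineq mult_left_mono flip: distrib_left)
  also have "\<dots> \<le> hnorm K s a + hnorm K s b"
    unfolding hnorm_def by (rule L2_set_triangle_ineq)
  finally show ?thesis .
qed

lemma hnorm_minus_commute: "hnorm K s (\<lambda>n. a n - b n) = hnorm K s (\<lambda>n. b n - a n)"
  by (rule hnorm_cong) (simp add: norm_minus_commute)

text \<open>Telescoping comparison: \<open>1 / (1 + x^2)\<close> is at most
  \<open>1 / (x^2 - 1/4) = 1 / (x - 1/2) - 1 / (x + 1/2)\<close>. The induction carries the
  telescoped remainder, and \<open>5\<close> is fixed by the base case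
  \<open>1 = 5 - 4\<close>.\<close>

lemma sum_inverse_jap_sq: "(\<Sum>n\<in>freqs K. (1 / jap n)\<^sup>2) \<le> 5 - 2 / (real K + 1/2)"
proof (induction K)
  case 0
  then show ?case by (simp add: power_divide jap_sq)
next
  case (Suc K)
  have eq: "{- int (Suc K)..int (Suc K)} = insert (- int (Suc K)) (insert (int (Suc K)) (freqs K))"
    by auto
  let ?x = "real K + 1"
  have "1 / (1 + ?x\<^sup>2) \<le> 1 / (?x\<^sup>2 - 1/4)"
    by (intro divide_left_mono mult_pos_pos add_pos_nonneg) (auto simp: power2_eq_square algebra_simps intro: add_nonneg_pos)
  also have "1 / (?x\<^sup>2 - 1/4) = 1 / (?x - 1/2) - 1 / (?x + 1/2)"
  proof -
    have "?x\<^sup>2 - 1/4 = (?x - 1/2) * (?x + 1/2)" by (simp add: power2_eq_square algebra_simps)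
    moreover have "?x - 1/2 > 0" "?x + 1/2 > 0" by auto
    ultimately show ?thesis by (simp add: diff_frac_eq)
  qed
  finally have *: "2 * (1 / (1 + ?x\<^sup>2)) \<le> 2 / (real K + 1/2) - 2 / (real (Suc K) + 1/2)"
    by (simp add: algebra_simps)
  have "(\<Sum>n\<in>{- int (Suc K)..int (Suc K)}. (1 / jap n)\<^sup>2)
      = 2 * (1 / (1 + ?x\<^sup>2)) + (\<Sum>n\<in>freqs K. (1 / jap n)\<^sup>2)"
  proof -
    define p q where "p = - int (Suc K)" and "q = int (Suc K)"
    have jj: "(1 / jap p)\<^sup>2 = 1 / (1 + ?x\<^sup>2)" "(1 / jap q)\<^sup>2 = 1 / (1 + ?x\<^sup>2)"
    proof -
      have "(real_of_int p)\<^sup>2 = ?x\<^sup>2" "(real_of_int q)\<^sup>2 = ?x\<^sup>2"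
        by (auto simp: p_def q_def power2_eq_square algebra_simps)
      then show "(1 / jap p)\<^sup>2 = 1 / (1 + ?x\<^sup>2)" "(1 / jap q)\<^sup>2 = 1 / (1 + ?x\<^sup>2)"
        by (simp_all add: power_divide jap_sq)
    qed
    have notin: "p \<notin> insert q (freqs K)" "q \<notin> (freqs K)"
      by (auto simp: p_def q_def)
    have eq': "{- int (Suc K)..int (Suc K)} = insert p (insert q (freqs K))"
      unfolding eq p_def q_def ..
    show ?thesis
      unfolding eq' using notin jj by (simp del: atLeastAtMost_iff)
  qed
  with * Suc show ?case by linarith
qed

text \<open>Cauchy-Schwarz against \<open>1 / jap\<close>, whose squares sum to at most
  \<open>5 < 3^2\<close>: the embedding of \<open>H^1\<close> into absolutely convergent Fourier
  series, with a constant independent of \<open>K\<close>.\<close>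

lemma l1_le_hnorm: "(\<Sum>n\<in>freqs K. cmod (a n)) \<le> 3 * hnorm K 1 a"
proof -
  let ?I = "(freqs K)"
  have "(\<Sum>n\<in>?I. cmod (a n)) = (\<Sum>n\<in>?I. \<bar>1 / jap n\<bar> * \<bar>jap n ^ 1 * cmod (a n)\<bar>)"
    by (intro sum.cong) (auto simp: abs_mult less_imp_neq[OF jap_pos(1), symmetric])
  also have "\<dots> \<le> L2_set (\<lambda>n. 1 / jap n) ?I * hnorm K 1 a"
    unfolding hnorm_def by (rule L2_set_mult_ineq)
  also have "\<dots> \<le> 3 * hnorm K 1 a"
  proof (intro mult_right_mono)
    have "(\<Sum>n\<in>?I. (1 / jap n)\<^sup>2) \<le> 3\<^sup>2"
    proof -
      have "0 \<le> 2 / (real K + 1/2)" by simp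
      with sum_inverse_jap_sq[of K] have "(\<Sum>n\<in>?I. (1 / jap n)\<^sup>2) \<le> 5" by linarith
      then show ?thesis by simp
    qed
    then show "L2_set (\<lambda>n. 1 / jap n) ?I \<le> 3"
      unfolding L2_set_def by (metis real_sqrt_le_mono real_sqrt_abs abs_numeral)
  qed simp
  finally show ?thesis .
qed

section \<open>Sextic forms and their boundedness\<close>

text \<open>A sextic form is evaluated at six sequences; slots \<open>0, 1, 2\<close> carry a factor \<open>u\<close> and slots \<open>3, 4, 5\<close> a
  factor \<open>cnj u\<close>.  Only the values of a tuple \<open>nat \<Rightarrow> int\<close> below \<open>6\<close> matter.\<close>

definition csign :: "nat \<Rightarrow> int" where
  "csign j = (if j < 3 then 1 else - 1)"

lemma csign_abs [simp]: "\<bar>csign j\<bar> = 1" and csign_sq [simp]: "csign j * csign j = 1" and csign_nz [simp]: "csign j \<noteq> 0"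
  by (auto simp: csign_def)

definition zero_mom :: "(nat \<Rightarrow> int) \<Rightarrow> bool" where
  "zero_mom n \<longleftrightarrow> (\<Sum>j<6. csign j * n j) = 0"

definition tuples :: "nat \<Rightarrow> (nat \<Rightarrow> int) set" where
  "tuples K = {n \<in> PiE {..<6} (\<lambda>_. (freqs K)). zero_mom n}"

lemma finite_tuples [simp]: "finite (tuples K)"
  unfolding tuples_def by (rule finite_Collect_conjI) (simp add: finite_PiE)

lemma tuplesD: "n \<in> tuples K \<Longrightarrow> j < 6 \<Longrightarrow> n j \<in> (freqs K)" "n \<in> tuples K \<Longrightarrow> zero_mom n"
  unfolding tuples_def PiE_iff by blast+

lemma tuples_mono: "K \<le> J \<Longrightarrow> tuples K \<subseteq> tuples J"
  unfolding tuples_def using PiE_mono[of "{..<6}" "\<lambda>_. (freqs K)" "\<lambda>_. {- int J..int J}"] by auto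

lemma zero_mom_determined:
  assumes "zero_mom n" "zero_mom n'" "j < 6" "\<And>l. l < 6 \<Longrightarrow> l \<noteq> j \<Longrightarrow> n l = n' l"
  shows "n j = n' j"
proof -
  have "csign j * n j + (\<Sum>l\<in>{..<6}-{j}. csign l * n l) = csign j * n' j + (\<Sum>l\<in>{..<6}-{j}. csign l * n' l)"
    using assms(1-3) sum.remove[of "{..<6}" j "\<lambda>l. csign l * n l"] sum.remove[of "{..<6}" j "\<lambda>l. csign l * n' l"]
    unfolding zero_mom_def by simp
  moreover have "(\<Sum>l\<in>{..<6}-{j}. csign l * n l) = (\<Sum>l\<in>{..<6}-{j}. csign l * n' l)"
    using assms(4) by (intro sum.cong) auto
  ultimately show ?thesis by simp
qed

text \<open>The zero-momentum condition determines slot \<open>j\<close> from the others, so that slot costs no summation.\<close>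

lemma sum_tuples_le:
  fixes b :: "nat \<Rightarrow> int \<Rightarrow> real"
  assumes "j < 6" "\<And>l n. 0 \<le> b l n"
  shows "(\<Sum>n\<in>tuples K. \<Prod>l\<in>{..<6}-{j}. b l (n l)) \<le> (\<Prod>l\<in>{..<6}-{j}. \<Sum>n\<in>freqs K. b l n)"
proof -
  let ?D = "{..<6}-{j}"
  let ?res = "\<lambda>n. restrict n ?D"
  have inj: "inj_on ?res (tuples K)"
  proof (rule inj_onI)
    fix n n' assume n: "n \<in> tuples K" "n' \<in> tuples K" "?res n = ?res n'"
    have eq: "n l = n' l" if "l < 6" "l \<noteq> j" for l
      using fun_cong[OF n(3), of l] that by auto
    have "n j = n' j"
      using zero_mom_determined[OF tuplesD(2)[OF n(1)] tuplesD(2)[OF n(2)] assms(1)] eq by blast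
    with eq show "n = n'"
      using n(1,2) unfolding tuples_def
      by (intro PiE_ext[of n "{..<6}" "\<lambda>_. (freqs K)"]) auto
  qed
  have "(\<Sum>n\<in>tuples K. \<Prod>l\<in>?D. b l (n l)) = (\<Sum>n\<in>tuples K. \<Prod>l\<in>?D. b l (?res n l))"
    by simp
  also have "\<dots> = (\<Sum>n\<in>?res ` tuples K. \<Prod>l\<in>?D. b l (n l))"
    by (subst sum.reindex[OF inj]) simp
  also have "\<dots> \<le> (\<Sum>n\<in>PiE ?D (\<lambda>_. (freqs K)). \<Prod>l\<in>?D. b l (n l))"
    proof (intro sum_mono2 finite_PiE prod_nonneg)
    show "?res ` tuples K \<subseteq> PiE ?D (\<lambda>_. (freqs K))"
      by (rule image_subsetI) (use tuplesD(1) in \<open>simp add: restrict_PiE_iff del: atLeastAtMost_iff\<close>)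
  qed (simp_all add: assms(2))
  also have "\<dots> = (\<Prod>l\<in>?D. \<Sum>n\<in>freqs K. b l n)"
    by (subst prod_sum_PiE) auto
  finally show ?thesis .
qed

lemma prod_remove_pair:
  fixes f :: "nat \<Rightarrow> 'a::comm_monoid_mult"
  assumes "i < N" "j < N" "i \<noteq> j"
  shows "(\<Prod>l<N. f l) = f i * f j * (\<Prod>l\<in>{..<N}-{i,j}. f l)"
proof -
  have "(\<Prod>l<N. f l) = f i * (f j * (\<Prod>l\<in>{..<N}-{i}-{j}. f l))"
    using assms prod.remove[of "{..<N}" i f] prod.remove[of "{..<N}-{i}" j f] by simp
  moreover have "{..<N}-{i}-{j} = {..<N}-{i,j}" by auto
  ultimately show ?thesis by (simp add: mult.assoc)
qed

text \<open>Cauchy-Schwarz over the tuples, with the product of the four remaining slots split as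
  \<open>sqrt P * sqrt P\<close>. In each of the two square sums one slot of the pair is absent, and
  zero momentum removes exactly that one from the summation.\<close>

lemma sum_tuples_l2_l1:
  fixes b :: "nat \<Rightarrow> int \<Rightarrow> real"
  assumes ij: "i < 6" "j < 6" "i \<noteq> j" and b: "\<And>l n. 0 \<le> b l n"
  shows "(\<Sum>n\<in>tuples K. \<Prod>l<6. b l (n l)) \<le>
    L2_set (b i) (freqs K) * L2_set (b j) (freqs K) *
      (\<Prod>l\<in>{..<6}-{i,j}. \<Sum>n\<in>freqs K. b l n)"
proof -
  let ?I = "(freqs K)" and ?D = "{..<6}-{i,j}"
  define P where "P n = (\<Prod>l\<in>?D. b l (n l))" for n :: "nat \<Rightarrow> int"
  define Q where "Q = (\<Prod>l\<in>?D. \<Sum>n\<in>?I. b l n)"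
  have P0: "0 \<le> P n" for n unfolding P_def by (intro prod_nonneg) (simp add: b)
  have Q0: "0 \<le> Q" unfolding Q_def by (intro prod_nonneg sum_nonneg) (simp add: b)
  have half: "(\<Sum>n\<in>tuples K. (b x (n x))\<^sup>2 * P n) \<le> (L2_set (b x) ?I)\<^sup>2 * Q"
    if "x < 6" "y < 6" "x \<noteq> y" "{x,y} = {i,j}" for x y
  proof -
    let ?b = "\<lambda>l n. if l = x then (b x n)\<^sup>2 else b l n"
    have D: "{..<6} - {y} = insert x ?D" "x \<notin> ?D" using that by auto
    have *: "(\<Prod>l\<in>?D. if l = x then A l else B l) = (\<Prod>l\<in>?D. B l)" for A B :: "nat \<Rightarrow> real"
      using D(2) by (intro prod.cong) auto
    have s: "(\<Sum>n\<in>?I. ?b l n) = (if l = x then (\<Sum>n\<in>?I. (b x n)\<^sup>2) else (\<Sum>n\<in>?I. b l n))" for l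
      by simp
    have l2: "(\<Sum>n\<in>?I. (b x n)\<^sup>2) = (L2_set (b x) ?I)\<^sup>2"
      unfolding L2_set_def by (rule real_sqrt_pow2[symmetric]) (simp add: sum_nonneg)
    have "(\<Sum>n\<in>tuples K. (b x (n x))\<^sup>2 * P n) = (\<Sum>n\<in>tuples K. \<Prod>l\<in>{..<6}-{y}. ?b l (n l))"
      unfolding D P_def using D(2) by (intro sum.cong refl) (subst prod.insert; simp add: *)
    also have "\<dots> \<le> (\<Prod>l\<in>{..<6}-{y}. \<Sum>n\<in>?I. ?b l n)"
      by (rule sum_tuples_le) (use that b in auto)
    also have "\<dots> = (L2_set (b x) ?I)\<^sup>2 * Q"
      unfolding D Q_def s using D(2) by (subst prod.insert) (simp_all add: * l2)
    finally show ?thesis .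
  qed
  have "(\<Sum>n\<in>tuples K. \<Prod>l<6. b l (n l)) =
     (\<Sum>n\<in>tuples K. \<bar>b i (n i) * sqrt (P n)\<bar> * \<bar>b j (n j) * sqrt (P n)\<bar>)"
  proof (intro sum.cong refl)
    fix n
    have "P n = sqrt (P n) * sqrt (P n)" using P0 by simp
    then show "(\<Prod>l<6. b l (n l)) = \<bar>b i (n i) * sqrt (P n)\<bar> * \<bar>b j (n j) * sqrt (P n)\<bar>"
      using prod_remove_pair[OF ij, of "\<lambda>l. b l (n l)"] by (simp add: P_def[symmetric] abs_mult b P0)
  qed
  also have "\<dots> \<le> L2_set (\<lambda>n. b i (n i) * sqrt (P n)) (tuples K) * L2_set (\<lambda>n. b j (n j) * sqrt (P n)) (tuples K)"
    by (rule L2_set_mult_ineq)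
  also have "\<dots> \<le> (L2_set (b i) ?I * sqrt Q) * (L2_set (b j) ?I * sqrt Q)"
  proof -
    have "L2_set (\<lambda>n. b x (n x) * sqrt (P n)) (tuples K) \<le> L2_set (b x) ?I * sqrt Q"
      if "x < 6" "y < 6" "x \<noteq> y" "{x,y} = {i,j}" for x y
    proof -
      have "L2_set (\<lambda>n. b x (n x) * sqrt (P n)) (tuples K) \<le> sqrt ((L2_set (b x) ?I)\<^sup>2 * Q)"
        unfolding L2_set_def[of _ "tuples K"] using half[OF that]
        by (intro real_sqrt_le_mono) (simp add: power_mult_distrib P0)
      then show ?thesis by (simp add: real_sqrt_mult)
    qed
    from this[of i j] this[of j i] ij show ?thesis by (intro mult_mono) (auto simp: Q0)
  qed
  also have "\<dots> = L2_set (b i) ?I * L2_set (b j) ?I * Q"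
    using Q0 by simp
  finally show ?thesis unfolding Q_def .
qed

text \<open>The symbols of this weight give forms bounded on \<open>H\<^sup>s\<close>: two slots are taken in \<open>\<ell>\<^sup>2\<close> with weight
  \<open>jap\<^sup>s\<close>, the other four in \<open>\<ell>\<^sup>1\<close> with weight \<open>jap\<^bsup>s-1\<^esup>\<close>, which \<open>H\<^sup>s\<close> controls.\<close>

definition pair_wt :: "nat \<Rightarrow> (nat \<Rightarrow> int) \<Rightarrow> real" where
  "pair_wt s n = (\<Sum>i<6. \<Sum>j\<in>{..<6}-{i}. jap (n i) * jap (n j) * (\<Prod>l<6. jap (n l) ^ (s - 1)))"

definition sextic :: "nat \<Rightarrow> ((nat \<Rightarrow> int) \<Rightarrow> real) \<Rightarrow> (nat \<Rightarrow> int \<Rightarrow> complex) \<Rightarrow> complex" where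
  "sextic K r a = (\<Sum>n\<in>tuples K. of_real (r n) * (\<Prod>j<6. a j (n j)))"

definition symb_le :: "((nat \<Rightarrow> int) \<Rightarrow> real) \<Rightarrow> nat \<Rightarrow> real \<Rightarrow> bool" where
  "symb_le r s C \<longleftrightarrow> (\<forall>n. zero_mom n \<longrightarrow> \<bar>r n\<bar> \<le> C * pair_wt s n)"

lemma pair_wt_nonneg [simp]: "0 \<le> pair_wt s n"
  unfolding pair_wt_def by (intro sum_nonneg mult_nonneg_nonneg prod_nonneg) auto

text \<open>The \<open>30\<close> ordered pairs of slots in \<open>pair_wt\<close> each cost
  \<open>3 ^ 4 = 81\<close>, one embedding constant for each of the four slots taken in
  \<open>l^1\<close>; hence \<open>2430\<close>.\<close>

lemma sextic_bound:
  assumes r: "symb_le r s C" and s: "1 \<le> s" and C: "0 \<le> C"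
  shows "cmod (sextic K r a) \<le> 2430 * C * (\<Prod>j<6. hnorm K s (a j))"
proof -
  let ?I = "(freqs K)"
  \<comment> \<open>The slots \<open>i\<close> and \<open>j\<close> keep the full weight of order
    \<open>s\<close>; the others give up one power of \<open>jap\<close>, which pays for their
    summability.\<close>
  define b where "b i j l n = (if l = i \<or> l = j then jap n else 1) * (jap n ^ (s - 1) * cmod (a l n))"
    for i j l :: nat and n
  have s': "jap n ^ s = jap n * jap n ^ (s - 1)" for n
    using s by (metis One_nat_def Suc_pred le_simps(3) less_eq_Suc_le power_Suc)
  have one: "(\<Sum>n\<in>tuples K. \<Prod>l<6. b i j l (n l)) \<le> 81 * (\<Prod>j<6. hnorm K s (a j))"
    if ij: "i < 6" "j < 6" "i \<noteq> j" for i j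
  proof -
    let ?D = "{..<6}-{i,j}"
    have card: "card ?D = 4" using ij by (subst card_Diff_subset) auto
    have h: "L2_set (b i j i) ?I = hnorm K s (a i)" "L2_set (b i j j) ?I = hnorm K s (a j)"
      unfolding hnorm_def b_def by (simp_all add: s' mult.assoc)
    have l: "(\<Sum>n\<in>?I. b i j l n) \<le> 3 * hnorm K s (a l)" if "l \<in> ?D" for l
    proof -
      have "(\<Sum>n\<in>?I. b i j l n) = (\<Sum>n\<in>?I. cmod (of_real (jap n ^ (s - 1)) * a l n))"
        using that by (intro sum.cong) (auto simp: b_def norm_mult norm_power)
      also have "\<dots> \<le> 3 * hnorm K 1 (\<lambda>n. of_real (jap n ^ (s - 1)) * a l n)"
        by (rule l1_le_hnorm)
      also have "hnorm K 1 (\<lambda>n. of_real (jap n ^ (s - 1)) * a l n) = hnorm K s (a l)"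
        unfolding hnorm_def by (intro L2_set_cong) (auto simp: s' norm_mult norm_power)
      finally show ?thesis .
    qed
    have "(\<Sum>n\<in>tuples K. \<Prod>l<6. b i j l (n l))
        \<le> L2_set (b i j i) ?I * L2_set (b i j j) ?I * (\<Prod>l\<in>?D. \<Sum>n\<in>?I. b i j l n)"
      by (rule sum_tuples_l2_l1) (use ij in \<open>auto simp: b_def\<close>)
    also have "\<dots> \<le> hnorm K s (a i) * hnorm K s (a j) * (\<Prod>l\<in>?D. 3 * hnorm K s (a l))"
      unfolding h using l
      by (intro mult_left_mono prod_mono) (auto simp: b_def intro!: sum_nonneg)
    also have "\<dots> = 81 * (\<Prod>j<6. hnorm K s (a j))"
      unfolding prod_remove_pair[OF ij] by (simp add: prod.distrib card)
    finally show ?thesis .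
  qed
  have "cmod (sextic K r a) \<le> (\<Sum>n\<in>tuples K. C * pair_wt s n * (\<Prod>j<6. cmod (a j (n j))))"
    unfolding sextic_def
  proof (intro sum_norm_le)
    fix n assume "n \<in> tuples K"
    then have "\<bar>r n\<bar> \<le> C * pair_wt s n" using r tuplesD(2) unfolding symb_le_def by blast
    then show "cmod (complex_of_real (r n) * (\<Prod>j<6. a j (n j))) \<le> C * pair_wt s n * (\<Prod>j<6. cmod (a j (n j)))"
      by (simp add: norm_mult prod_norm[symmetric] mult_right_mono prod_nonneg)
  qed
  also have "\<dots> = C * (\<Sum>i<6. \<Sum>j\<in>{..<6}-{i}. \<Sum>n\<in>tuples K. \<Prod>l<6. b i j l (n l))"
  proof -
    have e: "pair_wt s n * (\<Prod>j<6. cmod (a j (n j))) = (\<Sum>i<6. \<Sum>j\<in>{..<6}-{i}. \<Prod>l<6. b i j l (n l))" for n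
      unfolding pair_wt_def sum_distrib_right
    proof (intro sum.cong refl)
      fix i j :: nat assume ij: "i \<in> {..<6}" "j \<in> {..<6} - {i}"
      have "(\<Prod>l<6. if l = i \<or> l = j then jap (n l) else 1) = jap (n i) * jap (n j)"
      proof -
        have "(\<Prod>l<6. if l = i \<or> l = j then jap (n l) else 1) = (\<Prod>l\<in>{i,j}. jap (n l))"
          using ij by (intro prod.mono_neutral_cong_right) auto
        then show ?thesis using ij by auto
      qed
      then show "jap (n i) * jap (n j) * (\<Prod>l<6. jap (n l) ^ (s - 1)) * (\<Prod>j<6. cmod (a j (n j)))
         = (\<Prod>l<6. b i j l (n l))"
        unfolding b_def by (simp add: prod.distrib)
    qed
    have "(\<Sum>n\<in>tuples K. C * pair_wt s n * (\<Prod>j<6. cmod (a j (n j))))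
       = C * (\<Sum>n\<in>tuples K. \<Sum>i<6. \<Sum>j\<in>{..<6}-{i}. \<Prod>l<6. b i j l (n l))"
      by (simp add: mult.assoc e sum_distrib_left)
    also have "\<dots> = C * (\<Sum>i<6. \<Sum>j\<in>{..<6}-{i}. \<Sum>n\<in>tuples K. \<Prod>l<6. b i j l (n l))"
      by (subst sum.swap, subst (2) sum.swap) simp
    finally show ?thesis .
  qed
  also have "\<dots> \<le> C * (\<Sum>i<6::nat. \<Sum>j\<in>{..<6}-{i}. 81 * (\<Prod>j<6. hnorm K s (a j)))"
    using one by (intro mult_left_mono sum_mono C) auto
  also have "\<dots> = 2430 * C * (\<Prod>j<6. hnorm K s (a j))"
  proof -
    have "(\<Sum>i<6::nat. \<Sum>j\<in>{..<6}-{i}. x) = 30 * x" for x :: real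
      by (subst sum.cong[OF refl, of _ _ "\<lambda>_. 5 * x"]) (auto simp: card_Diff_subset)
    then show ?thesis by simp
  qed
  finally show ?thesis .
qed

section \<open>The quintic convolution\<close>

text \<open>Hybrid products: in the \<open>i\<close>-th term the slots before \<open>i\<close> are
  already exchanged and only slot \<open>i\<close> carries a difference.\<close>

lemma prod_diff_telescope:
  fixes a b :: "nat \<Rightarrow> 'a::comm_ring_1"
  shows "(\<Prod>j<N. a j) - (\<Prod>j<N. b j) =
    (\<Sum>i<N. \<Prod>j<N. if j < i then b j else if j = i then a i - b i else a j)"
proof (induction N)
  case (Suc N)
  let ?f = "\<lambda>i j. if j < i then b j else if j = i then a i - b i else a j"
  have 1: "(\<Prod>j<Suc N. ?f i j) = (\<Prod>j<N. ?f i j) * a N" if "i < N" for i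
    using that by simp
  have 2: "(\<Prod>j<Suc N. ?f N j) = (\<Prod>j<N. b j) * (a N - b N)"
    by simp
  have "(\<Sum>i<Suc N. \<Prod>j<Suc N. ?f i j) = (\<Sum>i<N. (\<Prod>j<N. ?f i j) * a N) + (\<Prod>j<N. b j) * (a N - b N)"
    unfolding sum.lessThan_Suc 2 using 1 by (intro arg_cong2[of _ _ _ _ "(+)"] sum.cong) auto
  also have "(\<Sum>i<N. (\<Prod>j<N. ?f i j) * a N) = ((\<Prod>j<N. a j) - (\<Prod>j<N. b j)) * a N"
    by (simp only: Suc sum_distrib_right)
  finally show ?case by (simp add: algebra_simps)
qed simp

lemma sextic_diff_telescope:
  "sextic K r a - sextic K r b =
    (\<Sum>i<6. sextic K r (\<lambda>j. if j < i then b j else if j = i then (\<lambda>n. a i n - b i n) else a j))"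
proof -
  have "sextic K r a - sextic K r b = (\<Sum>n\<in>tuples K. of_real (r n) *
     (\<Sum>i<6. \<Prod>j<6. if j < i then b j (n j) else if j = i then a i (n i) - b i (n i) else a j (n j)))"
    unfolding sextic_def by (simp add: prod_diff_telescope flip: sum_subtractf right_diff_distrib)
  also have "\<dots> = (\<Sum>i<6. sextic K r (\<lambda>j. if j < i then b j else if j = i then (\<lambda>n. a i n - b i n) else a j))"
    unfolding sextic_def sum_distrib_left
    by (subst sum.swap) (intro sum.cong prod.cong refl arg_cong2[of _ _ _ _ "(*)"], auto)
  finally show ?thesis .
qed

text \<open>The bounds \<open>B\<close> and \<open>D\<close> vary with the slot because the duality
  argument for the convolution puts a test sequence into slot \<open>5\<close>, which is the same in
  both forms and has its own norm.\<close>

lemma sextic_lipschitz: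
  assumes r: "symb_le r s C" and s: "1 \<le> s" and C: "0 \<le> C"
    and a: "\<And>j. j < 6 \<Longrightarrow> hnorm K s (a j) \<le> B j" and b: "\<And>j. j < 6 \<Longrightarrow> hnorm K s (b j) \<le> B j"
    and D: "\<And>j. j < 6 \<Longrightarrow> hnorm K s (\<lambda>n. a j n - b j n) \<le> D j"
  shows "cmod (sextic K r a - sextic K r b) \<le> 2430 * C * (\<Sum>i<6. D i * (\<Prod>j\<in>{..<6}-{i}. B j))"
proof -
  have "cmod (sextic K r (\<lambda>j. if j < i then b j else if j = i then (\<lambda>n. a i n - b i n) else a j))
      \<le> 2430 * C * (D i * (\<Prod>j\<in>{..<6}-{i}. B j))" (is "cmod (sextic K r ?c) \<le> _") if i: "i < 6" for i
  proof -
    have "cmod (sextic K r ?c) \<le> 2430 * C * (\<Prod>j<6. hnorm K s (?c j))"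
      by (rule sextic_bound[OF r s C])
    also have "(\<Prod>j<6. hnorm K s (?c j)) = hnorm K s (?c i) * (\<Prod>j\<in>{..<6}-{i}. hnorm K s (?c j))"
      using i by (simp add: prod.remove)
    also have "\<dots> \<le> D i * (\<Prod>j\<in>{..<6}-{i}. B j)"
      using a b D i order_trans[OF hnorm_nonneg D[OF i]]
      by (intro mult_mono prod_mono prod_nonneg) auto
    finally show ?thesis using C by (simp add: mult_left_mono)
  qed
  then show ?thesis
    unfolding sextic_diff_telescope sum_distrib_left by (intro sum_norm_le) auto
qed

definition trunc :: "nat \<Rightarrow> (int \<Rightarrow> complex) \<Rightarrow> int \<Rightarrow> complex" where
  "trunc K a n = (if n \<in> (freqs K) then a n else 0)"

definition entries :: "(int \<Rightarrow> complex) \<Rightarrow> nat \<Rightarrow> int \<Rightarrow> complex" where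
  "entries a j = (if j < 3 then a else (\<lambda>n. cnj (a n)))"

lemma hnorm_entries [simp]: "hnorm K s (entries a j) = hnorm K s a"
  by (simp add: entries_def)

lemma entries_diff: "entries (\<lambda>n. a n - b n) j = (\<lambda>n. entries a j n - entries b j n)"
  by (auto simp: entries_def)

lemma entries_trunc: "entries (trunc K a) j = trunc K (entries a j)"
  by (auto simp: entries_def trunc_def)

lemma hnorm_trunc_le: "hnorm J s (trunc K a) \<le> hnorm K s a"
proof -
  have "(\<Sum>n\<in>{- int J..int J}. (jap n ^ s * cmod (trunc K a n))\<^sup>2)
      = (\<Sum>n\<in>{- int J..int J} \<inter> (freqs K). (jap n ^ s * cmod (a n))\<^sup>2)"
    by (rule sum.mono_neutral_cong_right) (auto simp: trunc_def)
  also have "\<dots> \<le> (\<Sum>n\<in>freqs K. (jap n ^ s * cmod (a n))\<^sup>2)"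
    by (rule sum_mono2) auto
  finally show ?thesis unfolding hnorm_def L2_set_def by simp
qed

lemma sextic_trunc:
  assumes "K \<le> J"
  shows "sextic J r (\<lambda>j. trunc K (a j)) = sextic K r a"
  unfolding sextic_def
proof (rule sum.mono_neutral_cong_right)
  show "\<forall>n\<in>tuples J - tuples K. complex_of_real (r n) * (\<Prod>j<6. trunc K (a j) (n j)) = 0"
  proof
    fix n assume n: "n \<in> tuples J - tuples K"
    then have "\<exists>j<6. n j \<notin> (freqs K)"
      unfolding tuples_def by (auto simp: PiE_iff)
    then show "complex_of_real (r n) * (\<Prod>j<6. trunc K (a j) (n j)) = 0"
      by (auto simp: trunc_def)
  qed
next
  fix n assume "n \<in> tuples K"
  then have "(\<Prod>j<6. trunc K (a j) (n j)) = (\<Prod>j<6. a j (n j))"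
    using tuplesD(1) by (intro prod.cong refl) (auto simp: trunc_def simp del: atLeastAtMost_iff)
  then show "complex_of_real (r n) * (\<Prod>j<6. trunc K (a j) (n j)) = complex_of_real (r n) * (\<Prod>j<6. a j (n j))"
    by simp
qed (simp_all add: tuples_mono[OF assms])

lemma sextic_cong:
  assumes "\<And>j n. j < 6 \<Longrightarrow> n \<in> (freqs K) \<Longrightarrow> a j n = b j n"
    and "\<And>n. zero_mom n \<Longrightarrow> r n = q n"
  shows "sextic K r a = sextic K q b"
  unfolding sextic_def using assms tuplesD
  by (intro sum.cong arg_cong2[of _ _ _ _ "(*)"] prod.cong) auto

text \<open>The Fourier coefficients of \<open>|w|\<^sup>4 w\<close> at frequencies \<open>|n| \<le> K\<close>, where \<open>w\<close> is the trigonometric polynomial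
  with coefficients \<open>a\<close> cut off at \<open>K\<close>.\<close>

definition qconv :: "nat \<Rightarrow> (int \<Rightarrow> complex) \<Rightarrow> int \<Rightarrow> complex" where
  "qconv K a n = trunc K (\<lambda>n. sextic K (\<lambda>_. 1) ((entries a)(5 := (\<lambda>i. if i = n then 1 else 0)))) n"

lemma lessThan6: "{..<6::nat} = insert 5 {..<5}" by auto

text \<open>The unit sequence in slot \<open>5\<close> picks out the tuples with last frequency
  \<open>n\<close>; summing against \<open>b\<close> reassembles a sextic form. A weight on the
  output frequency thereby becomes a symbol, which is what the duality argument and the energy
  computation use.\<close>

lemma sum_qconv:
  "(\<Sum>n\<in>freqs K. of_real (w n) * b n * qconv K a n) =
   sextic K (\<lambda>n. w (n 5)) ((entries a)(5 := b))"
proof -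
  let ?I = "(freqs K)"
  have "(\<Sum>n\<in>?I. of_real (w n) * b n * qconv K a n)
     = (\<Sum>n\<in>?I. \<Sum>p\<in>tuples K. (if p 5 = n then of_real (w (p 5)) * (b (p 5) * (\<Prod>j<5. entries a j (p j))) else 0))"
  proof (intro sum.cong refl)
    fix n assume n: "n \<in> ?I"
    have "of_real (w n) * b n * qconv K a n = (\<Sum>p\<in>tuples K. of_real (w n) * b n * (\<Prod>j<6. ((entries a)(5 := (\<lambda>i. if i = n then 1 else 0))) j (p j)))"
      using n unfolding qconv_def trunc_def sextic_def by (simp add: sum_distrib_left)
    also have "\<dots> = (\<Sum>p\<in>tuples K. (if p 5 = n then of_real (w (p 5)) * (b (p 5) * (\<Prod>j<5. entries a j (p j))) else 0))"
      by (intro sum.cong refl) (auto simp: lessThan6 intro!: prod.cong)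
    finally show "of_real (w n) * b n * qconv K a n = \<dots>" .
  qed
  also have "\<dots> = (\<Sum>p\<in>tuples K. of_real (w (p 5)) * (b (p 5) * (\<Prod>j<5. entries a j (p j))))"
    by (subst sum.swap) (intro sum.cong refl, simp add: tuplesD(1)[unfolded atLeastAtMost_iff])
  also have "\<dots> = sextic K (\<lambda>n. w (n 5)) ((entries a)(5 := b))"
    unfolding sextic_def by (intro sum.cong refl) (auto simp: lessThan6 intro!: prod.cong)
  finally show ?thesis .
qed

section \<open>The pair weight and the comparability of the two largest frequencies\<close>

lemma pair_wt_ge:
  assumes "i < 6" "j < 6" "i \<noteq> j"
  shows "jap (n i) * jap (n j) * (\<Prod>l<6. jap (n l) ^ (s - 1)) \<le> pair_wt s n"
proof -
  have "jap (n i) * jap (n j) * (\<Prod>l<6. jap (n l) ^ (s - 1)) \<le>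
     (\<Sum>j\<in>{..<6}-{i}. jap (n i) * jap (n j) * (\<Prod>l<6. jap (n l) ^ (s - 1)))"
    by (rule member_le_sum) (use assms in \<open>auto intro!: mult_nonneg_nonneg prod_nonneg\<close>)
  also have "\<dots> \<le> pair_wt s n"
    unfolding pair_wt_def
    by (rule member_le_sum[where f="\<lambda>i. \<Sum>j\<in>{..<6}-{i}. jap (n i) * jap (n j) * (\<Prod>l<6. jap (n l) ^ (s - 1))"])
       (use assms in \<open>auto intro!: mult_nonneg_nonneg prod_nonneg sum_nonneg\<close>)
  finally show ?thesis .
qed

lemma prod_jap_ge:
  assumes "L \<subseteq> {..<6::nat}"
  shows "(\<Prod>l\<in>L. jap (n l) ^ e) \<le> (\<Prod>l<6. jap (n l) ^ e)"
  by (rule prod_mono2) (use assms in \<open>auto simp: jap_ge_1 one_le_power\<close>)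

lemma pair_wt_ge_pair:
  assumes "i < 6" "j < 6" "i \<noteq> j" "1 \<le> s"
  shows "jap (n i) ^ s * jap (n j) ^ s \<le> pair_wt s n"
proof -
  have "jap (n i) ^ s * jap (n j) ^ s = jap (n i) * jap (n j) * (\<Prod>l\<in>{i,j}. jap (n l) ^ (s - 1))"
    using assms by (cases s) auto
  also have "\<dots> \<le> jap (n i) * jap (n j) * (\<Prod>l<6. jap (n l) ^ (s - 1))"
    using assms prod_jap_ge[of "{i,j}" n "s - 1"] by (simp add: mult_left_mono)
  also have "\<dots> \<le> pair_wt s n" by (rule pair_wt_ge) fact+
  finally show ?thesis .
qed

lemma pair_wt_mono: "s \<le> s' \<Longrightarrow> pair_wt s n \<le> pair_wt s' n"
  unfolding pair_wt_def
  by (intro sum_mono mult_left_mono prod_mono conjI power_increasing jap_ge_1) auto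

lemma zero_mom_jap_le:
  assumes "zero_mom n" "i < 6"
  shows "jap (n i) \<le> (\<Sum>l\<in>{..<6}-{i}. jap (n l))"
proof -
  have "csign i * n i = - (\<Sum>l\<in>{..<6}-{i}. csign l * n l)"
    using assms sum.remove[of "{..<6}" i "\<lambda>l. csign l * n l"] unfolding zero_mom_def by simp
  then have "csign i * csign i * n i = - csign i * (\<Sum>l\<in>{..<6}-{i}. csign l * n l)"
    by (simp only: mult.assoc mult_minus_left mult_minus_right)
  then have e: "n i = (\<Sum>l\<in>{..<6}-{i}. - csign i * (csign l * n l))"
    by (simp only: csign_sq mult_1 sum_distrib_left)
  have "(if i = 0 then 1 else 0) \<in> {..<6::nat} - {i}" by auto
  then have "jap (n i) \<le> (\<Sum>l\<in>{..<6}-{i}. jap (- csign i * (csign l * n l)))"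
    by (subst e, intro jap_sum) auto
  also have "\<dots> = (\<Sum>l\<in>{..<6}-{i}. jap (n l))"
    by (intro sum.cong refl) (auto simp: csign_def)
  finally show ?thesis .
qed

lemma finite_maximizer:
  fixes f :: "'a \<Rightarrow> real"
  assumes "finite S" "S \<noteq> {}"
  obtains x where "x \<in> S" "\<And>y. y \<in> S \<Longrightarrow> f y \<le> f x"
proof -
  have "Max (f ` S) \<in> f ` S" using assms by (intro Max_in) auto
  then obtain x where "Max (f ` S) = f x" "x \<in> S" by (rule imageE)
  then show thesis using that assms by (metis Max_ge finite_imageI image_eqI)
qed

text \<open>Zero momentum bounds a bracket by the sum of the other five, hence by five times the
  largest of them. High frequencies therefore come in comparable pairs; this is the source of the
  factors \<open>5 ^ s\<close> and \<open>5 ^ m\<close>.\<close>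

lemma zero_mom_jap_le_other:
  assumes "zero_mom n" "i < 6"
  obtains j where "j < 6" "j \<noteq> i" "jap (n i) \<le> 5 * jap (n j)" "\<And>l. l < 6 \<Longrightarrow> l \<noteq> i \<Longrightarrow> jap (n l) \<le> jap (n j)"
proof -
  let ?S = "{..<6} - {i}"
  have ne: "?S \<noteq> {}" "finite ?S"
  proof -
    have "(if i = 0 then 1 else 0) \<in> {..<6::nat} - {i}" by auto
    then show "?S \<noteq> {}" by blast
  qed simp
  obtain j where j: "j \<in> ?S" "\<And>l. l \<in> ?S \<Longrightarrow> jap (n l) \<le> jap (n j)"
    using finite_maximizer[OF ne(2,1), where f="\<lambda>l. jap (n l)"] by blast
  have "jap (n i) \<le> (\<Sum>l\<in>?S. jap (n l))" by (rule zero_mom_jap_le) fact+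
  also have "\<dots> \<le> (\<Sum>l\<in>?S. jap (n j))" by (intro sum_mono j(2))
  also have "\<dots> = 5 * jap (n j)" using assms by simp
  finally show thesis using that[of j] j by auto
qed

text \<open>Half of the \<open>2 * s\<close> powers move to a second slot of comparable size, so a
  weight on one slot fits the pair weight. This is the algebra property of \<open>H^s\<close> in
  dual form.\<close>

lemma symb_le_jap_power:
  assumes "j < 6" "1 \<le> s"
  shows "symb_le (\<lambda>n. jap (n j) ^ (2 * s)) s (5 ^ s)"
  unfolding symb_le_def
proof (intro allI impI)
  fix n assume "zero_mom n"
  then obtain l where l: "l < 6" "l \<noteq> j" "jap (n j) \<le> 5 * jap (n l)"
    using zero_mom_jap_le_other assms by blast
  have "jap (n j) ^ (2 * s) = jap (n j) ^ s * jap (n j) ^ s"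
    by (simp add: mult_2 power_add)
  also have "\<dots> \<le> jap (n j) ^ s * (5 * jap (n l)) ^ s"
    using l by (intro mult_left_mono power_mono) auto
  also have "\<dots> = 5 ^ s * (jap (n j) ^ s * jap (n l) ^ s)"
    by (simp add: power_mult_distrib)
  also have "\<dots> \<le> 5 ^ s * pair_wt s n"
    using assms l by (intro mult_left_mono pair_wt_ge_pair) auto
  finally show "\<bar>jap (n j) ^ (2 * s)\<bar> \<le> 5 ^ s * pair_wt s n" by simp
qed

text \<open>By duality: the squared norm of the difference is a difference of two sextic forms with symbol
  \<open>jap\<^bsup>2s\<^esup>\<close> in the last slot, which contains the conjugate of the difference itself.\<close>

lemma qconv_lipschitz:
  assumes s: "1 \<le> s" and a: "hnorm K s a \<le> B" and b: "hnorm K s b \<le> B"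
    and D: "hnorm K s (\<lambda>n. a n - b n) \<le> D"
  shows "hnorm K s (\<lambda>n. qconv K a n - qconv K b n) \<le> 12150 * 5 ^ s * D * B ^ 4"
proof -
  define d where "d n = qconv K a n - qconv K b n" for n
  define w where "w n = jap n ^ (2 * s)" for n
  let ?d = "\<lambda>n. cnj (d n)"
  let ?I = "(freqs K)"
  have B0: "0 \<le> B" and D0: "0 \<le> D" using order_trans[OF hnorm_nonneg] a D by blast+
  have "complex_of_real ((hnorm K s d)\<^sup>2) = (\<Sum>n\<in>?I. of_real (w n) * ?d n * d n)"
    unfolding hnorm_sq w_def of_real_sum
    by (intro sum.cong refl)
       (simp add: power_mult_distrib complex_norm_square power_mult[symmetric] mult_ac flip: of_real_power)
  also have "\<dots> = (\<Sum>n\<in>?I. of_real (w n) * ?d n * qconv K a n) - (\<Sum>n\<in>?I. of_real (w n) * ?d n * qconv K b n)"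
    unfolding d_def[of n for n] by (simp add: right_diff_distrib sum_subtractf)
  also have "\<dots> = sextic K (\<lambda>n. w (n 5)) ((entries a)(5 := ?d)) - sextic K (\<lambda>n. w (n 5)) ((entries b)(5 := ?d))"
    by (simp only: sum_qconv)
  finally have eq: "complex_of_real ((hnorm K s d)\<^sup>2) = \<dots>" .
  have "(hnorm K s d)\<^sup>2 = cmod (complex_of_real ((hnorm K s d)\<^sup>2))"
    by (simp only: norm_of_real abs_power2)
  also have "\<dots> \<le> 2430 * 5 ^ s * (\<Sum>i<6::nat. (if i = 5 then 0 else D) * (\<Prod>j\<in>{..<6}-{i}. if j = 5 then hnorm K s d else B))"
    unfolding eq w_def
  proof (rule sextic_lipschitz)
    show "symb_le (\<lambda>n. jap (n 5) ^ (2 * s)) s (5 ^ s)" by (rule symb_le_jap_power) (use s in auto)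
    show "hnorm K s (\<lambda>n. ((entries a)(5 := ?d)) j n - ((entries b)(5 := ?d)) j n) \<le> (if j = 5 then 0 else D)" for j
    proof (cases "j = 5")
      case True
      then show ?thesis by (simp add: hnorm_def L2_set_def)
    next
      case False
      then show ?thesis using D by (simp flip: entries_diff)
    qed
  qed (use a b s in auto)
  \<comment> \<open>Slot \<open>5\<close> holds the same sequence in both forms and drops out, which
    leaves five terms: \<open>12150 = 5 * 2430\<close>.\<close>
  also have "(\<Sum>i<6::nat. (if i = 5 then 0 else D) * (\<Prod>j\<in>{..<6}-{i}. if j = 5 then hnorm K s d else B))
     = (\<Sum>i<5::nat. D * (hnorm K s d * B ^ 4))"
  proof -
    have p: "(\<Prod>j\<in>{..<6}-{i}. if j = 5 then hnorm K s d else B) = hnorm K s d * B ^ 4" if "i < 5" for i :: nat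
    proof -
      have e: "{..<6} - {i} = insert 5 ({..<5} - {i})" using that by auto
      have "(\<Prod>j\<in>{..<5}-{i}. if j = 5 then hnorm K s d else B) = (\<Prod>j\<in>{..<5}-{i}. B)"
        by (intro prod.cong) auto
      then show ?thesis unfolding e using that by simp
    qed
    have "(\<Sum>i<6::nat. (if i = 5 then 0 else D) * (\<Prod>j\<in>{..<6}-{i}. if j = 5 then hnorm K s d else B))
      = (\<Sum>i<5::nat. (if i = 5 then 0 else D) * (\<Prod>j\<in>{..<6}-{i}. if j = 5 then hnorm K s d else B))"
      unfolding lessThan6 by simp
    also have "\<dots> = (\<Sum>i<5::nat. D * (hnorm K s d * B ^ 4))"
      using p by (intro sum.cong) auto
    finally show ?thesis .
  qed
  finally have "hnorm K s d * hnorm K s d \<le> (12150 * 5 ^ s * D * B ^ 4) * hnorm K s d"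
    by (simp add: power2_eq_square mult_ac)
  \<comment> \<open>The common factor is cancelled unless it is zero, in which case the bound is
    trivial.\<close>
  then have "hnorm K s d \<le> 12150 * 5 ^ s * D * B ^ 4 \<or> hnorm K s d = 0"
    using hnorm_nonneg[of K s d] by (metis mult_right_le_imp_le order_le_less)
  then show ?thesis unfolding d_def[symmetric] using B0 D0 by auto
qed

text \<open>This presents \<open>qconv K a\<close>, on the modes up to \<open>K\<close>, as the
  quintic limit of the data \<open>trunc K a\<close>. Truncation inside the nonlinearity thus falls
  under the Lipschitz estimate.\<close>

lemma qconv_trunc:
  assumes "K \<le> J" "n \<in> (freqs K)"
  shows "qconv J (trunc K a) n = qconv K a n"
proof -
  have "qconv J (trunc K a) n = sextic J (\<lambda>_. 1) ((entries (trunc K a))(5 := (\<lambda>i. if i = n then 1 else 0)))"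
    using assms by (auto simp: qconv_def trunc_def)
  also have "\<dots> = sextic J (\<lambda>_. 1) (\<lambda>j. trunc K (((entries a)(5 := (\<lambda>i. if i = n then 1 else 0))) j))"
    using assms by (intro sextic_cong) (auto simp: entries_trunc trunc_def)
  also have "\<dots> = qconv K a n"
    using assms by (simp add: sextic_trunc qconv_def fun_upd_def trunc_def)
  finally show ?thesis .
qed

text \<open>Coefficientwise convergence is all that is asked of the full quintic term: every norm
  estimate concerns finitely many modes and so passes to the limit. It also keeps the multilinear
  part free of functions on the torus.\<close>

definition quintic_lim :: "(int \<Rightarrow> complex) \<Rightarrow> (int \<Rightarrow> complex) \<Rightarrow> bool" where
  "quintic_lim a v \<longleftrightarrow> (\<forall>n. (\<lambda>J. qconv J a n) \<longlonglongrightarrow> v n)"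

lemma hnorm_tendsto:
  assumes "\<And>n. n \<in> (freqs K) \<Longrightarrow> (\<lambda>J. f J n) \<longlonglongrightarrow> g n"
  shows "(\<lambda>J. hnorm K s (f J)) \<longlonglongrightarrow> hnorm K s g"
  unfolding hnorm_def L2_set_def
  by (intro tendsto_intros tendsto_real_sqrt assms) auto

text \<open>The limits are required only on the window of the conclusion because in the error
  estimate one of them is \<open>qconv K\<close>, which is the limit for truncated data only at
  frequencies up to \<open>K\<close>.\<close>

lemma hnorm_quintic_lim_lipschitz:
  assumes s: "1 \<le> s" and a: "\<And>K. hnorm K s a \<le> B" and b: "\<And>K. hnorm K s b \<le> B"
    and D: "\<And>K. hnorm K s (\<lambda>n. a n - b n) \<le> D"
    and u: "\<And>n. n \<in> (freqs K) \<Longrightarrow> (\<lambda>J. qconv J a n) \<longlonglongrightarrow> u n"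
    and v: "\<And>n. n \<in> (freqs K) \<Longrightarrow> (\<lambda>J. qconv J b n) \<longlonglongrightarrow> v n"
  shows "hnorm K s (\<lambda>n. u n - v n) \<le> 12150 * 5 ^ s * D * B ^ 4"
proof (rule LIMSEQ_le_const2)
  show "(\<lambda>J. hnorm K s (\<lambda>n. qconv J a n - qconv J b n)) \<longlonglongrightarrow> hnorm K s (\<lambda>n. u n - v n)"
    using u v by (intro hnorm_tendsto tendsto_diff) auto
  show "\<exists>N. \<forall>J\<ge>N. hnorm K s (\<lambda>n. qconv J a n - qconv J b n) \<le> 12150 * 5 ^ s * D * B ^ 4"
    using order_trans[OF hnorm_mono_K qconv_lipschitz[OF s a b D]] by blast
qed

lemma qconv_zero [simp]: "qconv K (\<lambda>n. 0) n = 0"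
proof -
  have "sextic K (\<lambda>_. 1) ((entries (\<lambda>n. 0))(5 := b)) = 0" for b
    unfolding sextic_def by (intro sum.neutral ballI) (auto simp: entries_def intro!: bexI[of _ 0])
  then show ?thesis by (simp add: qconv_def trunc_def)
qed

lemma hnorm_quintic_lim_bound:
  assumes s: "1 \<le> s" and a: "\<And>K. hnorm K s a \<le> B" and u: "quintic_lim a u"
  shows "hnorm K s u \<le> 12150 * 5 ^ s * B ^ 5"
proof -
  have B: "0 \<le> B" using order_trans[OF hnorm_nonneg a] .
  have "hnorm K s (\<lambda>n. 0) \<le> B" for K using B by (simp add: hnorm_def L2_set_def)
  then have "hnorm K s (\<lambda>n. u n - 0) \<le> 12150 * 5 ^ s * B * B ^ 4"
    using a u unfolding quintic_lim_def by (intro hnorm_quintic_lim_lipschitz[OF s a, of "\<lambda>n. 0"]) auto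
  then show ?thesis by (simp add: numeral_eq_Suc mult_ac)
qed

section \<open>Symbols of the normal form\<close>

definition psi :: "nat \<Rightarrow> (nat \<Rightarrow> int) \<Rightarrow> real" where
  "psi m n = (\<Sum>j<6. of_int (csign j) * jap (n j) ^ (2 * m))"

definition reson :: "(nat \<Rightarrow> int) \<Rightarrow> real" where
  "reson n = (\<Sum>j<6. of_int (csign j) * (of_int (n j))\<^sup>2)"

lemma sum6: "(\<Sum>j<6::nat. f j) = f 0 + f 1 + f 2 + f 3 + f 4 + f 5"
  by (simp add: numeral_eq_Suc)

lemma reson_jap: "reson n = (\<Sum>j<6. of_int (csign j) * (jap (n j))\<^sup>2)"
  by (simp add: reson_def jap_sq csign_def sum6)

text \<open>For opposite signs the factorisation of \<open>x^m - y^m\<close> supplies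
  \<open>q\<close>, also when \<open>x = y\<close> and the denominator vanishes; for equal signs the
  denominator is positive. In both cases the larger number controls \<open>q\<close>.\<close>

lemma two_power_quotient:
  fixes x y :: real
  assumes "0 < y" "y \<le> x" "1 \<le> m"
  shows "\<exists>q. \<bar>q\<bar> \<le> m * x ^ (m - 1) \<and>
    of_int (csign i) * x ^ m + of_int (csign j) * y ^ m = q * (of_int (csign i) * x + of_int (csign j) * y)"
proof (cases "csign i = csign j")
  case True
  have xm: "x ^ m = x ^ (m - 1) * x" "y ^ m = y ^ (m - 1) * y"
    using assms(3) by (cases m; simp)+
  have "y ^ (m - 1) \<le> x ^ (m - 1)" using assms by (intro power_mono) auto
  then have "x ^ m + y ^ m \<le> x ^ (m - 1) * (x + y)"
    unfolding xm using assms by (simp add: algebra_simps mult_right_mono)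
  then have "(x ^ m + y ^ m) / (x + y) \<le> x ^ (m - 1)"
    using assms by (simp add: divide_le_eq)
  also have "\<dots> \<le> m * x ^ (m - 1)" using assms by simp
  finally have "\<bar>(x ^ m + y ^ m) / (x + y)\<bar> \<le> m * x ^ (m - 1)" using assms by simp
  moreover have "of_int (csign i) * x ^ m + of_int (csign j) * y ^ m
      = (x ^ m + y ^ m) / (x + y) * (of_int (csign i) * x + of_int (csign j) * y)"
    using True assms by (simp flip: distrib_left)
  ultimately show ?thesis by blast
next
  case False
  let ?q = "\<Sum>a<m. y ^ (m - Suc a) * x ^ a"
  have e: "csign j = - csign i" using False by (auto simp: csign_def split: if_splits)
  have "?q \<le> (\<Sum>a<m. x ^ (m - 1))"
  proof (rule sum_mono)
    fix a assume a: "a \<in> {..<m}"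
    have "y ^ (m - Suc a) * x ^ a \<le> x ^ (m - Suc a) * x ^ a"
      using assms by (intro mult_right_mono power_mono) auto
    also have "\<dots> = x ^ (m - 1)" using a by (simp flip: power_add)
    finally show "y ^ (m - Suc a) * x ^ a \<le> x ^ (m - 1)" .
  qed
  moreover have "0 \<le> ?q" using assms by (intro sum_nonneg) auto
  moreover have "of_int (csign i) * x ^ m + of_int (csign j) * y ^ m = ?q * (of_int (csign i) * x + of_int (csign j) * y)"
  proof -
    have "of_int (csign i) * x ^ m + of_int (csign j) * y ^ m = of_int (csign i) * (x ^ m - y ^ m)"
      by (simp add: e algebra_simps)
    also have "\<dots> = of_int (csign i) * ((x - y) * ?q)" by (simp only: power_diff_sumr2)
    also have "\<dots> = ?q * (of_int (csign i) * x + of_int (csign j) * y)" by (simp add: e algebra_simps)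
    finally show ?thesis .
  qed
  ultimately show ?thesis by (intro exI[of _ ?q]) auto
qed

text \<open>The third slot carries only \<open>s - 1\<close> powers in the weight, so absorbing a
  square asks for \<open>s - 1 >= 2\<close>.\<close>

lemma pair_wt_ge_triple:
  assumes "i < 6" "j < 6" "l < 6" "i \<noteq> j" "l \<noteq> i" "l \<noteq> j" "3 \<le> s"
  shows "jap (n i) ^ s * jap (n j) ^ s * (jap (n l))\<^sup>2 \<le> pair_wt s n"
proof -
  have s: "jap (n x) ^ s = jap (n x) * jap (n x) ^ (s - 1)" for x
    using assms by (cases s) auto
  have "jap (n i) ^ s * jap (n j) ^ s * (jap (n l))\<^sup>2 \<le> jap (n i) ^ s * jap (n j) ^ s * jap (n l) ^ (s - 1)"
    using assms by (intro mult_left_mono power_increasing jap_ge_1) auto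
  also have "\<dots> = jap (n i) * jap (n j) * (\<Prod>l\<in>{i,j,l}. jap (n l) ^ (s - 1))"
    using assms by (simp add: s)
  also have "\<dots> \<le> jap (n i) * jap (n j) * (\<Prod>l<6. jap (n l) ^ (s - 1))"
    using assms prod_jap_ge[of "{i,j,l}" n "s - 1"] by (simp add: mult_left_mono)
  also have "\<dots> \<le> pair_wt s n" by (rule pair_wt_ge) fact+
  finally show ?thesis .
qed

lemma two_leading_frequencies:
  assumes n: "zero_mom n"
  obtains i j where "i < 6" "j < 6" "i \<noteq> j" "jap (n j) \<le> jap (n i)" "jap (n i) \<le> 5 * jap (n j)"
    "\<And>l. l < 6 \<Longrightarrow> l \<noteq> i \<Longrightarrow> jap (n l) \<le> jap (n j)"
proof -
  have "{..<6::nat} \<noteq> {}" by (simp add: lessThan_empty_iff)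
  then obtain i where i: "i < 6" "\<And>l. l < 6 \<Longrightarrow> jap (n l) \<le> jap (n i)"
    using finite_maximizer[of "{..<6}" "\<lambda>l. jap (n l)"] by (metis finite_lessThan lessThan_iff)
  obtain j where "j < 6" "j \<noteq> i" "jap (n i) \<le> 5 * jap (n j)" "\<And>l. l < 6 \<Longrightarrow> l \<noteq> i \<Longrightarrow> jap (n l) \<le> jap (n j)"
    using zero_mom_jap_le_other[OF n i(1)] by blast
  with i show thesis using that[of i j] by auto
qed

text \<open>With \<open>x = jap\<^sup>2\<close>, the symbol \<open>q\<close> is chosen to cancel the contribution of the two largest frequencies
  exactly, \<open>q = (\<plusminus> x\<^sub>i\<^sup>m \<plusminus> x\<^sub>j\<^sup>m) / (\<plusminus> x\<^sub>i \<plusminus> x\<^sub>j)\<close>.  What remains carries the weight \<open>x\<^sub>l\<close> of a third frequency; this is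
  admissible since \<open>m - 2 \<ge> 2\<close>, and it is the step that fails for \<open>m = 2\<close>.\<close>

lemma normal_form_pointwise:
  assumes n: "zero_mom n" and m: "4 \<le> m"
  shows "\<exists>q. \<bar>q\<bar> \<le> (8 * m * 5 ^ m) * pair_wt (m - 1) n \<and> \<bar>psi m n - reson n * q\<bar> \<le> (8 * m * 5 ^ m) * pair_wt (m - 1) n"
proof -
  obtain i j where ij: "i < 6" "j < 6" "i \<noteq> j" "jap (n j) \<le> jap (n i)" "jap (n i) \<le> 5 * jap (n j)"
    and le: "\<And>l. l < 6 \<Longrightarrow> l \<noteq> i \<Longrightarrow> jap (n l) \<le> jap (n j)"
    using two_leading_frequencies[OF n] by blast
  define x where "x l = (jap (n l))\<^sup>2" for l
  define P where "P = jap (n i) ^ (m - 1) * jap (n j) ^ (m - 1)"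
  have P0: "0 \<le> P" by (simp add: P_def)
  have x0: "0 < x l" for l unfolding x_def by (rule zero_less_power) simp
  have xij: "x j \<le> x i" unfolding x_def using ij by (intro power_mono) auto
  obtain q where q: "\<bar>q\<bar> \<le> m * x i ^ (m - 1)"
    "of_int (csign i) * x i ^ m + of_int (csign j) * x j ^ m = q * (of_int (csign i) * x i + of_int (csign j) * x j)"
    using two_power_quotient[OF x0 xij, of m i j] m by auto
  \<comment> \<open>The second frequency takes over half of the powers, at a cost of
    \<open>5 ^ (m - 1)\<close>.\<close>
  have xiP: "x i ^ (m - 1) \<le> 5 ^ (m - 1) * P"
  proof -
    have "x i ^ (m - 1) = jap (n i) ^ (m - 1) * jap (n i) ^ (m - 1)"
      by (simp add: x_def power_mult[symmetric] mult_2 power_add)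
    also have "\<dots> \<le> jap (n i) ^ (m - 1) * (5 * jap (n j)) ^ (m - 1)"
      using ij by (intro mult_left_mono power_mono) auto
    finally show ?thesis by (simp add: P_def power_mult_distrib mult_ac)
  qed
  have qP: "\<bar>q\<bar> \<le> m * 5 ^ m * P"
  proof -
    have "\<bar>q\<bar> \<le> m * (5 ^ (m - 1) * P)" using q(1) xiP by (meson mult_left_mono of_nat_0_le_iff order_trans)
    also have "\<dots> \<le> m * (5 ^ m * P)"
      by (intro mult_left_mono mult_right_mono power_increasing P0) auto
    finally show ?thesis by (simp add: mult_ac)
  qed
  have split: "(\<Sum>l<6. f l) = f i + f j + (\<Sum>l\<in>{..<6}-{i,j}. f l)" for f :: "nat \<Rightarrow> real"
    using ij by (simp add: sum.remove[of "{..<6}" i] sum.remove[of "{..<6}-{i}" j] Diff_insert[symmetric] insert_commute)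
  have psi: "psi m n = (\<Sum>l<6. of_int (csign l) * x l ^ m)"
    by (simp add: psi_def x_def power_mult)
  have reson: "reson n = (\<Sum>l<6. of_int (csign l) * x l)"
    by (simp add: reson_jap x_def)
  \<comment> \<open>By the choice of \<open>q\<close> the terms \<open>i\<close> and
    \<open>j\<close> cancel, and \<open>q\<close> meets only the frequencies of the other four
    slots.\<close>
  have e: "psi m n - reson n * q = (\<Sum>l\<in>{..<6}-{i,j}. of_int (csign l) * (x l * (x l ^ (m - 1) - q)))"
  proof -
    have xm: "x l ^ m = x l * x l ^ (m - 1)" for l using m by (cases m) auto
    have "psi m n - reson n * q = (\<Sum>l\<in>{..<6}-{i,j}. of_int (csign l) * x l ^ m) - (\<Sum>l\<in>{..<6}-{i,j}. of_int (csign l) * x l) * q"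
      unfolding psi reson split using q(2) by (simp add: algebra_simps)
    also have "\<dots> = (\<Sum>l\<in>{..<6}-{i,j}. of_int (csign l) * (x l * (x l ^ (m - 1) - q)))"
      unfolding sum_distrib_right sum_subtractf[symmetric] by (intro sum.cong refl) (simp add: xm algebra_simps)
    finally show ?thesis .
  qed
  have "\<bar>psi m n - reson n * q\<bar> \<le> (\<Sum>l\<in>{..<6}-{i,j}. 2 * m * 5 ^ m * pair_wt (m - 1) n)"
    unfolding e
  proof (intro order_trans[OF sum_abs] sum_mono)
    fix l assume l: "l \<in> {..<6} - {i,j}"
    have "x l \<le> x i" using le[of l] l ij unfolding x_def by (intro power_mono) auto
    then have "x l ^ (m - 1) \<le> x i ^ (m - 1)" using x0[of l] by (intro power_mono) auto
    also have "\<dots> \<le> 5 ^ m * P" using xiP P0 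
      by (meson diff_le_self mult_right_mono one_le_numeral order_trans power_increasing)
    also have "\<dots> \<le> m * 5 ^ m * P" using m P0 by (simp add: mult_right_mono)
    finally have "x l ^ (m - 1) \<le> m * 5 ^ m * P" .
    moreover have "0 \<le> x l ^ (m - 1)" using x0[of l] by simp
    ultimately have "\<bar>x l ^ (m - 1) - q\<bar> \<le> 2 * (m * 5 ^ m * P)"
      using qP by linarith
    then have "\<bar>x l ^ (m - 1) - q\<bar> \<le> 2 * m * 5 ^ m * P"
      by (simp add: mult.assoc)
    then have "x l * \<bar>x l ^ (m - 1) - q\<bar> \<le> x l * (2 * m * 5 ^ m * P)"
      using x0[of l] by (simp add: mult_left_mono)
    also have "\<dots> = 2 * m * 5 ^ m * (jap (n i) ^ (m - 1) * jap (n j) ^ (m - 1) * (jap (n l))\<^sup>2)"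
      by (simp add: P_def x_def mult_ac)
    also have "\<dots> \<le> 2 * m * 5 ^ m * pair_wt (m - 1) n"
      using ij l m by (intro mult_left_mono pair_wt_ge_triple) auto
    finally show "\<bar>of_int (csign l) * (x l * (x l ^ (m - 1) - q))\<bar> \<le> 2 * m * 5 ^ m * pair_wt (m - 1) n"
      using x0[of l] by (simp add: abs_mult flip: of_int_abs)
  qed
  \<comment> \<open>Four slots remain, each bounded with the constant
    \<open>2 * m * 5 ^ m\<close>.\<close>
  also have "\<dots> = 8 * m * 5 ^ m * pair_wt (m - 1) n"
  proof -
    have "card ({..<6} - {i,j}) = 4" using ij by (subst card_Diff_subset) auto
    then show ?thesis by simp
  qed
  finally have 2: "\<bar>psi m n - reson n * q\<bar> \<le> (8 * m * 5 ^ m) * pair_wt (m - 1) n" by simp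
  have "P \<le> pair_wt (m - 1) n" unfolding P_def using ij m by (intro pair_wt_ge_pair) auto
  then have "m * 5 ^ m * P \<le> m * 5 ^ m * pair_wt (m - 1) n" by (simp add: mult_left_mono)
  also have "\<dots> \<le> (8 * m * 5 ^ m) * pair_wt (m - 1) n" by (intro mult_right_mono) auto
  finally have "\<bar>q\<bar> \<le> (8 * m * 5 ^ m) * pair_wt (m - 1) n" using qP by simp
  with 2 show ?thesis by (intro exI[of _ q]) simp
qed

section \<open>Exact division in the case \<open>m = 2\<close>\<close>

text \<open>For \<open>m = 2\<close> the last bound must involve a product of four derivatives, so an exact polynomial division is
  needed.  If \<open>e\<^sub>i\<close> and \<open>f\<^sub>i\<close> are the elementary symmetric functions of the frequencies of \<open>u\<close> and of
  \<open>cnj u\<close> and \<open>s = e\<^sub>1 = f\<^sub>1\<close>, Newton's identities give \<open>-2 (e\<^sub>2 - f\<^sub>2)\<close> for the resonance function and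
  \<open>(e\<^sub>2 - f\<^sub>2) (2 (e\<^sub>2 + f\<^sub>2) - 4 s\<^sup>2) + 4 s (e\<^sub>3 - f\<^sub>3)\<close> for the difference of the fourth power sums.  Writing one
  \<open>s\<close> of each product through the other group of frequencies makes the remainder multilinear.\<close>

definition h2_symbol :: "(nat \<Rightarrow> int) \<Rightarrow> real" where
  "h2_symbol n = of_int (2 + 2 * (n 0 + n 1 + n 2) * (n 3 + n 4 + n 5) - (n 0 * n 1 + n 0 * n 2 + n 1 * n 2)
     - (n 3 * n 4 + n 3 * n 5 + n 4 * n 5))"

definition h2_remainder :: "(nat \<Rightarrow> int) \<Rightarrow> real" where
  "h2_remainder n = of_int (4 * (n 0 * n 1 * n 2 * (n 3 + n 4 + n 5) - n 3 * n 4 * n 5 * (n 0 + n 1 + n 2)))"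

text \<open>Since \<open>jap a ^ 4 = 1 + 2 * a^2 + a^4\<close>, the constants cancel and the
  quadratic part is twice the resonance function; this accounts for the summand \<open>2\<close> in
  \<open>h2_symbol\<close>. The fourth powers are divided by Newton's identities.\<close>

lemma normal_form_H2_identity:
  assumes "zero_mom n"
  shows "psi 2 n - reson n * h2_symbol n = h2_remainder n"
proof -
  have j4: "jap a ^ 4 = real_of_int ((1 + a\<^sup>2)\<^sup>2)" for a
  proof -
    have "jap a ^ 4 = ((jap a)\<^sup>2)\<^sup>2" by (simp flip: power_mult)
    then show ?thesis by (simp add: jap_sq)
  qed
  define p0 p1 p2 q0 q1 q2 where d: "p0 = n 0" "p1 = n 1" "p2 = n 2" "q0 = n 3" "q1 = n 4" "q2 = n 5"
  \<comment> \<open>Momentum eliminates one frequency, after which the claim is a polynomial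
    identity over the integers.\<close>
  have p: "p0 = q0 + q1 + q2 - p1 - p2"
    using assms unfolding zero_mom_def sum6 d by (simp add: csign_def)
  have "psi 2 n - reson n * h2_symbol n = of_int ((1 + p0\<^sup>2)\<^sup>2 + (1 + p1\<^sup>2)\<^sup>2 + (1 + p2\<^sup>2)\<^sup>2 - (1 + q0\<^sup>2)\<^sup>2 - (1 + q1\<^sup>2)\<^sup>2 - (1 + q2\<^sup>2)\<^sup>2
     - (p0\<^sup>2 + p1\<^sup>2 + p2\<^sup>2 - q0\<^sup>2 - q1\<^sup>2 - q2\<^sup>2) * (2 + 2 * (p0 + p1 + p2) * (q0 + q1 + q2) - (p0 * p1 + p0 * p2 + p1 * p2)
     - (q0 * q1 + q0 * q2 + q1 * q2)))"
    unfolding psi_def reson_def h2_symbol_def sum6 d by (simp add: csign_def j4)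
  also have "\<dots> = of_int (4 * (p0 * p1 * p2 * (q0 + q1 + q2) - q0 * q1 * q2 * (p0 + p1 + p2)))"
    unfolding p by (rule arg_cong[where f=of_int]) algebra
  finally show ?thesis unfolding h2_remainder_def d .
qed

lemma of_int_mult_le_jap: "\<bar>real_of_int (a * b)\<bar> \<le> jap a * jap b"
  using mult_mono[OF abs_le_jap[of a] abs_le_jap[of b]] by (simp add: abs_mult)

text \<open>\<open>26 = 2 + 2 * 9 + 3 + 3\<close> counts the constant and the products of two
  different slots.\<close>

lemma h2_symbol_bound: "symb_le h2_symbol 1 26"
  unfolding symb_le_def
proof (intro allI impI)
  fix n
  have pr: "\<bar>real_of_int (n i * n j)\<bar> \<le> pair_wt 1 n" if "i < 6" "j < 6" "i \<noteq> j" for i j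
    using of_int_mult_le_jap[of "n i" "n j"] pair_wt_ge_pair[of i j 1 n] that by simp
  have "1 * 1 \<le> jap (n 0) * jap (n 1)" by (intro mult_mono jap_ge_1) auto
  then have 1: "1 \<le> pair_wt 1 n" using pair_wt_ge_pair[of 0 1 1 n] by simp
  have e: "h2_symbol n = 2 + 2 * (of_int (n 0 * n 3) + of_int (n 0 * n 4) + of_int (n 0 * n 5) + of_int (n 1 * n 3) + of_int (n 1 * n 4) + of_int (n 1 * n 5)
     + of_int (n 2 * n 3) + of_int (n 2 * n 4) + of_int (n 2 * n 5)) - (of_int (n 0 * n 1) + of_int (n 0 * n 2) + of_int (n 1 * n 2))
     - (of_int (n 3 * n 4) + of_int (n 3 * n 5) + of_int (n 4 * n 5))"
    unfolding h2_symbol_def by (simp add: algebra_simps)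
  have "\<bar>h2_symbol n\<bar> \<le> 26 * pair_wt 1 n"
    unfolding e using 1 pr[of 0 3] pr[of 0 4] pr[of 0 5] pr[of 1 3] pr[of 1 4] pr[of 1 5] pr[of 2 3] pr[of 2 4] pr[of 2 5]
      pr[of 0 1] pr[of 0 2] pr[of 1 2] pr[of 3 4] pr[of 3 5] pr[of 4 5]
    unfolding abs_le_iff by (simp del: of_int_mult)
  then show "\<bar>h2_symbol n\<bar> \<le> 26 * pair_wt 1 n" .
qed

text \<open>Order \<open>2\<close> is one more than the final estimate allows. This crude bound
  ensures that the truncated rates converge on \<open>H^2\<close>; the estimate by the
  \<open>L^4\<close> norm is \<open>sextic_h2_remainder_bound\<close>.\<close>

lemma h2_remainder_bound: "symb_le h2_remainder 2 24"
  unfolding symb_le_def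
proof (intro allI impI)
  fix n
  have pr: "\<bar>real_of_int (n i * n j * n l * n k)\<bar> \<le> pair_wt 2 n"
    if "i < 6" "j < 6" "l < 6" "k < 6" "i \<noteq> j" "i \<noteq> l" "i \<noteq> k" "j \<noteq> l" "j \<noteq> k" "l \<noteq> k" for i j l k
  proof -
    have "\<bar>real_of_int ((n i * n j) * (n l * n k))\<bar> \<le> (jap (n i) * jap (n j)) * (jap (n l) * jap (n k))"
      unfolding of_int_mult[of "n i * n j"] abs_mult by (intro mult_mono of_int_mult_le_jap) auto
    also have "\<dots> \<le> (jap (n i) * jap (n j)) * (\<Prod>l\<in>{l,k}. jap (n l) ^ (2 - 1))"
      using that by simp
    also have "\<dots> \<le> (jap (n i) * jap (n j)) * (\<Prod>l<6. jap (n l) ^ (2 - 1))"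
      using that by (intro mult_left_mono prod_jap_ge) auto
    also have "\<dots> \<le> pair_wt 2 n" by (rule pair_wt_ge) fact+
    finally show ?thesis by (simp only: mult.assoc)
  qed
  have e: "h2_remainder n = 4 * (of_int (n 0 * n 1 * n 2 * n 3) + of_int (n 0 * n 1 * n 2 * n 4) + of_int (n 0 * n 1 * n 2 * n 5)
    - of_int (n 3 * n 4 * n 5 * n 0) - of_int (n 3 * n 4 * n 5 * n 1) - of_int (n 3 * n 4 * n 5 * n 2))"
    unfolding h2_remainder_def by (simp add: algebra_simps)
  show "\<bar>h2_remainder n\<bar> \<le> 24 * pair_wt 2 n"
    unfolding e using pr[of 0 1 2 3] pr[of 0 1 2 4] pr[of 0 1 2 5] pr[of 3 4 5 0] pr[of 3 4 5 1] pr[of 3 4 5 2]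
    unfolding abs_le_iff by (simp del: of_int_mult)
qed

text \<open>The remainder symbol is bounded at two orders: order \<open>2 * k\<close> for the
  existence of the limit along solutions, order \<open>2 * k - 1\<close> for the flux estimate when
  \<open>k >= 2\<close>. For \<open>k = 1\<close> an exact formula replaces the latter.\<close>

lemma normal_form:
  assumes "1 \<le> k"
  shows "\<exists>r C. 0 \<le> C \<and> symb_le r (2 * k - 1) C \<and> symb_le (\<lambda>n. psi (2 * k) n - reson n * r n) (2 * k) C \<and>
    (2 \<le> k \<longrightarrow> symb_le (\<lambda>n. psi (2 * k) n - reson n * r n) (2 * k - 1) C) \<and>
    (k = 1 \<longrightarrow> (\<forall>n. zero_mom n \<longrightarrow> psi (2 * k) n - reson n * r n = h2_remainder n))"
proof (cases "k = 1")
  case True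
  have "symb_le h2_symbol 1 26" by (rule h2_symbol_bound)
  moreover have "symb_le (\<lambda>n. psi 2 n - reson n * h2_symbol n) 2 26"
    unfolding symb_le_def
  proof (intro allI impI)
    fix n assume n: "zero_mom n"
    have "\<bar>h2_remainder n\<bar> \<le> 24 * pair_wt 2 n" using h2_remainder_bound n unfolding symb_le_def by blast
    also have "\<dots> \<le> 26 * pair_wt 2 n" by (intro mult_right_mono) auto
    finally show "\<bar>psi 2 n - reson n * h2_symbol n\<bar> \<le> 26 * pair_wt 2 n" by (simp add: normal_form_H2_identity n)
  qed
  ultimately show ?thesis using True normal_form_H2_identity by (intro exI[of _ h2_symbol] exI[of _ 26]) simp
next
  case False
  define m where "m = 2 * k"
  have m: "4 \<le> m" using False assms by (simp add: m_def)
  define C where "C = real (8 * m * 5 ^ m)"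
  \<comment> \<open>Only the size of the symbol enters later, so it can be chosen tuple by
    tuple.\<close>
  have "\<forall>n. \<exists>q. zero_mom n \<longrightarrow> \<bar>q\<bar> \<le> C * pair_wt (m - 1) n \<and> \<bar>psi m n - reson n * q\<bar> \<le> C * pair_wt (m - 1) n"
    using normal_form_pointwise[OF _ m] unfolding C_def by auto
  then obtain r where r: "\<And>n. zero_mom n \<Longrightarrow> \<bar>r n\<bar> \<le> C * pair_wt (m - 1) n"
    "\<And>n. zero_mom n \<Longrightarrow> \<bar>psi m n - reson n * r n\<bar> \<le> C * pair_wt (m - 1) n"
    by metis
  have C0: "0 \<le> C" by (simp add: C_def)
  have "C * pair_wt (m - 1) n \<le> C * pair_wt m n" for n
    using C0 by (intro mult_left_mono pair_wt_mono) auto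
  then have "symb_le (\<lambda>n. psi m n - reson n * r n) m C"
    unfolding symb_le_def using r(2) order_trans by blast
  then show ?thesis
    using r C0 False unfolding symb_le_def m_def[symmetric] by blast
qed

section \<open>Energy balance of the truncated coefficients\<close>

lemma sextic_reindex:
  assumes inv: "\<And>j. \<sigma> (\<sigma> j) = j" and six: "\<And>j. \<sigma> j < 6 \<longleftrightarrow> j < 6"
    and fix': "\<And>j. \<not> j < 6 \<Longrightarrow> \<sigma> j = j"
    and mom: "\<And>n. zero_mom n \<Longrightarrow> zero_mom (n \<circ> \<sigma>)"
  shows "sextic K (\<lambda>n. f (n \<circ> \<sigma>)) a = sextic K f (\<lambda>j. a (\<sigma> j))"
  unfolding sextic_def
proof (rule sum.reindex_bij_witness[of _ "\<lambda>n. n \<circ> \<sigma>" "\<lambda>n. n \<circ> \<sigma>"])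
  have tup: "n \<circ> \<sigma> \<in> tuples K" if "n \<in> tuples K" for n
    using that mom six fix' unfolding tuples_def PiE_iff extensional_def
    by (simp del: atLeastAtMost_iff)
  show "n \<circ> \<sigma> \<in> tuples K" if "n \<in> tuples K" for n using tup that .
  show "n \<circ> \<sigma> \<in> tuples K" if "n \<in> tuples K" for n using tup that .
  have per: "(\<Prod>j<6. g (\<sigma> j)) = (\<Prod>j<6. g j)" for g :: "nat \<Rightarrow> complex"
    by (rule prod.reindex_bij_witness[of _ \<sigma> \<sigma>]) (auto simp: inv six)
  show "complex_of_real (f (n \<circ> \<sigma>)) * (\<Prod>j<6. a (\<sigma> j) ((n \<circ> \<sigma>) j)) =
         complex_of_real (f (n \<circ> \<sigma>)) * (\<Prod>j<6. a j (n j))" for n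
    using per[of "\<lambda>j. a j (n j)"] by simp
qed (auto simp: comp_def inv)

text \<open>The case \<open>c = 1\<close> covers involutions inside the two halves of the slots,
  \<open>c = -1\<close> the exchange of the halves.\<close>

lemma sum_csign_reindex:
  assumes inv: "\<And>j. \<sigma> (\<sigma> j) = j" and six: "\<And>j. \<sigma> j < 6 \<longleftrightarrow> j < 6"
    and e: "\<And>j. j < 6 \<Longrightarrow> csign (\<sigma> j) = c * csign j" and n: "zero_mom n" and c: "c * c = 1"
  shows "zero_mom (n \<circ> \<sigma>)"
proof -
  have "(\<Sum>j<6. csign j * n (\<sigma> j)) = (\<Sum>j<6. csign (\<sigma> j) * n (\<sigma> (\<sigma> j)))"
    by (rule sum.reindex_bij_witness[of _ \<sigma> \<sigma>]) (auto simp: inv six)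
  also have "\<dots> = c * (\<Sum>j<6. csign j * n j)"
    unfolding sum_distrib_left by (intro sum.cong refl) (simp add: inv e)
  finally show ?thesis using n by (simp add: zero_mom_def)
qed

lemma sextic_cnj: "sextic K f (\<lambda>j n. cnj (a j n)) = cnj (sextic K f a)"
  by (simp add: sextic_def)

text \<open>On \<open>entries a\<close> the three slots of each half hold the same sequence, so a
  weight moves freely within a half; exchanging the halves conjugates the form. Every position of
  the weight is thus reduced to slot \<open>5\<close>.\<close>

lemma sextic_weight_eq:
  assumes j: "j < 6"
  shows "sextic K (\<lambda>n. w (n j)) (entries a) =
    (if j < 3 then cnj (sextic K (\<lambda>n. w (n 5)) (entries a)) else sextic K (\<lambda>n. w (n 5)) (entries a))"
proof -
  have 1: "sextic K (\<lambda>n. w (n j)) (entries a) = sextic K (\<lambda>n. w (n 5)) (entries a)" if j: "3 \<le> j" "j < 6" for j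
  proof -
    let ?s = "Transposition.transpose j 5"
    have six: "?s i < 6 \<longleftrightarrow> i < 6" and lt: "?s i < 3 \<longleftrightarrow> i < 3" and fix': "\<not> i < 6 \<Longrightarrow> ?s i = i" for i
      using j by (auto simp: Transposition.transpose_def)
    have "sextic K (\<lambda>n. w (n j)) (entries a) = sextic K (\<lambda>n. (\<lambda>n. w (n 5)) (n \<circ> ?s)) (entries a)"
      by simp
    also have "\<dots> = sextic K (\<lambda>n. w (n 5)) (\<lambda>i. entries a (?s i))"
      by (rule sextic_reindex[OF _ six fix'])
         (auto intro!: sum_csign_reindex[where c=1] simp: six csign_def lt)
    also have "(\<lambda>i. entries a (?s i)) = entries a"
      by (auto simp: entries_def lt)
    finally show ?thesis .
  qed
  show ?thesis
  proof (cases "j < 3")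
    case True
    let ?s = "\<lambda>i::nat. if i < 3 then i + 3 else if i < 6 then i - 3 else i"
    have e: "csign (?s i) = -1 * csign i" if "i < 6" for i using that by (auto simp: csign_def)
    have "sextic K (\<lambda>n. w (n j)) (entries a) = sextic K (\<lambda>n. (\<lambda>n. w (n (j + 3))) (n \<circ> ?s)) (entries a)"
      using True by (intro sextic_cong) auto
    also have "\<dots> = sextic K (\<lambda>n. w (n (j + 3))) (\<lambda>i. entries a (?s i))"
    proof (rule sextic_reindex)
      show "zero_mom (n \<circ> ?s)" if "zero_mom n" for n
        by (rule sum_csign_reindex[where c="-1", OF _ _ e that]) auto
    qed auto
    also have "\<dots> = sextic K (\<lambda>n. w (n (j + 3))) (\<lambda>i n. cnj (entries a i n))"
      by (intro sextic_cong) (auto simp: entries_def)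
    also have "\<dots> = cnj (sextic K (\<lambda>n. w (n 5)) (entries a))"
      unfolding sextic_cnj using 1[of "j + 3"] True by simp
    finally show ?thesis using True by simp
  next
    case False
    then have "sextic K (\<lambda>n. w (n j)) (entries a) = sextic K (\<lambda>n. w (n 5)) (entries a)" by (intro 1 j) simp
    then show ?thesis using False by (simp only: if_False)
  qed
qed

lemma sextic_sum_symb: "sextic K (\<lambda>n. \<Sum>j\<in>I. f j n) a = (\<Sum>j\<in>I. sextic K (f j) a)"
  unfolding sextic_def of_real_sum sum_distrib_right by (rule sum.swap)

lemma sextic_diff_symb: "sextic K (\<lambda>n. f n - g n) a = sextic K f a - sextic K g a"
  unfolding sextic_def by (simp add: left_diff_distrib sum_subtractf)

lemma sextic_scale_symb: "sextic K (\<lambda>n. c * f n) a = of_real c * sextic K f a"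
  unfolding sextic_def by (simp add: sum_distrib_left mult.assoc)

text \<open>The three slots of \<open>u\<close> enter with sign \<open>+\<close> but contribute
  conjugates, the three others enter with sign \<open>-\<close>; so all six imaginary parts agree.
  Read backwards, this replaces the weight on one slot by \<open>psi\<close>.\<close>

lemma Im_sextic_psi:
  "Im (sextic K (psi m) (entries a)) = - 6 * Im (sextic K (\<lambda>n. jap (n 5) ^ (2 * m)) (entries a))"
proof -
  have "sextic K (psi m) (entries a) = (\<Sum>j<6. of_int (csign j) * sextic K (\<lambda>n. jap (n j) ^ (2 * m)) (entries a))"
    unfolding psi_def[abs_def] sextic_sum_symb sextic_scale_symb by simp
  also have "\<dots> = (\<Sum>j<6. of_int (csign j) * (if j < 3 then cnj (sextic K (\<lambda>n. jap (n 5) ^ (2 * m)) (entries a)) else sextic K (\<lambda>n. jap (n 5) ^ (2 * m)) (entries a)))"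
    using sextic_weight_eq[of _ K "\<lambda>i. jap i ^ (2 * m)"] by (intro sum.cong refl) auto
  finally show ?thesis by (simp add: sum6 csign_def)
qed

section \<open>Time derivatives of sextic forms and of the truncated energy\<close>

lemma prod_upd6:
  "j < 6 \<Longrightarrow> (\<Prod>i<6. (a(j := b)) i (n i)) = b (n j) * (\<Prod>i\<in>{..<6}-{j}. a i (n i))"
  for a :: "nat \<Rightarrow> int \<Rightarrow> complex"
  by (subst prod.remove[of _ j]) (auto intro!: prod.cong)

lemma sextic_upd_add:
  "j < 6 \<Longrightarrow> sextic K f (a(j := (\<lambda>n. b n + d n))) = sextic K f (a(j := b)) + sextic K f (a(j := d))"
  unfolding sextic_def by (simp add: prod_upd6 algebra_simps sum.distrib del: fun_upd_apply)

lemma sextic_upd_weight: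
  assumes "j < 6"
  shows "sextic K f (a(j := (\<lambda>n. z * of_real (w n) * a j n))) = z * sextic K (\<lambda>n. w (n j) * f n) a"
proof -
  have "(\<Prod>i<6. a i (n i)) = a j (n j) * (\<Prod>i\<in>{..<6}-{j}. a i (n i))" for n
    using assms by (subst prod.remove[of _ j]) auto
  then show ?thesis
    unfolding sextic_def using assms by (simp add: prod_upd6 sum_distrib_left mult_ac del: fun_upd_apply)
qed

lemma has_vector_derivative_sextic:
  assumes "\<And>n. ((\<lambda>\<tau>. c \<tau> n) has_vector_derivative c' n) (at t)"
  shows "((\<lambda>\<tau>. sextic K r (entries (c \<tau>))) has_vector_derivative
     (\<Sum>j<6. sextic K r ((entries (c t))(j := entries c' j)))) (at t)"
proof -
  have entries: "((\<lambda>\<tau>. entries (c \<tau>) j n) has_vector_derivative entries c' j n) (at t)" for j n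
    using assms[of n] by (auto simp: entries_def intro: has_vector_derivative_cnj)
  have prod: "((\<lambda>\<tau>. \<Prod>j<6. entries (c \<tau>) j (n j)) has_vector_derivative
     (\<Sum>j<6. entries c' j (n j) * (\<Prod>i\<in>{..<6}-{j}. entries (c t) i (n i)))) (at t)" for n
  proof -
    have "((\<lambda>\<tau>. \<Prod>j<6. entries (c \<tau>) j (n j)) has_derivative
       (\<lambda>y. \<Sum>j<6. (y *\<^sub>R entries c' j (n j)) * (\<Prod>i\<in>{..<6}-{j}. entries (c t) i (n i)))) (at t)"
      using entries unfolding has_vector_derivative_def by (intro has_derivative_prod) auto
    then show ?thesis
      unfolding has_vector_derivative_def by (simp add: scaleR_sum_right)
  qed
  have "((\<lambda>\<tau>. sextic K r (entries (c \<tau>))) has_vector_derivative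
    (\<Sum>n\<in>tuples K. of_real (r n) * (\<Sum>j<6. entries c' j (n j) * (\<Prod>i\<in>{..<6}-{j}. entries (c t) i (n i))))) (at t)"
    unfolding sextic_def by (intro has_vector_derivative_sum has_vector_derivative_mult_right prod)
  also have "(\<Sum>n\<in>tuples K. of_real (r n) * (\<Sum>j<6. entries c' j (n j) * (\<Prod>i\<in>{..<6}-{j}. entries (c t) i (n i))))
     = (\<Sum>j<6. sextic K r ((entries (c t))(j := entries c' j)))"
    unfolding sextic_def sum_distrib_left by (subst sum.swap) (simp add: prod_upd6 del: fun_upd_apply)
  finally show ?thesis .
qed

text \<open>\<open>2 * pi\<close> matches the normalisation of \<open>fourier_coeff\<close>, so that
  the first term tends to the squared Sobolev norm. \<open>2 * pi / 3\<close> is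
  \<open>4 * pi / 6\<close>: differentiating the first term produces \<open>4 * pi\<close>, and
  \<open>psi\<close> collects six equal contributions.\<close>

definition energy_trunc :: "((nat \<Rightarrow> int) \<Rightarrow> real) \<Rightarrow> nat \<Rightarrow> nat \<Rightarrow> (int \<Rightarrow> complex) \<Rightarrow> real" where
  "energy_trunc r m K a = 2 * pi * (hnorm K m a)\<^sup>2 + 2 * pi / 3 * Re (sextic K r (entries a))"

text \<open>The time derivative of the truncated energy, up to an error from truncating inside the nonlinearity that
  vanishes in the limit.  The sequence \<open>v\<close> stands for the coefficients of the full quintic term.\<close>

definition rate :: "((nat \<Rightarrow> int) \<Rightarrow> real) \<Rightarrow> nat \<Rightarrow> int set \<Rightarrow> nat \<Rightarrow> (int \<Rightarrow> complex) \<Rightarrow> (int \<Rightarrow> complex) \<Rightarrow> real" where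
  "rate r m S K a v = - (2 * pi / 3) * Im (sextic K (\<lambda>n. psi m n - reson n * r n) (entries a)) +
     2 * pi / 3 * (\<Sum>j<6. Re (sextic K r ((entries a)(j := entries (\<lambda>n. - \<i> * (if n \<in> S then v n else 0)) j))))"

text \<open>The linear flow rotates each mode, so the norm sees only the nonlinearity. The
  correction sees \<open>reson\<close> from the linear flow and one inserted nonlinearity per slot.
  Replacing \<open>v\<close> by \<open>qconv K\<close> in the first contribution yields the form
  with symbol \<open>psi\<close> and leaves the last sum as error.\<close>

lemma energy_trunc_derivative:
  assumes c': "\<And>n. ((\<lambda>\<tau>. c \<tau> n) has_vector_derivative
      (- \<i> * (of_int n ^ 2 * c t n + (if n \<in> S then v n else 0)))) (at t)"
    and S: "\<And>n. n \<notin> S \<Longrightarrow> c t n = 0"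
  shows "((\<lambda>\<tau>. energy_trunc r m K (c \<tau>)) has_real_derivative
     rate r m S K (c t) v + 4 * pi * Im (\<Sum>n\<in>freqs K. of_real (jap n ^ (2 * m)) * cnj (c t n) * (v n - qconv K (c t) n))) (at t)"
proof -
  let ?I = "(freqs K)"
  define u where "u n = (if n \<in> S then v n else 0)" for n
  define a where "a = c t"
  define d where "d n = - \<i> * (of_int n ^ 2 * a n + u n)" for n
  have c'': "((\<lambda>\<tau>. c \<tau> n) has_vector_derivative d n) (at t)" for n
    using c'[of n] by (simp add: d_def u_def a_def)
  define w where "w n = jap n ^ (2 * m)" for n
  have Re_cnj: "Re (cnj z * z) = (cmod z)\<^sup>2" for z
    by (simp add: cmod_power2) (simp add: power2_eq_square)
  have hn2: "(hnorm K m b)\<^sup>2 = (\<Sum>n\<in>?I. w n * Re (cnj (b n) * b n))" for b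
    unfolding hnorm_sq w_def by (simp only: Re_cnj power_mult_distrib power_even_eq)
  have "((\<lambda>\<tau>. (hnorm K m (c \<tau>))\<^sup>2) has_vector_derivative (\<Sum>n\<in>?I. w n * Re (cnj (a n) * d n + cnj (d n) * a n))) (at t)"
    unfolding hn2 a_def
    by (intro has_vector_derivative_sum has_vector_derivative_mult_right
        bounded_linear.has_vector_derivative[OF bounded_linear_Re] has_vector_derivative_mult has_vector_derivative_cnj c'')
  also have "(\<Sum>n\<in>?I. w n * Re (cnj (a n) * d n + cnj (d n) * a n)) = 2 * Im (\<Sum>n\<in>?I. of_real (w n) * cnj (a n) * v n)"
    unfolding Im_sum sum_distrib_left
  proof (intro sum.cong refl)
    fix n
    \<comment> \<open>Off \<open>S\<close> the coefficient of the solution vanishes, so the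
      projector disappears from this pairing.\<close>
    have "cnj (a n) * v n = cnj (a n) * u n" using S[of n] by (auto simp: u_def a_def)
    then have "of_real (w n) * cnj (a n) * v n = of_real (w n) * (cnj (a n) * u n)"
      by (simp only: mult.assoc)
    then have "2 * Im (of_real (w n) * cnj (a n) * v n) = 2 * Im (of_real (w n) * (cnj (a n) * u n))"
      by (simp only:)
    also have "\<dots> = w n * (2 * Im (cnj (a n) * u n))"
      by (simp add: algebra_simps)
    also have "2 * Im (cnj (a n) * u n) = Re (cnj (a n) * d n + cnj (d n) * a n)"
    proof -
      have sq: "complex_of_int n ^ 2 = of_real ((real_of_int n)\<^sup>2)" by simp
      show ?thesis unfolding d_def sq by (simp add: algebra_simps)
    qed
    finally show "w n * Re (cnj (a n) * d n + cnj (d n) * a n) = 2 * Im (of_real (w n) * cnj (a n) * v n)" by simp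
  qed
  finally have 1: "((\<lambda>\<tau>. (hnorm K m (c \<tau>))\<^sup>2) has_vector_derivative 2 * Im (\<Sum>n\<in>?I. of_real (w n) * cnj (a n) * v n)) (at t)" .
  have "((\<lambda>\<tau>. sextic K r (entries (c \<tau>))) has_vector_derivative (\<Sum>j<6. sextic K r ((entries a)(j := entries d j)))) (at t)"
    unfolding a_def by (rule has_vector_derivative_sextic[OF c''])
  then have "((\<lambda>\<tau>. Re (sextic K r (entries (c \<tau>)))) has_vector_derivative Re (\<Sum>j<6. sextic K r ((entries a)(j := entries d j)))) (at t)"
    by (rule bounded_linear.has_vector_derivative[OF bounded_linear_Re])
  also have "(\<Sum>j<6. sextic K r ((entries a)(j := entries d j))) =
     - \<i> * sextic K (\<lambda>n. reson n * r n) (entries a) + (\<Sum>j<6. sextic K r ((entries a)(j := entries (\<lambda>n. - \<i> * u n) j)))"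
  proof -
    have "sextic K r ((entries a)(j := entries d j)) = - \<i> * sextic K (\<lambda>n. (of_int (csign j) * (of_int (n j))\<^sup>2) * r n) (entries a)
        + sextic K r ((entries a)(j := entries (\<lambda>n. - \<i> * u n) j))" if j: "j < 6" for j
    proof -
      \<comment> \<open>Conjugation in the last three slots reverses the phase rotation, which is
        what \<open>csign\<close> records.\<close>
      have e: "entries d j = (\<lambda>n. - \<i> * of_real (of_int (csign j) * (of_int n)\<^sup>2) * entries a j n + entries (\<lambda>n. - \<i> * u n) j n)"
        by (auto simp: entries_def d_def csign_def algebra_simps)
      show ?thesis
        unfolding e sextic_upd_add[OF j] sextic_upd_weight[OF j, of K r "entries a" "- \<i>" "\<lambda>n. of_int (csign j) * (of_int n)\<^sup>2"] ..
    qed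
    then have "(\<Sum>j<6. sextic K r ((entries a)(j := entries d j))) = (\<Sum>j<6. - \<i> * sextic K (\<lambda>n. (of_int (csign j) * (of_int (n j))\<^sup>2) * r n) (entries a))
        + (\<Sum>j<6. sextic K r ((entries a)(j := entries (\<lambda>n. - \<i> * u n) j)))"
      by (simp add: sum.distrib sum_subtractf sum_negf)
    also have "(\<Sum>j<6. - \<i> * sextic K (\<lambda>n. (of_int (csign j) * (of_int (n j))\<^sup>2) * r n) (entries a)) = - \<i> * sextic K (\<lambda>n. reson n * r n) (entries a)"
      unfolding reson_def sum_distrib_right sextic_sum_symb sum_distrib_left ..
    finally show ?thesis .
  qed
  finally have 2: "((\<lambda>\<tau>. Re (sextic K r (entries (c \<tau>)))) has_vector_derivative
     Im (sextic K (\<lambda>n. reson n * r n) (entries a)) + (\<Sum>j<6. Re (sextic K r ((entries a)(j := entries (\<lambda>n. - \<i> * u n) j))))) (at t)"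
    by (simp add: Re_sum add.commute)
  have q: "(\<Sum>n\<in>?I. of_real (w n) * cnj (a n) * qconv K a n) = sextic K (\<lambda>n. w (n 5)) (entries a)"
  proof -
    have "(entries a)(5 := (\<lambda>n. cnj (a n))) = entries a" by (auto simp: entries_def)
    then show ?thesis using sum_qconv[of w "\<lambda>n. cnj (a n)" K a] by simp
  qed
  have "((\<lambda>\<tau>. energy_trunc r m K (c \<tau>)) has_vector_derivative
     2 * pi * (2 * Im (\<Sum>n\<in>?I. of_real (w n) * cnj (a n) * v n)) +
     2 * pi / 3 * (Im (sextic K (\<lambda>n. reson n * r n) (entries a)) + (\<Sum>j<6. Re (sextic K r ((entries a)(j := entries (\<lambda>n. - \<i> * u n) j)))))) (at t)"
    unfolding energy_trunc_def by (intro has_vector_derivative_add has_vector_derivative_mult_right 1 2)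
  moreover have "2 * pi * (2 * Im (\<Sum>n\<in>?I. of_real (w n) * cnj (a n) * v n)) +
     2 * pi / 3 * (Im (sextic K (\<lambda>n. reson n * r n) (entries a)) + (\<Sum>j<6. Re (sextic K r ((entries a)(j := entries (\<lambda>n. - \<i> * u n) j)))))
     = rate r m S K a v + 4 * pi * Im (\<Sum>n\<in>?I. of_real (w n) * cnj (a n) * (v n - qconv K a n))"
  proof -
    define Z1 Z2 where "Z1 = Im (\<Sum>n\<in>?I. of_real (w n) * cnj (a n) * v n)"
      and "Z2 = Im (\<Sum>n\<in>?I. of_real (w n) * cnj (a n) * (v n - qconv K a n))"
    have Z: "Z2 = Z1 - Im (sextic K (\<lambda>n. w (n 5)) (entries a))"
      unfolding Z1_def Z2_def q[symmetric] by (simp add: right_diff_distrib sum_subtractf del: Im_sum)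
    have P: "Im (sextic K (psi m) (entries a)) = - 6 * Im (sextic K (\<lambda>n. w (n 5)) (entries a))"
      unfolding w_def by (rule Im_sextic_psi)
    show ?thesis
      unfolding rate_def sextic_diff_symb u_def Z1_def[symmetric] Z2_def[symmetric] Z minus_complex.sel P
      by (simp add: algebra_simps)
  qed
  ultimately show ?thesis
    unfolding w_def a_def has_real_derivative_iff_has_vector_derivative by simp
qed

section \<open>Convergence of the truncated forms and rates\<close>

lemma sextic_lipschitz_uniform:
  assumes r: "symb_le r s C" and s: "1 \<le> s" and C: "0 \<le> C"
    and a: "\<And>j. j < 6 \<Longrightarrow> hnorm K s (a j) \<le> B" and b: "\<And>j. j < 6 \<Longrightarrow> hnorm K s (b j) \<le> B"
    and D: "\<And>j. j < 6 \<Longrightarrow> hnorm K s (\<lambda>n. a j n - b j n) \<le> D"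
  shows "cmod (sextic K r a - sextic K r b) \<le> 14580 * C * B ^ 5 * D"
proof -
  have "cmod (sextic K r a - sextic K r b) \<le> 2430 * C * (\<Sum>i<6::nat. D * (\<Prod>j\<in>{..<6}-{i}. B))"
    using sextic_lipschitz[OF r s C a b D] .
  \<comment> \<open>The six slots contribute equally: \<open>14580 = 6 * 2430\<close>.\<close>
  also have "(\<Sum>i<6::nat. D * (\<Prod>j\<in>{..<6}-{i}. B)) = (\<Sum>i<6::nat. D * B ^ 5)"
    by (intro sum.cong) auto
  finally show ?thesis by (simp add: mult_ac)
qed

text \<open>The squared norms increase with the cutoff and are bounded; their distance to the limit
  bounds the tail beyond \<open>K\<close> uniformly in the window \<open>J\<close>.\<close>

lemma hnorm_tail:
  assumes "\<And>K. hnorm K s a \<le> B"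
  shows "\<exists>D. D \<longlonglongrightarrow> 0 \<and> (\<forall>K J. hnorm J s (\<lambda>n. a n - trunc K a n) \<le> D K) \<and> (\<forall>K. 0 \<le> D K)"
proof -
  define f where "f K = (hnorm K s a)\<^sup>2" for K
  have mono: "incseq f"
    unfolding f_def incseq_def by (auto intro!: power_mono hnorm_mono_K)
  have "f K \<le> B\<^sup>2" for K unfolding f_def by (intro power_mono assms) simp
  then obtain L where L: "f \<longlonglongrightarrow> L" "\<And>K. f K \<le> L"
    using incseq_convergent[OF mono] by blast
  show ?thesis
  proof (intro exI conjI allI)
    have "(\<lambda>K. sqrt (L - f K)) \<longlonglongrightarrow> sqrt (L - L)"
      by (intro tendsto_intros L)
    then show "(\<lambda>K. sqrt (L - f K)) \<longlonglongrightarrow> 0" by simp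
    show "0 \<le> sqrt (L - f K)" for K using L(2)[of K] by simp
    show "hnorm J s (\<lambda>n. a n - trunc K a n) \<le> sqrt (L - f K)" for K J
    proof -
      have *: "(hnorm J s (\<lambda>n. a n - trunc K a n))\<^sup>2 \<le> L - f K" if J: "K \<le> J" for J
      proof -
        have "(hnorm J s (\<lambda>n. a n - trunc K a n))\<^sup>2 = (\<Sum>n\<in>{- int J..int J} - (freqs K). (jap n ^ s * cmod (a n))\<^sup>2)"
          unfolding hnorm_sq by (rule sum.mono_neutral_cong_right) (auto simp: trunc_def)
        also have "\<dots> = f J - f K"
          unfolding f_def hnorm_sq using J by (intro sum_diff) auto
        finally show ?thesis using L(2)[of J] by simp
      qed
      have "hnorm J s (\<lambda>n. a n - trunc K a n) \<le> hnorm (max J K) s (\<lambda>n. a n - trunc K a n)"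
        by (rule hnorm_mono_K) simp
      also have "\<dots> \<le> sqrt (L - f K)"
        by (rule real_le_rsqrt) (rule *, simp)
      finally show ?thesis .
    qed
  qed
qed

lemma Cauchy_of_tail:
  fixes f :: "nat \<Rightarrow> 'a::complete_space"
  assumes D: "D \<longlonglongrightarrow> (0::real)" and f: "\<And>K J. K \<le> J \<Longrightarrow> dist (f J) (f K) \<le> D K"
  shows "convergent f"
  unfolding Cauchy_convergent_iff[symmetric]
proof (rule metric_CauchyI)
  fix e :: real assume "0 < e"
  then obtain N where N: "\<And>K. K \<ge> N \<Longrightarrow> D K < e / 2"
    using order_tendstoD(2)[OF D, of "e/2"] unfolding eventually_sequentially by auto
  show "\<exists>M. \<forall>m\<ge>M. \<forall>n\<ge>M. dist (f m) (f n) < e"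
  proof (intro exI allI impI)
    fix m n assume "m \<ge> N" "n \<ge> N"
    then have "dist (f m) (f N) \<le> D N" "dist (f n) (f N) \<le> D N" "D N < e / 2" using f N by auto
    then show "dist (f m) (f n) < e" using dist_triangle2[of "f m" "f n" "f N"] by linarith
  qed
qed

text \<open>Evaluating at the smaller cutoff equals evaluating at the larger one on truncated data,
  so the Lipschitz bound and the tail estimate make the sequence Cauchy.\<close>

lemma convergent_sextic:
  assumes r: "symb_le r s C" and s: "1 \<le> s" and C: "0 \<le> C" and a: "\<And>K. hnorm K s a \<le> B"
  shows "convergent (\<lambda>K. sextic K r (entries a))"
proof -
  obtain D where D: "D \<longlonglongrightarrow> 0" "\<And>K J. hnorm J s (\<lambda>n. a n - trunc K a n) \<le> D K" "\<And>K. 0 \<le> D K"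
    using hnorm_tail[OF a] by auto
  show ?thesis
  proof (rule Cauchy_of_tail)
    show "(\<lambda>K. 14580 * C * B ^ 5 * D K) \<longlonglongrightarrow> 0" using tendsto_mult_right_zero[OF D(1)] .
    fix K J :: nat assume "K \<le> J"
    then have "sextic K r (entries a) = sextic J r (entries (trunc K a))"
      by (simp only: entries_trunc[abs_def] sextic_trunc)
    moreover have "cmod (sextic J r (entries a) - sextic J r (entries (trunc K a))) \<le> 14580 * C * B ^ 5 * D K"
    proof (rule sextic_lipschitz_uniform[OF r s C])
      show "hnorm J s (\<lambda>n. entries a j n - entries (trunc K a) j n) \<le> D K" for j
        unfolding entries_diff[symmetric] hnorm_entries by (rule D)
    qed (simp_all only: hnorm_entries a order_trans[OF hnorm_trunc_le a])
    ultimately show "dist (sextic J r (entries a)) (sextic K r (entries a)) \<le> 14580 * C * B ^ 5 * D K"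
      by (simp only: dist_norm)
  qed
qed

text \<open>\<open>102060 = 7 * 14580\<close>: one form with the remainder symbol and six with a
  nonlinearity inserted into the correction. The former is the one that calls for order
  \<open>m\<close>.\<close>

lemma rate_lipschitz:
  assumes r: "symb_le r (m - 1) C" and g: "symb_le (\<lambda>n. psi m n - reson n * r n) m C" and m: "2 \<le> m" and C: "0 \<le> C"
    and a: "hnorm K m a \<le> B" and b: "hnorm K m b \<le> B" and u: "hnorm K m u \<le> B" and v: "hnorm K m v \<le> B"
    and D: "hnorm K m (\<lambda>n. a n - b n) \<le> D" and D': "hnorm K m (\<lambda>n. u n - v n) \<le> D"
  shows "\<bar>rate r m S K a u - rate r m S K b v\<bar> \<le> 2 * pi / 3 * (102060 * C * B ^ 5) * D"
proof -
  let ?g = "\<lambda>n. psi m n - reson n * r n"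
  let ?N = "\<lambda>u n. - \<i> * (if n \<in> S then u n else 0)"
  let ?A = "\<lambda>a u j. (entries a)(j := entries (?N u) j)"
  have N: "hnorm K (m - 1) (?N u) \<le> hnorm K m u" for u
    by (intro order_trans[OF hnorm_mono[of K _ u] hnorm_mono_s]) (auto simp: norm_mult)
  have 1: "cmod (sextic K ?g (entries a) - sextic K ?g (entries b)) \<le> 14580 * C * B ^ 5 * D"
  proof (rule sextic_lipschitz_uniform[OF g _ C])
    show "hnorm K m (\<lambda>n. entries a j n - entries b j n) \<le> D" for j
      unfolding entries_diff[symmetric] hnorm_entries by (rule D)
  qed (use m a b in \<open>simp_all\<close>)
  have 2: "cmod (sextic K r (?A a u j) - sextic K r (?A b v j)) \<le> 14580 * C * B ^ 5 * D" for j
  proof (rule sextic_lipschitz_uniform[OF r _ C])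
    fix l
    have m': "hnorm K (m - 1) x \<le> hnorm K m x" for x by (rule hnorm_mono_s) simp
    show "hnorm K (m - 1) (?A a u j l) \<le> B" "hnorm K (m - 1) (?A b v j l) \<le> B"
      using order_trans[OF m' a] order_trans[OF m' b] order_trans[OF N u] order_trans[OF N v] by auto
    have e: "(\<lambda>n. ?A a u j l n - ?A b v j l n) = ?A (\<lambda>n. a n - b n) (\<lambda>n. u n - v n) j l"
      by (auto simp: entries_def algebra_simps)
    show "hnorm K (m - 1) (\<lambda>n. ?A a u j l n - ?A b v j l n) \<le> D"
      unfolding e using order_trans[OF m' D] order_trans[OF N D'] by auto
  qed (use m in auto)
  have "rate r m S K a u - rate r m S K b v = 2 * pi / 3 *
     (- Im (sextic K ?g (entries a) - sextic K ?g (entries b)) + (\<Sum>j<6. Re (sextic K r (?A a u j) - sextic K r (?A b v j))))"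
    unfolding rate_def by (simp add: algebra_simps sum_subtractf del: fun_upd_apply)
  also have "\<bar>\<dots>\<bar> \<le> 2 * pi / 3 * (14580 * C * B ^ 5 * D + (\<Sum>j<6::nat. 14580 * C * B ^ 5 * D))"
    unfolding abs_mult
  proof (rule mult_mono)
    show "\<bar>- Im (sextic K ?g (entries a) - sextic K ?g (entries b)) + (\<Sum>j<6. Re (sextic K r (?A a u j) - sextic K r (?A b v j)))\<bar>
      \<le> 14580 * C * B ^ 5 * D + (\<Sum>j<6::nat. 14580 * C * B ^ 5 * D)"
      using order_trans[OF abs_Im_le_cmod 1] order_trans[OF abs_Re_le_cmod 2]
      by (intro order_trans[OF abs_triangle_ineq] add_mono order_trans[OF sum_abs] sum_mono) (simp_all only: abs_minus_cancel)
  qed auto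
  finally show ?thesis by (simp add: algebra_simps)
qed

lemma rate_trunc:
  assumes "K \<le> J"
  shows "rate r m S K a v = rate r m S J (trunc K a) (trunc K v)"
proof -
  have 1: "sextic J f (entries (trunc K a)) = sextic K f (entries a)" for f
    unfolding entries_trunc[abs_def] sextic_trunc[OF assms, of f "entries a"] ..
  have 2: "sextic J r ((entries (trunc K a))(j := entries (\<lambda>n. - \<i> * (if n \<in> S then trunc K v n else 0)) j))
     = sextic K r ((entries a)(j := entries (\<lambda>n. - \<i> * (if n \<in> S then v n else 0)) j))" for j
    unfolding sextic_trunc[OF assms, symmetric]
    by (intro sextic_cong) (auto simp: entries_def trunc_def)
  show ?thesis unfolding rate_def 1 2 ..
qed

lemma convergent_rate:
  assumes r: "symb_le r (m - 1) C" and g: "symb_le (\<lambda>n. psi m n - reson n * r n) m C" and m: "2 \<le> m" and C: "0 \<le> C"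
    and a: "\<And>K. hnorm K m a \<le> B" and v: "\<And>K. hnorm K m v \<le> B"
  shows "convergent (\<lambda>K. rate r m S K a v)"
proof -
  obtain D where D: "D \<longlonglongrightarrow> 0" "\<And>K J. hnorm J m (\<lambda>n. a n - trunc K a n) \<le> D K" "\<And>K. 0 \<le> D K"
    using hnorm_tail[OF a] by auto
  obtain E where E: "E \<longlonglongrightarrow> 0" "\<And>K J. hnorm J m (\<lambda>n. v n - trunc K v n) \<le> E K" "\<And>K. 0 \<le> E K"
    using hnorm_tail[OF v] by auto
  show ?thesis
  proof (rule Cauchy_of_tail)
    show "(\<lambda>K. 2 * pi / 3 * (102060 * C * B ^ 5) * (D K + E K)) \<longlonglongrightarrow> 0"
      using tendsto_mult_right_zero[OF tendsto_add_zero[OF D(1) E(1)]] .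
    fix K J :: nat assume KJ: "K \<le> J"
    show "dist (rate r m S J a v) (rate r m S K a v) \<le> 2 * pi / 3 * (102060 * C * B ^ 5) * (D K + E K)"
      unfolding dist_real_def rate_trunc[OF KJ]
      by (rule rate_lipschitz[OF r g m C a order_trans[OF hnorm_trunc_le a] v order_trans[OF hnorm_trunc_le v]])
         (use D E order_trans[OF D(2)] order_trans[OF E(2)] in \<open>auto intro!: order_trans[OF D(2)] order_trans[OF E(2)]\<close>)
  qed
qed

section \<open>Passage to the limit in the derivative\<close>

text \<open>Joint convergence of the derivatives as \<open>K \<rightarrow> \<infinity>\<close> and \<open>t \<rightarrow> t0\<close> suffices; no uniformity on a fixed
  neighbourhood of \<open>t0\<close> is available from mere continuity of the flow.\<close>

lemma has_real_derivative_of_truncations: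
  fixes f :: "nat \<Rightarrow> real \<Rightarrow> real"
  assumes d: "0 < \<delta>" and der: "\<And>K t. (f K has_real_derivative g K t) (at t)"
    and lim: "\<And>t. (\<lambda>K. f K t) \<longlonglongrightarrow> F t"
    and bound: "\<And>K t. \<bar>t - t0\<bar> < \<delta> \<Longrightarrow> \<bar>g K t - L\<bar> \<le> Q * D t + \<theta> K"
    and D: "(D \<longlongrightarrow> 0) (at t0)" "D t0 = 0" and th: "\<theta> \<longlonglongrightarrow> 0"
  shows "(F has_real_derivative L) (at t0)"
proof -
  have "\<exists>d>0. \<forall>t. \<bar>t - t0\<bar> < d \<longrightarrow> \<bar>F t - F t0 - L * (t - t0)\<bar> \<le> e * \<bar>t - t0\<bar>" if e: "0 < e" for e
  proof -
    have "((\<lambda>t. Q * D t) \<longlongrightarrow> 0) (at t0)" using tendsto_mult_right_zero[OF D(1)] .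
    then obtain d1 where d1: "0 < d1" "\<And>t. t \<noteq> t0 \<Longrightarrow> dist t t0 < d1 \<Longrightarrow> Q * D t < e / 2"
      using order_tendstoD(2)[of "\<lambda>t. Q * D t" 0 "at t0" "e/2"] e unfolding eventually_at by auto
    obtain N where N: "\<And>K. K \<ge> N \<Longrightarrow> \<theta> K < e / 2"
      using order_tendstoD(2)[OF th, of "e/2"] e unfolding eventually_sequentially by auto
    define d' where "d' = min \<delta> d1"
    have small: "\<bar>g K t - L\<bar> \<le> e" if "K \<ge> N" "\<bar>t - t0\<bar> < d'" for K t
    proof -
      have "Q * D t < e / 2" using d1(2)[of t] that D(2) e unfolding d'_def dist_real_def by (cases "t = t0") auto
      then show ?thesis using bound[of t K] N[OF that(1)] that(2) unfolding d'_def by auto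
    qed
    have "\<bar>F t - F t0 - L * (t - t0)\<bar> \<le> e * \<bar>t - t0\<bar>" if t: "\<bar>t - t0\<bar> < d'" for t
    proof (rule LIMSEQ_le_const2)
      show "(\<lambda>K. \<bar>f K t - f K t0 - L * (t - t0)\<bar>) \<longlonglongrightarrow> \<bar>F t - F t0 - L * (t - t0)\<bar>"
        by (intro tendsto_intros lim)
      show "\<exists>N. \<forall>K\<ge>N. \<bar>f K t - f K t0 - L * (t - t0)\<bar> \<le> e * \<bar>t - t0\<bar>"
      proof (intro exI[of _ N] allI impI)
        fix K assume K: "K \<ge> N"
        \<comment> \<open>Mean value inequality for \<open>f K\<close> minus the line of slope
          \<open>L\<close>; the estimate is uniform in \<open>K >= N\<close> and survives the limit
          in \<open>K\<close>.\<close>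
        have "norm ((f K t - L * t) - (f K t0 - L * t0)) \<le> e * norm (t - t0)"
        proof (rule field_differentiable_bound[where S="{t. \<bar>t - t0\<bar> < d'}"])
          show "convex {t. \<bar>t - t0\<bar> < d'}"
            using convex_ball[of t0 d'] by (simp add: ball_def dist_real_def abs_minus_commute)
          show "((\<lambda>t. f K t - L * t) has_field_derivative (g K z - L)) (at z within {t. \<bar>t - t0\<bar> < d'})" for z
            by (rule has_field_derivative_at_within) (auto intro!: derivative_eq_intros der)
        qed (use small K t in auto)
        then show "\<bar>f K t - f K t0 - L * (t - t0)\<bar> \<le> e * \<bar>t - t0\<bar>"
          by (simp add: algebra_simps)
      qed
    qed
    then show ?thesis using d d1(1) unfolding d'_def by (intro exI[of _ "min \<delta> d1"]) auto
  qed
  then have "(F has_derivative (\<lambda>h. L * h)) (at t0)"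
    unfolding has_derivative_at_alt by (auto simp: bounded_linear_mult_right)
  then show ?thesis by (simp add: has_field_derivative_def)
qed

text \<open>Near \<open>t0\<close> everything is measured against the solution at \<open>t0\<close>:
  the rates differ by a multiple of \<open>D t\<close>, and the error from truncating inside the
  nonlinearity is bounded through \<open>D t\<close> and the tail at \<open>t0\<close>. This is the
  joint smallness that \<open>has_real_derivative_of_truncations\<close> asks for.\<close>

lemma truncation_limit_derivative:
  assumes r: "symb_le r (m - 1) C" and g: "symb_le (\<lambda>n. psi m n - reson n * r n) m C" and m: "2 \<le> m" and C: "0 \<le> C"
    and c': "\<And>t n. ((\<lambda>\<tau>. c \<tau> n) has_vector_derivative
      (- \<i> * (of_int n ^ 2 * c t n + (if n \<in> S then v t n else 0)))) (at t)"
    and S: "\<And>t n. n \<notin> S \<Longrightarrow> c t n = 0"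
    and bd: "\<And>K. hnorm K m (c t0) \<le> B"
    and D: "\<And>t K. hnorm K m (\<lambda>n. c t n - c t0 n) \<le> D t" "(D \<longlongrightarrow> 0) (at t0)" "D t0 = 0"
    and v: "\<And>t. quintic_lim (c t) (v t)"
    and E: "\<And>t. (\<lambda>K. energy_trunc r m K (c t)) \<longlonglongrightarrow> E t"
  shows "(\<lambda>K. rate r m S K (c t0) (v t0)) \<longlonglongrightarrow> lim (\<lambda>K. rate r m S K (c t0) (v t0)) \<and>
    (E has_real_derivative lim (\<lambda>K. rate r m S K (c t0) (v t0))) (at t0)"
proof -
  define M where "M = 12150 * 5 ^ m * (1::real)"
  have M0: "0 \<le> M" by (simp add: M_def)
  have m1: "1 \<le> m" using m by simp
  define B1 where "B1 = B + 1"
  have B0: "0 \<le> B" using order_trans[OF hnorm_nonneg bd] .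
  define B2 where "B2 = B1 + M * B1 ^ 5"
  have B2: "B1 \<le> B2" "M * B1 ^ 5 \<le> B2" "0 \<le> B2" using B0 M0 by (auto simp: B2_def B1_def)
  have D0: "0 \<le> D t" for t using order_trans[OF hnorm_nonneg D(1)] .
  obtain \<delta> where \<delta>: "0 < \<delta>" "\<And>t. \<bar>t - t0\<bar> < \<delta> \<Longrightarrow> D t \<le> 1"
  proof -
    obtain d where "0 < d" "\<And>t. t \<noteq> t0 \<Longrightarrow> dist t t0 < d \<Longrightarrow> D t < 1"
      using order_tendstoD(2)[OF D(2), of 1] unfolding eventually_at by auto
    then show thesis using D(3) by (intro that[of d]) (metis dist_real_def less_imp_le zero_le_one)+
  qed
  have c1: "hnorm K m (c t) \<le> B1" if "\<bar>t - t0\<bar> < \<delta>" for K t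
    using hnorm_triangle[of K m "c t0" "\<lambda>n. c t n - c t0 n"] bd[of K] D(1)[of K t] \<delta>(2)[OF that] by (simp add: B1_def)
  have vb: "hnorm K m (v t) \<le> M * B1 ^ 5" if "\<bar>t - t0\<bar> < \<delta>" for K t
    using hnorm_quintic_lim_bound[OF m1 c1[OF that] v] by (simp add: M_def)
  have vd: "hnorm K m (\<lambda>n. v t n - v t0 n) \<le> M * D t * B1 ^ 4" if "\<bar>t - t0\<bar> < \<delta>" for K t
    using hnorm_quintic_lim_lipschitz[OF m1 c1[OF that] c1[of t0] D(1)[of _ t], of K "v t" "v t0"] v \<delta>(1)
    unfolding quintic_lim_def by (auto simp: M_def)
  obtain T where T: "T \<longlonglongrightarrow> 0" "\<And>K J. hnorm J m (\<lambda>n. c t0 n - trunc K (c t0) n) \<le> T K" "\<And>K. 0 \<le> T K"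
   
    using hnorm_tail[OF bd] by auto
  define L where "L = lim (\<lambda>K. rate r m S K (c t0) (v t0))"
  have conv: "(\<lambda>K. rate r m S K (c t0) (v t0)) \<longlonglongrightarrow> L"
    unfolding L_def using convergent_rate[OF r g m C, of "c t0" B2 "v t0"] order_trans[OF c1 B2(1)] order_trans[OF vb B2(2)] \<delta>(1)
    by (intro convergent_LIMSEQ_iff[THEN iffD1]) auto
  define X where "X K t = 4 * pi * Im (\<Sum>n\<in>freqs K. of_real (jap n ^ (2 * m)) * cnj (c t n) * (v t n - qconv K (c t) n))" for K t
  have Xb: "\<bar>X K t\<bar> \<le> 4 * pi * B1 * (M * (2 * D t + T K) * B1 ^ 4)" if t: "\<bar>t - t0\<bar> < \<delta>" for K t
  proof -
    let ?I = "(freqs K)"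
    \<comment> \<open>The tail at time \<open>t\<close> is compared with that at \<open>t0\<close>;
      the difference of the two times enters twice, once as it is and once truncated.\<close>
    have tail: "hnorm J m (\<lambda>n. c t n - trunc K (c t) n) \<le> 2 * D t + T K" for J
    proof -
      have "hnorm J m (\<lambda>n. c t n - trunc K (c t) n) \<le>
         hnorm J m (\<lambda>n. c t n - c t0 n) + hnorm J m (\<lambda>n. (c t0 n - trunc K (c t0) n) + trunc K (\<lambda>n. c t0 n - c t n) n)"
        by (rule order_trans[OF _ hnorm_triangle]) (auto intro!: eq_refl hnorm_cong simp: trunc_def)
      also have "\<dots> \<le> hnorm J m (\<lambda>n. c t n - c t0 n) + (hnorm J m (\<lambda>n. c t0 n - trunc K (c t0) n) + hnorm K m (\<lambda>n. c t0 n - c t n))"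
        by (intro add_left_mono order_trans[OF hnorm_triangle] hnorm_trunc_le)
      finally show ?thesis using D(1)[of J t] D(1)[of K t] T(2)[of J K] hnorm_minus_commute[of K m "c t0" "c t"] by simp
    qed
    \<comment> \<open>The truncated convolution is the quintic limit of the truncated solution, so
      the Lipschitz estimate applies to the pair.\<close>
    have q: "hnorm K m (\<lambda>n. v t n - qconv K (c t) n) \<le> M * (2 * D t + T K) * B1 ^ 4"
      unfolding M_def mult_1_right
    proof (rule hnorm_quintic_lim_lipschitz[OF m1 c1[OF t] order_trans[OF hnorm_trunc_le c1[OF t]] tail])
      show "(\<lambda>J. qconv J (c t) n) \<longlonglongrightarrow> v t n" for n using v by (simp add: quintic_lim_def)
      show "(\<lambda>J. qconv J (trunc K (c t)) n) \<longlonglongrightarrow> qconv K (c t) n" if "n \<in> ?I" for n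
        by (rule tendsto_eventually) (use qconv_trunc[OF _ that] in \<open>auto simp: eventually_sequentially\<close>)
    qed
    have "\<bar>Im (\<Sum>n\<in>?I. of_real (jap n ^ (2 * m)) * cnj (c t n) * (v t n - qconv K (c t) n))\<bar>
      \<le> (\<Sum>n\<in>?I. \<bar>jap n ^ m * cmod (c t n)\<bar> * \<bar>jap n ^ m * cmod (v t n - qconv K (c t) n)\<bar>)"
      by (intro order_trans[OF abs_Im_le_cmod] sum_norm_le)
         (simp add: norm_mult norm_power power_even_eq power2_eq_square abs_mult)
    also have "\<dots> \<le> hnorm K m (c t) * hnorm K m (\<lambda>n. v t n - qconv K (c t) n)"
      unfolding hnorm_def by (rule L2_set_mult_ineq)
    also have "\<dots> \<le> B1 * (M * (2 * D t + T K) * B1 ^ 4)"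
      using c1[OF t] q by (intro mult_mono) (auto intro: order_trans[OF hnorm_nonneg])
    finally show ?thesis unfolding X_def abs_mult by (simp add: mult.assoc)
  qed
  define Q1 where "Q1 = 2 * pi / 3 * (102060 * C * B2 ^ 5)"
  have Q10: "0 \<le> Q1" using C B2 by (simp add: Q1_def)
  have rb: "\<bar>rate r m S K (c t) (v t) - rate r m S K (c t0) (v t0)\<bar> \<le> Q1 * (D t + M * D t * B1 ^ 4)" if t: "\<bar>t - t0\<bar> < \<delta>" for K t
    unfolding Q1_def
  proof (rule rate_lipschitz[OF r g m C])
    show "hnorm K m (c t) \<le> B2" "hnorm K m (c t0) \<le> B2" "hnorm K m (v t) \<le> B2" "hnorm K m (v t0) \<le> B2"
      using order_trans[OF c1 B2(1)] order_trans[OF vb B2(2)] t \<delta>(1) by auto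
    have "0 \<le> M * D t * B1 ^ 4" using M0 D0 B0 by (simp add: B1_def)
    then show "hnorm K m (\<lambda>n. c t n - c t0 n) \<le> D t + M * D t * B1 ^ 4"
      "hnorm K m (\<lambda>n. v t n - v t0 n) \<le> D t + M * D t * B1 ^ 4"
      using D(1)[of K t] vd[OF t, of K] D0[of t] by linarith+
  qed
  define W where "W = 4 * pi * B1 * M * B1 ^ 4"
  have "(E has_real_derivative L) (at t0)"
  proof (rule has_real_derivative_of_truncations[where D=D and \<delta>=\<delta> and f="\<lambda>K t. energy_trunc r m K (c t)"])
    show "((\<lambda>t. energy_trunc r m K (c t)) has_real_derivative rate r m S K (c t) (v t) + X K t) (at t)" for K t
      unfolding X_def by (rule energy_trunc_derivative[OF c' S])
    show "\<bar>rate r m S K (c t) (v t) + X K t - L\<bar> \<le> (Q1 * (1 + M * B1 ^ 4) + W * 2) * D t + (W * T K + \<bar>rate r m S K (c t0) (v t0) - L\<bar>)"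
      if "\<bar>t - t0\<bar> < \<delta>" for K t
    proof -
      have "\<bar>rate r m S K (c t) (v t) + X K t - L\<bar> \<le> \<bar>rate r m S K (c t) (v t) - rate r m S K (c t0) (v t0)\<bar> + \<bar>X K t\<bar> + \<bar>rate r m S K (c t0) (v t0) - L\<bar>"
        by linarith
      also have "\<dots> \<le> Q1 * (D t + M * D t * B1 ^ 4) + 4 * pi * B1 * (M * (2 * D t + T K) * B1 ^ 4) + \<bar>rate r m S K (c t0) (v t0) - L\<bar>"
        using rb[OF that] Xb[OF that] by (intro add_mono) auto
      also have "\<dots> = (Q1 * (1 + M * B1 ^ 4) + W * 2) * D t + (W * T K + \<bar>rate r m S K (c t0) (v t0) - L\<bar>)"
        by (simp add: W_def algebra_simps)
      finally show ?thesis .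
    qed
    have "(\<lambda>K. \<bar>rate r m S K (c t0) (v t0) - L\<bar>) \<longlonglongrightarrow> \<bar>L - L\<bar>" by (intro tendsto_intros conv)
    then show "(\<lambda>K. W * T K + \<bar>rate r m S K (c t0) (v t0) - L\<bar>) \<longlonglongrightarrow> 0"
      using tendsto_add_zero[OF tendsto_mult_right_zero[OF T(1), of W]] by simp
  qed (use \<delta> D E in auto)
  with conv show ?thesis unfolding L_def by blast
qed

text \<open>The bound \<open>G\<close> for the remainder form stays a parameter: it comes from
  \<open>sextic_bound\<close> when \<open>k >= 2\<close> and from the \<open>L^4\<close> norm when
  \<open>k = 1\<close>. Each of the six inserted forms has five factors of norm \<open>B\<close> and
  one of norm \<open>V\<close>.\<close>

lemma rate_bound:
  assumes r: "symb_le r (m - 1) C" and m: "2 \<le> m" and C: "0 \<le> C"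
    and a: "hnorm K (m - 1) a \<le> B" and v: "hnorm K (m - 1) v \<le> V"
    and G: "cmod (sextic K (\<lambda>n. psi m n - reson n * r n) (entries a)) \<le> G"
  shows "\<bar>rate r m S K a v\<bar> \<le> 2 * pi / 3 * (G + 14580 * C * B ^ 5 * V)"
proof -
  let ?A = "\<lambda>j. (entries a)(j := entries (\<lambda>n. - \<i> * (if n \<in> S then v n else 0)) j)"
  have N: "hnorm K (m - 1) (\<lambda>n. - \<i> * (if n \<in> S then v n else 0)) \<le> V"
    by (intro order_trans[OF hnorm_mono v]) (auto simp: norm_mult)
  have B: "0 \<le> B" using a hnorm_nonneg order_trans by blast
  have 1: "cmod (sextic K r (?A j)) \<le> 2430 * C * (B ^ 5 * V)" if j: "j < 6" for j
  proof -
    have "(\<Prod>l<6. hnorm K (m - 1) (?A j l)) = hnorm K (m - 1) (?A j j) * (\<Prod>l\<in>{..<6}-{j}. hnorm K (m - 1) (?A j l))"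
      using j by (simp add: prod.remove)
    also have "\<dots> \<le> V * (\<Prod>l\<in>{..<6}-{j}. B)"
      using a N order_trans[OF hnorm_nonneg v] by (intro mult_mono prod_mono prod_nonneg) auto
    also have "\<dots> = B ^ 5 * V" using j by simp
    finally show ?thesis
      by (intro order_trans[OF sextic_bound[OF r _ C] mult_left_mono]) (use m C in simp_all)
  qed
  have "\<bar>rate r m S K a v\<bar> = 2 * pi / 3 * \<bar>- Im (sextic K (\<lambda>n. psi m n - reson n * r n) (entries a)) + (\<Sum>j<6. Re (sextic K r (?A j)))\<bar>"
    unfolding rate_def by (subst abs_of_nonneg[of "2 * pi / 3", symmetric], simp, unfold abs_mult[symmetric]) (simp add: algebra_simps del: fun_upd_apply)
  also have "\<dots> \<le> 2 * pi / 3 * (G + (\<Sum>j<6::nat. 2430 * C * (B ^ 5 * V)))"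
  proof (rule mult_left_mono)
    show "\<bar>- Im (sextic K (\<lambda>n. psi m n - reson n * r n) (entries a)) + (\<Sum>j<6. Re (sextic K r (?A j)))\<bar> \<le> G + (\<Sum>j<6::nat. 2430 * C * (B ^ 5 * V))"
      using order_trans[OF abs_Im_le_cmod G] order_trans[OF abs_Re_le_cmod 1]
      by (intro order_trans[OF abs_triangle_ineq] add_mono order_trans[OF sum_abs] sum_mono) (simp_all only: abs_minus_cancel lessThan_iff)
  qed simp
  finally show ?thesis by (simp add: mult_ac)
qed

section \<open>Fourier series on the torus\<close>

definition mode :: "int \<Rightarrow> real \<Rightarrow> complex" where
  "mode n x = exp (\<i> * of_int n * of_real x)"

lemma mode_mult: "mode n x * mode m x = mode (n + m) x"
  by (simp add: mode_def algebra_simps flip: exp_add)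

lemma cnj_mode: "cnj (mode n x) = mode (- n) x"
  by (simp add: mode_def exp_cnj)

lemma norm_mode [simp]: "cmod (mode n x) = 1"
  by (simp add: mode_def norm_exp_eq_Re)

lemma mode_0 [simp]: "mode 0 x = 1"
  by (simp add: mode_def)

lemma continuous_on_mode [continuous_intros]: "continuous_on S (mode n)"
  unfolding mode_def[abs_def] by (intro continuous_intros)

lemma mode_periodic: "mode n (x + 2 * pi) = mode n x"
proof -
  have "\<i> * of_int n * of_real (x + 2 * pi) = \<i> * of_int n * of_real x + (2 * of_int n * of_real pi) * \<i>"
    by (simp add: algebra_simps)
  moreover have "exp ((2 * complex_of_int n * of_real pi) * \<i>) = 1"
    using exp_integer_2pi[of "of_int n"] by simp
  ultimately show ?thesis unfolding mode_def by (simp only: exp_add mult_1_right)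
qed

lemma mode_has_vector_derivative: "(mode n has_vector_derivative (\<i> * of_int n * mode n x)) (at x within S)"
proof -
  have "((\<lambda>z. exp (\<i> * of_int n * z)) has_field_derivative (\<i> * of_int n * exp (\<i> * of_int n * of_real x))) (at (of_real x))"
    by (auto intro!: derivative_eq_intros)
  then show ?thesis
    unfolding mode_def[abs_def] by (intro has_vector_derivative_real_field)
qed

lemma fourier_coeff_mode: "fourier_coeff u n = (1 / (2 * pi)) * (LINT x|torus. u x * mode (- n) x)"
  by (simp add: fourier_coeff_def mode_def)

lemma integrable_torus_continuous:
  fixes f :: "real \<Rightarrow> 'b::euclidean_space"
  shows "continuous_on {0..2 * pi} f \<Longrightarrow> integrable torus f"
  by (rule continuous_imp_integrable_real)

lemma LINT_mode: "(LINT x|torus. mode n x) = (if n = 0 then 2 * pi else 0)"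
proof (cases "n = 0")
  case True
  then have "mode n = (\<lambda>x. 1)" by auto
  then have "(LINT x|torus. mode n x) = integral {0..2 * pi} (\<lambda>x. 1 :: complex)"
    by (subst lebesgue_integral_eq_integral) (auto intro: integrable_torus_continuous)
  then show ?thesis using True by (simp add: scaleR_conv_of_real)
next
  case False
  have "((\<lambda>x. \<i> * of_int n * mode n x) has_integral (mode n (2 * pi) - mode n 0)) {0..2 * pi}"
    by (rule fundamental_theorem_of_calculus) (auto intro: mode_has_vector_derivative)
  moreover have "mode n (2 * pi) = mode n 0" using mode_periodic[of n 0] by simp
  ultimately have "((\<lambda>x. \<i> * of_int n * mode n x) has_integral 0) {0..2 * pi}"
    by simp
  then have "integral {0..2 * pi} (\<lambda>x. \<i> * of_int n * mode n x) = 0"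
    by (rule integral_unique)
  then have "integral {0..2 * pi} (mode n) = 0" using False by (simp add: integral_mult_right)
  moreover have "(LINT x|torus. mode n x) = integral {0..2 * pi} (mode n)"
    by (intro lebesgue_integral_eq_integral integrable_torus_continuous continuous_intros) auto
  ultimately show ?thesis using False by simp
qed

definition tpoly :: "nat \<Rightarrow> (int \<Rightarrow> complex) \<Rightarrow> real \<Rightarrow> complex" where
  "tpoly K a x = (\<Sum>n\<in>freqs K. a n * mode n x)"

lemma continuous_on_tpoly [continuous_intros]: "continuous_on S (tpoly K a)"
  unfolding tpoly_def[abs_def] by (intro continuous_intros)

lemma tpoly_periodic: "tpoly K a (x + 2 * pi) = tpoly K a x"
  unfolding tpoly_def mode_periodic ..

lemma measurable_torus_continuous:
  fixes f :: "real \<Rightarrow> 'b::euclidean_space"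
  shows "continuous_on {0..2 * pi} f \<Longrightarrow> f \<in> borel_measurable torus"
  using borel_measurable_integrable integrable_torus_continuous by blast

lemma L2_continuous: "continuous_on {0..2 * pi} f \<Longrightarrow> f \<in> L2_torus"
  unfolding L2_torus_def
  by (auto intro!: measurable_torus_continuous integrable_torus_continuous continuous_intros)

lemma integrable_mult_L2:
  assumes "f \<in> L2_torus" "g \<in> L2_torus"
  shows "integrable torus (\<lambda>x. f x * g x)"
proof (rule Bochner_Integration.integrable_bound)
  show "integrable torus (\<lambda>x. (cmod (f x))\<^sup>2 + (cmod (g x))\<^sup>2)"
    using assms unfolding L2_torus_def by auto
  show "(\<lambda>x. f x * g x) \<in> borel_measurable torus"
    using assms unfolding L2_torus_def by auto
  have "a * b \<le> a\<^sup>2 + b\<^sup>2" for a b :: real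
  proof -
    have "2 * (a * b) \<le> a\<^sup>2 + b\<^sup>2" using sum_squares_bound[of a b] by (simp add: mult.assoc)
    moreover have "0 \<le> a\<^sup>2 + b\<^sup>2" by simp
    ultimately show ?thesis by linarith
  qed
  then show "AE x in torus. cmod (f x * g x) \<le> norm ((cmod (f x))\<^sup>2 + (cmod (g x))\<^sup>2)"
    by (auto simp: norm_mult)
qed

lemma integrable_mult_mode: "f \<in> L2_torus \<Longrightarrow> integrable torus (\<lambda>x. f x * mode n x)"
  by (rule integrable_mult_L2, assumption, rule L2_continuous, rule continuous_on_mode)

lemma LINT_mult_mode: "(LINT x|torus. f x * mode (- n) x) = 2 * pi * fourier_coeff f n"
  by (simp add: fourier_coeff_mode)

lemma fourier_coeff_diff:
  assumes "f \<in> L2_torus" "g \<in> L2_torus"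
  shows "fourier_coeff (\<lambda>x. f x - g x) n = fourier_coeff f n - fourier_coeff g n"
  unfolding fourier_coeff_mode
  by (simp add: left_diff_distrib right_diff_distrib integrable_mult_mode assms)

lemma fourier_coeff_tpoly: "fourier_coeff (tpoly K a) n = (if n \<in> (freqs K) then a n else 0)"
proof -
  have "(LINT x|torus. tpoly K a x * mode (- n) x) = (LINT x|torus. (\<Sum>k\<in>freqs K. a k * mode (k - n) x))"
    unfolding tpoly_def sum_distrib_right mult.assoc mode_mult by simp
  also have "\<dots> = (\<Sum>k\<in>freqs K. LINT x|torus. a k * mode (k - n) x)"
    by (intro Bochner_Integration.integral_sum integrable_torus_continuous continuous_intros)
  also have "\<dots> = (\<Sum>k\<in>freqs K. if k = n then 2 * pi * a n else 0)"
    by (intro sum.cong refl) (auto simp: LINT_mode)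
  also have "\<dots> = (if n \<in> (freqs K) then 2 * pi * a n else 0)"
    by (simp add: sum.delta)
  finally show ?thesis unfolding fourier_coeff_mode by auto
qed

text \<open>Completing the square mode by mode. With the Fourier coefficients for \<open>a\<close>
  it gives Bessel's inequality; with arbitrary \<open>a\<close> it shows that the Fourier
  coefficients are the best choice, which is how density yields Parseval.\<close>

lemma tpoly_dist_sq:
  assumes g: "g \<in> L2_torus"
  shows "(LINT x|torus. (cmod (g x - tpoly K a x))\<^sup>2) = (LINT x|torus. (cmod (g x))\<^sup>2)
     - 2 * pi * (\<Sum>n\<in>freqs K. (cmod (fourier_coeff g n))\<^sup>2)
     + 2 * pi * (\<Sum>n\<in>freqs K. (cmod (fourier_coeff g n - a n))\<^sup>2)"
proof -
  let ?I = "(freqs K)"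
  have inner: "(LINT x|torus. f x * cnj (tpoly K a x)) = (\<Sum>n\<in>?I. 2 * pi * (cnj (a n) * fourier_coeff f n))"
    if f: "f \<in> L2_torus" for f
  proof -
    have "(LINT x|torus. f x * cnj (tpoly K a x)) = (LINT x|torus. (\<Sum>n\<in>?I. cnj (a n) * (f x * mode (- n) x)))"
      unfolding tpoly_def cnj_sum sum_distrib_left by (simp add: cnj_mode mult_ac)
    also have "\<dots> = (\<Sum>n\<in>?I. LINT x|torus. cnj (a n) * (f x * mode (- n) x))"
      by (intro Bochner_Integration.integral_sum integrable_mult_right integrable_mult_mode f)
    also have "\<dots> = (\<Sum>n\<in>?I. cnj (a n) * (2 * pi * fourier_coeff f n))"
      by (simp only: Bochner_Integration.integral_mult_right_zero LINT_mult_mode)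
    finally show ?thesis by (simp only: mult_ac)
  qed
  have t: "tpoly K a \<in> L2_torus" by (intro L2_continuous continuous_intros)
  have tc: "(\<lambda>x. cnj (tpoly K a x)) \<in> L2_torus" by (intro L2_continuous continuous_intros)
  have pw: "(cmod (z - w))\<^sup>2 = (cmod z)\<^sup>2 - 2 * Re (z * cnj w) + Re (w * cnj w)" for z w
    by (simp add: cmod_power2) (simp add: power2_eq_square algebra_simps)
  have ints: "integrable torus (\<lambda>x. (cmod (g x))\<^sup>2)" "integrable torus (\<lambda>x. Re (g x * cnj (tpoly K a x)))"
    "integrable torus (\<lambda>x. Re (tpoly K a x * cnj (tpoly K a x)))"
    using g integrable_mult_L2[OF g tc] integrable_mult_L2[OF t tc] unfolding L2_torus_def
    by (auto intro: integrable_Re simp del: times_complex.sel complex_cnj_mult)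
  have "(LINT x|torus. (cmod (g x - tpoly K a x))\<^sup>2) = (LINT x|torus. (cmod (g x))\<^sup>2)
     - 2 * (LINT x|torus. Re (g x * cnj (tpoly K a x))) + (LINT x|torus. Re (tpoly K a x * cnj (tpoly K a x)))"
    unfolding pw using ints by (simp del: times_complex.sel)
  also have "(LINT x|torus. Re (g x * cnj (tpoly K a x))) = Re (\<Sum>n\<in>?I. 2 * pi * (cnj (a n) * fourier_coeff g n))"
    by (subst integral_Re[OF integrable_mult_L2[OF g tc]]) (simp only: inner[OF g])
  also have "(LINT x|torus. Re (tpoly K a x * cnj (tpoly K a x))) = Re (\<Sum>n\<in>?I. 2 * pi * (cnj (a n) * a n))"
    by (subst integral_Re[OF integrable_mult_L2[OF t tc]])
       (simp only: inner[OF t], rule arg_cong[where f=Re], intro sum.cong refl, simp add: fourier_coeff_tpoly)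
  finally have "(LINT x|torus. (cmod (g x - tpoly K a x))\<^sup>2) = (LINT x|torus. (cmod (g x))\<^sup>2)
     + (\<Sum>n\<in>?I. 2 * pi * (Re (a n * cnj (a n)) - 2 * Re (fourier_coeff g n * cnj (a n))))"
    by (simp add: sum_subtractf sum_distrib_left mult_ac algebra_simps)
  also have "(\<Sum>n\<in>?I. 2 * pi * (Re (a n * cnj (a n)) - 2 * Re (fourier_coeff g n * cnj (a n))))
      = (\<Sum>n\<in>?I. 2 * pi * ((cmod (fourier_coeff g n - a n))\<^sup>2 - (cmod (fourier_coeff g n))\<^sup>2))"
    unfolding pw by (simp add: algebra_simps)
  finally show ?thesis by (simp add: sum_subtractf sum_distrib_left algebra_simps)
qed

lemma bessel_inequality:
  assumes "g \<in> L2_torus"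
  shows "2 * pi * (\<Sum>n\<in>freqs K. (cmod (fourier_coeff g n))\<^sup>2) \<le> (LINT x|torus. (cmod (g x))\<^sup>2)"
proof -
  have "0 \<le> (LINT x|torus. (cmod (g x - tpoly K (fourier_coeff g) x))\<^sup>2)"
    by (rule Bochner_Integration.integral_nonneg) simp
  then show ?thesis unfolding tpoly_dist_sq[OF assms] by simp
qed

section \<open>Density of trigonometric polynomials\<close>

inductive trig :: "(real \<Rightarrow> complex) \<Rightarrow> bool" where
  trig_mode: "trig (\<lambda>x. c * mode n x)"
| trig_add: "trig f \<Longrightarrow> trig g \<Longrightarrow> trig (\<lambda>x. f x + g x)"

text \<open>Closure under products is the purpose of the inductive class: polynomials on the circle
  translate without tracking degrees, and \<open>trig_imp_tpoly\<close> recovers the cutoff at the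
  end.\<close>

lemma trig_mult: "trig f \<Longrightarrow> trig g \<Longrightarrow> trig (\<lambda>x. f x * g x)"
proof (induction f rule: trig.induct)
  case (trig_mode c n)
  from trig_mode show ?case
  proof (induction g rule: trig.induct)
    case (trig_mode c' m)
    have "(\<lambda>x. c * mode n x * (c' * mode m x)) = (\<lambda>x. (c * c') * mode (n + m) x)"
      by (simp add: mult_ac flip: mode_mult)
    then show ?case by (simp only: trig.trig_mode)
  next
    case (trig_add f g)
    then show ?case using trig.trig_add by (simp add: distrib_left)
  qed
next
  case (trig_add f h)
  then show ?case using trig.trig_add by (simp add: distrib_right)
qed

lemma trig_imp_tpoly: "trig f \<Longrightarrow> \<exists>K a. f = tpoly K a"
proof (induction rule: trig.induct)
  case (trig_mode c n)
  have "n \<in> {- int (nat \<bar>n\<bar>)..int (nat \<bar>n\<bar>)}" by auto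
  then have "(\<lambda>x. c * mode n x) = tpoly (nat \<bar>n\<bar>) (\<lambda>k. if k = n then c else 0)"
    unfolding tpoly_def by (simp add: if_distrib[of "\<lambda>z. z * _"] sum.delta del: atLeastAtMost_iff cong: if_cong)
  then show ?case by blast
next
  case (trig_add f g)
  then obtain K a L b where fg: "f = tpoly K a" "g = tpoly L b" by blast
  have extend: "tpoly N a x = tpoly (max N M) (trunc N a) x" for N M a x
    unfolding tpoly_def by (rule sum.mono_neutral_cong_left) (auto simp: trunc_def)
  have "(\<lambda>x. f x + g x) = tpoly (max K L) (\<lambda>n. trunc K a n + trunc L b n)"
    unfolding fg extend[of K _ _ L] extend[of L _ _ K] max.commute[of L K]
    by (rule ext) (simp add: tpoly_def sum.distrib distrib_right)
  then show ?case by blast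
qed

lemma trig_of_real_polynomial:
  "real_polynomial_function p \<Longrightarrow> trig (\<lambda>x. of_real (p (exp (\<i> * of_real x))))"
proof (induction rule: real_polynomial_function.induct)
  case (linear f)
  interpret f: bounded_linear f by fact
  have fz: "f z = Re z * f 1 + Im z * f \<i>" for z
  proof -
    have "z = Re z *\<^sub>R 1 + Im z *\<^sub>R \<i>" by (simp add: complex_eq_iff)
    then show ?thesis by (metis f.add f.scaleR real_scaleR_def)
  qed
  \<comment> \<open>A real linear functional on the circle is a combination of cosine and sine,
    hence of the modes \<open>1\<close> and \<open>- 1\<close>.\<close>
  have "of_real (f (exp (\<i> * of_real x))) =
     (f 1 / 2 - \<i> * f \<i> / 2) * mode 1 x + (f 1 / 2 + \<i> * f \<i> / 2) * mode (- 1) x" for x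
  proof -
    have "exp (\<i> * of_real x) = cis x" by (simp add: cis_conv_exp)
    moreover have "mode 1 x = cis x" "mode (- 1) x = cnj (cis x)"
      by (simp_all add: mode_def cis_conv_exp exp_cnj)
    ultimately show ?thesis
      unfolding fz[of "exp (\<i> * of_real x)"] by (simp add: complex_eq_iff)
  qed
  then show ?case by (simp only: trig.intros)
next
  case (const c)
  then show ?case using trig_mode[of "of_real c" 0] by simp
qed (auto intro: trig_add trig_mult)

lemma trig_of_polynomial:
  assumes "polynomial_function (p :: complex \<Rightarrow> complex)"
  shows "trig (\<lambda>x. p (exp (\<i> * of_real x)))"
proof -
  have "trig (\<lambda>x. of_real (Re (p (exp (\<i> * of_real x)))))" "trig (\<lambda>x. of_real (Im (p (exp (\<i> * of_real x)))))"
    using assms trig_of_real_polynomial[of "Re \<circ> p"] trig_of_real_polynomial[of "Im \<circ> p"]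
    unfolding polynomial_function_def by (auto simp: bounded_linear_Re bounded_linear_Im)
  moreover have "trig (\<lambda>x. \<i>)" using trig_mode[of \<i> 0] by simp
  ultimately have "trig (\<lambda>x. of_real (Re (p (exp (\<i> * of_real x)))) + \<i> * of_real (Im (p (exp (\<i> * of_real x)))))"
    by (intro trig_add trig_mult)
  then show ?thesis by (simp flip: complex_eq)
qed

text \<open>A function with matching end values descends to the circle, where Stone-Weierstrass
  approximates it by polynomials in the real coordinates; these pull back to trigonometric
  polynomials.\<close>

lemma periodic_approx_tpoly:
  assumes h: "continuous_on {0..2 * pi} h" "h 0 = h (2 * pi)" and e: "0 < e"
  shows "\<exists>K a. \<forall>x\<in>{0..2 * pi}. cmod (h x - tpoly K a x) < e"
proof -
  define E where "E x = exp (\<i> * complex_of_real x)" for x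
  define F where "F z = h (Arg2pi z)" for z
  have FE: "F (E x) = h x" if "x \<in> {0..2 * pi}" for x
  proof (cases "x = 2 * pi")
    case True
    then have "E x = 1" by (simp add: E_def exp_two_pi_i' mult.commute)
    then show ?thesis using h(2) True Arg2pi_exp[of 0] by (simp add: F_def)
  next
    case False
    then show ?thesis using that by (simp add: F_def E_def Arg2pi_exp)
  qed
  have contE: "continuous_on S E" for S unfolding E_def[abs_def] by (intro continuous_intros)
  have im: "E ` {0..2 * pi} = sphere 0 1"
  proof
    show "E ` {0..2 * pi} \<subseteq> sphere 0 1" by (auto simp: E_def norm_exp_eq_Re)
    show "sphere 0 1 \<subseteq> E ` {0..2 * pi}"
    proof
      fix z :: complex assume "z \<in> sphere 0 1"
      then have "E (Arg2pi z) = z" using complex_norm_eq_1_exp[of z] by (simp add: E_def)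
      moreover have "Arg2pi z \<in> {0..2 * pi}" using Arg2pi[of z] by auto
      ultimately show "z \<in> E ` {0..2 * pi}" by (metis image_eqI)
    qed
  qed
  \<comment> \<open>The map from the compact interval onto the circle is closed, so preimages of
    closed sets under \<open>F\<close> are images of compact sets. The jump of \<open>Arg2pi\<close>
    at \<open>1\<close> is harmless because the end values agree.\<close>
  have "continuous_on (sphere 0 1) F"
    unfolding continuous_on_closed_invariant
  proof (intro allI impI)
    fix B :: "complex set" assume B: "closed B"
    let ?A = "{x \<in> {0..2 * pi}. h x \<in> B}"
    have "closed ({0..2 * pi} \<inter> h -` B)"
      by (rule continuous_closed_preimage[OF h(1) _ B]) simp
    then have "compact ({0..2 * pi} \<inter> ({0..2 * pi} \<inter> h -` B))"
      by (rule compact_Int_closed[OF compact_Icc])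
    moreover have "{0..2 * pi} \<inter> ({0..2 * pi} \<inter> h -` B) = ?A" by auto
    ultimately have "compact ?A" by simp
    then have "closed (E ` ?A)" using contE compact_continuous_image compact_imp_closed by blast
    moreover have "E ` ?A \<inter> sphere 0 1 = F -` B \<inter> sphere 0 1"
    proof -
      have "z \<in> E ` ?A \<longleftrightarrow> F z \<in> B" if "z \<in> sphere 0 1" for z
      proof -
        from that obtain x where "z = E x" "x \<in> {0..2 * pi}" unfolding im[symmetric] by (rule imageE)
        then have "x \<in> ?A" if "F z \<in> B" using FE[of x] that by simp
        then have "z \<in> E ` ?A" if "F z \<in> B" using \<open>z = E x\<close> that by (intro image_eqI)
        moreover have "F z \<in> B" if "z \<in> E ` ?A"
        proof -
          from that obtain y where y: "z = E y" "y \<in> ?A" by (rule imageE)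
          then show ?thesis using FE[of y] by simp
        qed
        ultimately show ?thesis by blast
      qed
      then show ?thesis by blast
    qed
    ultimately show "\<exists>A. closed A \<and> A \<inter> sphere 0 1 = F -` B \<inter> sphere 0 1" by blast
  qed
  then obtain p where p: "polynomial_function p" "\<And>z. z \<in> sphere 0 1 \<Longrightarrow> norm (F z - p z) < e"
    using Stone_Weierstrass_polynomial_function[of "sphere 0 (1::real)" F e] e
    by (metis Stone_Weierstrass_polynomial_function compact_sphere)
  obtain K a where "(\<lambda>x. p (E x)) = tpoly K a"
    using trig_imp_tpoly[OF trig_of_polynomial[OF p(1)]] unfolding E_def by blast
  then have "tpoly K a x = p (E x)" for x by metis
  moreover have "cmod (h x - p (E x)) < e" if "x \<in> {0..2 * pi}" for x
  proof -
    have "E x \<in> sphere 0 1" unfolding im[symmetric] using that by (rule imageI)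
    from p(2)[OF this] FE[OF that] show ?thesis by simp
  qed
  ultimately have "cmod (h x - tpoly K a x) < e" if "x \<in> {0..2 * pi}" for x using that by simp
  then show ?thesis by blast
qed

text \<open>Radial retraction onto the disc of radius \<open>L\<close>, for positive
  \<open>L\<close>: it bounds the approximants, as dominated convergence requires, and keeps them
  continuous.\<close>

definition clip :: "real \<Rightarrow> complex \<Rightarrow> complex" where
  "clip L z = z /\<^sub>R max 1 (cmod z / L)"

lemma continuous_on_clip: "continuous_on S (clip L)"
proof (cases "L = 0")
  case False
  then show ?thesis unfolding clip_def[abs_def] by (intro continuous_intros) auto
qed (simp add: clip_def[abs_def])

lemma norm_clip_le: "0 < L \<Longrightarrow> cmod (clip L z) \<le> L"
  unfolding clip_def by (simp add: divide_simps max_def)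

lemma clip_eq: "0 < L \<Longrightarrow> cmod z \<le> L \<Longrightarrow> clip L z = z"
  unfolding clip_def by (simp add: max_def divide_simps)

lemma norm_diff_clip_le: "0 < L \<Longrightarrow> cmod (z - clip L z) \<le> cmod z"
proof -
  assume L: "0 < L"
  define t where "t = inverse (max 1 (cmod z / L))"
  have t: "0 \<le> t" "t \<le> 1" unfolding t_def by (auto simp: inverse_le_1_iff)
  have "z - clip L z = (1 - t) *\<^sub>R z" by (simp add: clip_def t_def algebra_simps)
  then have "cmod (z - clip L z) = (1 - t) * cmod z" using t by simp
  also have "\<dots> \<le> 1 * cmod z" using t by (intro mult_right_mono) auto
  finally show ?thesis by simp
qed

lemma norm_add_sq_le:
  fixes z w :: complex
  shows "(cmod (z + w))\<^sup>2 \<le> 2 * (cmod z)\<^sup>2 + 2 * (cmod w)\<^sup>2"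
proof -
  have "(cmod (z + w))\<^sup>2 \<le> (cmod z + cmod w)\<^sup>2" by (intro power_mono norm_triangle_ineq) auto
  also have "\<dots> \<le> 2 * (cmod z)\<^sup>2 + 2 * (cmod w)\<^sup>2"
    using sum_squares_bound[of "cmod z" "cmod w"] by (simp add: power2_sum)
  finally show ?thesis .
qed

lemma L2_diff:
  assumes "f \<in> L2_torus" "g \<in> L2_torus"
  shows "(\<lambda>x. f x - g x) \<in> L2_torus"
proof -
  have m: "f \<in> borel_measurable torus" "g \<in> borel_measurable torus" using assms by (auto simp: L2_torus_def)
  have "integrable torus (\<lambda>x. (cmod (f x - g x))\<^sup>2)"
  proof (rule Bochner_Integration.integrable_bound)
    show "integrable torus (\<lambda>x. 2 * (cmod (f x))\<^sup>2 + 2 * (cmod (g x))\<^sup>2)"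
      using assms by (simp add: L2_torus_def)
    show "AE x in torus. norm ((cmod (f x - g x))\<^sup>2) \<le> norm (2 * (cmod (f x))\<^sup>2 + 2 * (cmod (g x))\<^sup>2)"
      using norm_add_sq_le[of "f _" "- g _"] by (intro AE_I2) simp
  qed (use m in simp)
  then show ?thesis using m by (simp add: L2_torus_def)
qed

text \<open>Clipping makes \<open>g\<close> bounded up to a small error. A measurable function is an
  almost everywhere limit of continuous ones; clipping these and damping them near the ends gives
  bounded approximants with equal end values. Both errors vanish by dominated convergence.\<close>

lemma L2_approx_continuous:
  assumes g: "g \<in> L2_torus" and e: "0 < e"
  shows "\<exists>h. continuous_on UNIV h \<and> h 0 = h (2 * pi) \<and> (LINT x|torus. (cmod (g x - h x))\<^sup>2) < e"
proof -
  have gm [measurable]: "g \<in> borel_measurable torus" and gi: "integrable torus (\<lambda>x. (cmod (g x))\<^sup>2)"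
    using g by (auto simp: L2_torus_def)
  have clipm [measurable]: "clip L \<in> borel_measurable borel" for L
    by (rule borel_measurable_continuous_onI) (rule continuous_on_clip)
  have "(\<lambda>L. LINT x|torus. (cmod (g x - clip (real (Suc L)) (g x)))\<^sup>2) \<longlonglongrightarrow> (LINT x|torus. 0)"
  proof (rule integral_dominated_convergence[where w="\<lambda>x. (cmod (g x))\<^sup>2"])
    show "AE x in torus. (\<lambda>L. (cmod (g x - clip (real (Suc L)) (g x)))\<^sup>2) \<longlonglongrightarrow> 0"
    proof (rule AE_I2)
      fix x
      obtain N where N: "cmod (g x) \<le> real N" using real_arch_simple by blast
      have "(cmod (g x - clip (real (Suc L)) (g x)))\<^sup>2 = 0" if "L \<ge> N" for L
        using clip_eq[of "real (Suc L)" "g x"] N that by simp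
      then show "(\<lambda>L. (cmod (g x - clip (real (Suc L)) (g x)))\<^sup>2) \<longlonglongrightarrow> 0"
        by (intro tendsto_eventually) (auto simp: eventually_sequentially)
    qed
    show "AE x in torus. norm ((cmod (g x - clip (real (Suc L)) (g x)))\<^sup>2) \<le> (cmod (g x))\<^sup>2" for L
      by (intro AE_I2) (simp add: power_mono norm_diff_clip_le)
  qed (use gi in simp_all)
  then have "\<forall>\<^sub>F L in sequentially. (LINT x|torus. (cmod (g x - clip (real (Suc L)) (g x)))\<^sup>2) < e / 4"
    using e by (intro order_tendstoD(2)) auto
  then obtain L0 where L0: "(LINT x|torus. (cmod (g x - clip (real (Suc L0)) (g x)))\<^sup>2) < e / 4"
    unfolding eventually_sequentially by blast
  define L where "L = real (Suc L0)"
  have L: "0 < L" by (simp add: L_def)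
  have "g measurable_on {0..2 * pi}"
    using gm by (simp add: measurable_on_iff_borel_measurable)
  then obtain N h where N: "negligible N" and h: "\<And>n::nat. continuous_on UNIV (h n)"
    and lim: "\<And>x. x \<notin> N \<Longrightarrow> (\<lambda>n. h n x) \<longlonglongrightarrow> (if x \<in> {0..2 * pi} then g x else 0)"
    unfolding measurable_on_def by blast
  \<comment> \<open>A continuous cutoff that vanishes at both ends and is eventually
    \<open>1\<close> at each interior point.\<close>
  define \<phi> where "\<phi> n x = min 1 (real n * max 0 (x * (2 * pi - x)))" for n x
  define H where "H n x = \<phi> n x *\<^sub>R clip L (h n x)" for n x
  have phi: "0 \<le> \<phi> n x" "\<phi> n x \<le> 1" for n x by (auto simp: \<phi>_def)
  have contH: "continuous_on UNIV (H n)" for n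
    unfolding H_def[abs_def] \<phi>_def
    by (intro continuous_intros continuous_on_compose2[OF continuous_on_clip h]) auto
  have Hm [measurable]: "H n \<in> borel_measurable torus" for n
    by (intro measurable_torus_continuous continuous_on_subset[OF contH]) auto
  have normH: "cmod (H n x) \<le> L" for n x
  proof -
    have "cmod (H n x) = \<phi> n x * cmod (clip L (h n x))" using phi by (simp add: H_def)
    also have "\<dots> \<le> 1 * L" using phi L by (intro mult_mono norm_clip_le) auto
    finally show ?thesis by simp
  qed
  have bd: "(cmod (clip L (g x) - H n x))\<^sup>2 \<le> (2 * L)\<^sup>2" for n x
  proof (rule power_mono)
    show "cmod (clip L (g x) - H n x) \<le> 2 * L"
      using norm_triangle_ineq4[of "clip L (g x)" "H n x"] normH[of n x] norm_clip_le[OF L, of "g x"] by linarith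
  qed simp
  have "(\<lambda>n. LINT x|torus. (cmod (clip L (g x) - H n x))\<^sup>2) \<longlonglongrightarrow> (LINT x|torus. 0)"
  proof (rule integral_dominated_convergence[where w="\<lambda>x. (2 * L)\<^sup>2"])
    have "negligible (N \<union> {0, 2 * pi})" using N by (auto intro: negligible_Un)
    then have ns: "N \<union> {0, 2 * pi} \<in> null_sets lebesgue" by (simp add: negligible_iff_null_sets)
    have "AE x in lebesgue. x \<in> {0..2 * pi} \<longrightarrow> (\<lambda>n. (cmod (clip L (g x) - H n x))\<^sup>2) \<longlonglongrightarrow> 0"
    proof (rule AE_I'[OF ns])
      have "(\<lambda>n. (cmod (clip L (g x) - H n x))\<^sup>2) \<longlonglongrightarrow> 0" if x: "x \<in> {0..2 * pi}" "x \<notin> N \<union> {0, 2 * pi}" for x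
      proof -
        have "(\<lambda>n. h n x) \<longlonglongrightarrow> g x" using lim[of x] x by auto
        then have c: "(\<lambda>n. clip L (h n x)) \<longlonglongrightarrow> clip L (g x)"
          by (rule continuous_on_tendsto_compose[OF continuous_on_clip[of UNIV]]) auto
        have pos: "0 < x * (2 * pi - x)" using x by auto
        obtain n0 where n0: "1 / (x * (2 * pi - x)) \<le> real n0" using real_arch_simple by blast
        have "\<phi> n x = 1" if "n \<ge> n0" for n
        proof -
          have "1 / (x * (2 * pi - x)) \<le> real n" using n0 that by simp
          then have "1 \<le> real n * (x * (2 * pi - x))" using pos by (simp add: pos_divide_le_eq)
          then show ?thesis using pos by (simp add: \<phi>_def)
        qed
        then have "(\<lambda>n. \<phi> n x) \<longlonglongrightarrow> 1"
          by (intro tendsto_eventually) (auto simp: eventually_sequentially)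
        then have "(\<lambda>n. H n x) \<longlonglongrightarrow> 1 *\<^sub>R clip L (g x)"
          unfolding H_def using c by (rule tendsto_scaleR)
        then have "(\<lambda>n. (cmod (clip L (g x) - H n x))\<^sup>2) \<longlonglongrightarrow> (cmod (clip L (g x) - 1 *\<^sub>R clip L (g x)))\<^sup>2"
          by (intro tendsto_intros)
        then show ?thesis by simp
      qed
      then show "{x \<in> space lebesgue. \<not> (x \<in> {0..2 * pi} \<longrightarrow> (\<lambda>n. (cmod (clip L (g x) - H n x))\<^sup>2) \<longlonglongrightarrow> 0)} \<subseteq> N \<union> {0, 2 * pi}"
        by blast
    qed
    then show "AE x in torus. (\<lambda>n. (cmod (clip L (g x) - H n x))\<^sup>2) \<longlonglongrightarrow> 0"
      by (subst AE_restrict_space_iff) auto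
    show "AE x in torus. norm ((cmod (clip L (g x) - H n x))\<^sup>2) \<le> (2 * L)\<^sup>2" for n
      using bd by (intro AE_I2) simp
    show "integrable torus (\<lambda>x. (2 * L)\<^sup>2)"
      by (intro integrable_torus_continuous continuous_intros)
  qed simp_all
  then have "\<forall>\<^sub>F n in sequentially. (LINT x|torus. (cmod (clip L (g x) - H n x))\<^sup>2) < e / 4"
    using e by (intro order_tendstoD(2)) auto
  then obtain n where n: "(LINT x|torus. (cmod (clip L (g x) - H n x))\<^sup>2) < e / 4"
    unfolding eventually_sequentially by blast
  have i1: "integrable torus (\<lambda>x. (cmod (g x - clip L (g x)))\<^sup>2)"
    by (rule Bochner_Integration.integrable_bound[OF gi]) (auto simp: power_mono norm_diff_clip_le L)
  have i2: "integrable torus (\<lambda>x. (cmod (clip L (g x) - H n x))\<^sup>2)"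
  proof (rule Bochner_Integration.integrable_bound)
    show "integrable torus (\<lambda>x. (2 * L)\<^sup>2)" by (intro integrable_torus_continuous continuous_intros)
    show "AE x in torus. norm ((cmod (clip L (g x) - H n x))\<^sup>2) \<le> norm ((2 * L)\<^sup>2)"
      using bd by (intro AE_I2) simp
  qed simp
  have "(LINT x|torus. (cmod (g x - H n x))\<^sup>2) \<le>
     (LINT x|torus. 2 * (cmod (g x - clip L (g x)))\<^sup>2 + 2 * (cmod (clip L (g x) - H n x))\<^sup>2)"
  proof (rule Bochner_Integration.integral_mono')
    show "integrable torus (\<lambda>x. 2 * (cmod (g x - clip L (g x)))\<^sup>2 + 2 * (cmod (clip L (g x) - H n x))\<^sup>2)"
      using i1 i2 by simp
    fix x
    show "(cmod (g x - H n x))\<^sup>2 \<le> 2 * (cmod (g x - clip L (g x)))\<^sup>2 + 2 * (cmod (clip L (g x) - H n x))\<^sup>2"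
      using norm_add_sq_le[of "g x - clip L (g x)" "clip L (g x) - H n x"] by simp
  qed simp
  also have "\<dots> < e" using i1 i2 L0 n unfolding L_def[symmetric] by simp
  finally show ?thesis
    using contH[of n] by (intro exI[of _ "H n"]) (simp add: H_def \<phi>_def)
qed

lemma L2_approx_tpoly:
  assumes g: "g \<in> L2_torus" and e: "0 < e"
  shows "\<exists>K a. (LINT x|torus. (cmod (g x - tpoly K a x))\<^sup>2) < e"
proof -
  obtain h where h: "continuous_on UNIV h" "h 0 = h (2 * pi)" "(LINT x|torus. (cmod (g x - h x))\<^sup>2) < e / 4"
    using L2_approx_continuous[OF g, of "e / 4"] e by auto
  \<comment> \<open>Chosen so that \<open>2 * d^2 * (2 * pi) = e / 4\<close>; together with twice
    \<open>e / 4\<close> from the first approximation this stays below \<open>e\<close>.\<close>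
  define d where "d = sqrt (e / (16 * pi))"
  have d: "0 < d" "d\<^sup>2 = e / (16 * pi)" using e by (auto simp: d_def)
  obtain K a where Ka: "\<And>x. x \<in> {0..2 * pi} \<Longrightarrow> cmod (h x - tpoly K a x) < d"
    using periodic_approx_tpoly[OF continuous_on_subset[OF h(1) subset_UNIV] h(2) d(1)] by blast
  have hL: "h \<in> L2_torus" by (intro L2_continuous continuous_on_subset[OF h(1)]) auto
  have i: "integrable torus (\<lambda>x. (cmod (g x - h x))\<^sup>2)"
    using L2_diff[OF g hL] by (simp add: L2_torus_def)
  have "(LINT x|torus. (cmod (g x - tpoly K a x))\<^sup>2) \<le> (LINT x|torus. 2 * (cmod (g x - h x))\<^sup>2 + 2 * d\<^sup>2)"
  proof (rule Bochner_Integration.integral_mono')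
    show "integrable torus (\<lambda>x. 2 * (cmod (g x - h x))\<^sup>2 + 2 * d\<^sup>2)"
      using i by (auto intro!: Bochner_Integration.integrable_add integrable_torus_continuous continuous_intros)
    fix x assume "x \<in> space torus"
    then have "cmod (h x - tpoly K a x) < d" using Ka by simp
    then have "(cmod (h x - tpoly K a x))\<^sup>2 \<le> d\<^sup>2" by (intro power_mono) auto
    then show "(cmod (g x - tpoly K a x))\<^sup>2 \<le> 2 * (cmod (g x - h x))\<^sup>2 + 2 * d\<^sup>2"
      using norm_add_sq_le[of "g x - h x" "h x - tpoly K a x"] by simp
  qed simp
  also have "\<dots> = 2 * (LINT x|torus. (cmod (g x - h x))\<^sup>2) + 2 * d\<^sup>2 * (2 * pi)"
  proof -
    have "integrable torus (\<lambda>x. 2 * d\<^sup>2)" by (intro integrable_torus_continuous continuous_intros)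
    moreover have "(LINT x|torus. 2 * d\<^sup>2) = 2 * d\<^sup>2 * (2 * pi)"
      by (subst lebesgue_integral_eq_integral) (auto intro: integrable_torus_continuous)
    ultimately show ?thesis using i by simp
  qed
  also have "\<dots> < e" using h(3) d(2) e by (simp add: field_simps)
  finally show ?thesis by blast
qed

text \<open>Bessel's inequality bounds the partial sums above. Below, a trigonometric polynomial
  close to \<open>g\<close> in mean square leaves a defect at most its own distance, and the partial
  sums only increase from there.\<close>

theorem parseval:
  assumes g: "g \<in> L2_torus"
  shows "(\<lambda>K. \<Sum>n\<in>freqs K. (cmod (fourier_coeff g n))\<^sup>2) \<longlonglongrightarrow> (LINT x|torus. (cmod (g x))\<^sup>2) / (2 * pi)"
proof (rule LIMSEQ_I)
  fix e :: real assume e: "0 < e"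
  let ?S = "\<lambda>K. \<Sum>n\<in>freqs K. (cmod (fourier_coeff g n))\<^sup>2"
  let ?N = "LINT x|torus. (cmod (g x))\<^sup>2"
  obtain K a where Ka: "(LINT x|torus. (cmod (g x - tpoly K a x))\<^sup>2) < 2 * pi * e"
    using L2_approx_tpoly[OF g, of "2 * pi * e"] e by auto
  have "0 \<le> (\<Sum>n\<in>freqs K. (cmod (fourier_coeff g n - a n))\<^sup>2)" by (intro sum_nonneg) auto
  then have 1: "?N - 2 * pi * ?S K < 2 * pi * e"
    using Ka unfolding tpoly_dist_sq[OF g] by (smt (verit) mult_nonneg_nonneg pi_ge_zero)
  show "\<exists>no. \<forall>J\<ge>no. norm (?S J - ?N / (2 * pi)) < e"
  proof (intro exI[of _ K] allI impI)
    fix J assume "J \<ge> K"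
    then have "?S K \<le> ?S J" by (intro sum_mono2) auto
    then have "2 * pi * ?S K \<le> 2 * pi * ?S J" by simp
    then have "?N - 2 * pi * ?S J < 2 * pi * e" "2 * pi * ?S J \<le> ?N"
      using 1 bessel_inequality[OF g, of J] by linarith+
    then have "?N / (2 * pi) - ?S J < e" "?S J \<le> ?N / (2 * pi)"
      by (simp_all add: field_simps)
    then show "norm (?S J - ?N / (2 * pi)) < e" by simp
  qed
qed

lemma fourier_uniqueness:
  assumes f: "continuous_on {0..2 * pi} f" and z: "\<And>n. fourier_coeff f n = 0" and x: "x \<in> {0..2 * pi}"
  shows "f x = 0"
proof -
  have "(\<lambda>K. 0) \<longlonglongrightarrow> (LINT x|torus. (cmod (f x))\<^sup>2) / (2 * pi)"
    using parseval[OF L2_continuous[OF f]] by (simp add: z)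
  then have "(LINT x|torus. (cmod (f x))\<^sup>2) = 0"
    using LIMSEQ_unique[OF tendsto_const] by force
  moreover have c: "continuous_on {0..2 * pi} (\<lambda>x. (cmod (f x))\<^sup>2)" by (intro continuous_intros f)
  ultimately have "integral {0..2 * pi} (\<lambda>x. (cmod (f x))\<^sup>2) = 0"
    by (simp add: lebesgue_integral_eq_integral integrable_torus_continuous)
  then have "(cmod (f x))\<^sup>2 = 0" using integral_eq_0_iff[OF c] x by simp
  then show ?thesis by simp
qed

section \<open>Fourier coefficients of Sobolev functions\<close>

text \<open>Grouping the modes \<open>k\<close> and \<open>- k\<close> turns symmetric partial sums
  into an ordinary series for the Weierstrass test. The limit function is produced here rather than
  given, which is how Bessel potentials of lower order are constructed.\<close>

lemma uniform_limit_tpoly: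
  assumes B: "\<And>K. (\<Sum>n\<in>freqs K. cmod (a n)) \<le> B"
  shows "\<exists>f. uniform_limit UNIV (\<lambda>K. tpoly K a) f sequentially"
proof -
  define t where "t k x = (if k = 0 then a 0 else a (int k) * mode (int k) x + a (- int k) * mode (- int k) x)" for k :: nat and x
  define M where "M k = (if k = 0 then cmod (a 0) else cmod (a (int k)) + cmod (a (- int k)))" for k :: nat
  have step: "{- int (Suc K)..int (Suc K)} = insert (int (Suc K)) (insert (- int (Suc K)) (freqs K))" for K
    by auto
  have symm: "(\<Sum>n\<in>freqs K. f n) = (\<Sum>k<Suc K. if k = 0 then f 0 else f (int k) + f (- int k))"
    for f :: "int \<Rightarrow> 'a::ab_group_add" and K
  proof (induction K)
    case (Suc K)
    have "int (Suc K) \<notin> insert (- int (Suc K)) (freqs K)" "- int (Suc K) \<notin> (freqs K)" by auto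
    then have "(\<Sum>n\<in>{- int (Suc K)..int (Suc K)}. f n) = f (int (Suc K)) + (f (- int (Suc K)) + (\<Sum>n\<in>freqs K. f n))"
      unfolding step by (simp del: of_nat_Suc atLeastAtMost_iff insert_iff)
    then show ?case unfolding Suc sum.lessThan_Suc[of _ "Suc K"] by (simp add: add_ac)
  qed simp
  have tp: "tpoly K a x = (\<Sum>k<Suc K. t k x)" for K x
    unfolding tpoly_def symm t_def by (intro sum.cong refl) auto
  have "uniform_limit UNIV (\<lambda>K x. \<Sum>k<K. t k x) (\<lambda>x. suminf (\<lambda>k. t k x)) sequentially"
  proof (rule Weierstrass_m_test)
    show "norm (t k x) \<le> M k" for k x
      unfolding t_def M_def by (auto intro!: order_trans[OF norm_triangle_ineq] simp: norm_mult)
    show "summable M"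
    proof (rule summableI_nonneg_bounded)
      show "0 \<le> M k" for k by (simp add: M_def)
      show "(\<Sum>k<K. M k) \<le> B" for K
      proof -
        have "(\<Sum>k<K. M k) \<le> (\<Sum>k<Suc K. M k)" by (simp add: M_def)
        also have "\<dots> = (\<Sum>n\<in>freqs K. cmod (a n))" unfolding symm M_def by simp
        finally show ?thesis using B[of K] by simp
      qed
    qed
  qed
  then have "uniform_limit UNIV (\<lambda>K x. \<Sum>k<Suc K. t k x) (\<lambda>x. suminf (\<lambda>k. t k x)) sequentially"
    by (rule filterlim_compose[OF _ filterlim_Suc])
  then have "uniform_limit UNIV (\<lambda>K. tpoly K a) (\<lambda>x. suminf (\<lambda>k. t k x)) sequentially"
    by (simp only: tp[symmetric, abs_def])
  then show ?thesis by blast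
qed

lemma LINT_uniform_limit:
  fixes f :: "nat \<Rightarrow> real \<Rightarrow> 'b::euclidean_space"
  assumes u: "uniform_limit {0..2 * pi} f g sequentially" and f: "\<And>K. continuous_on {0..2 * pi} (f K)"
  shows "(\<lambda>K. LINT x|torus. f K x) \<longlonglongrightarrow> (LINT x|torus. g x)"
proof -
  have g: "continuous_on {0..2 * pi} g"
    by (rule uniform_limit_theorem[OF _ u]) (auto simp: f)
  have "(\<lambda>K. integral (cbox 0 (2 * pi)) (f K)) \<longlonglongrightarrow> integral (cbox 0 (2 * pi)) g"
  proof -
    have "(\<lambda>K. integral {0..2 * pi} (f K)) \<longlonglongrightarrow> integral {0..2 * pi} g"
    proof (rule LIMSEQ_I)
      fix e :: real assume e: "0 < e"
      then have "\<forall>\<^sub>F K in sequentially. \<forall>x\<in>{0..2 * pi}. dist (f K x) (g x) < e / (4 * pi)"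
        by (intro uniform_limitD[OF u]) simp
      then obtain N where N: "\<And>K x. K \<ge> N \<Longrightarrow> x \<in> {0..2 * pi} \<Longrightarrow> dist (f K x) (g x) < e / (4 * pi)"
        unfolding eventually_sequentially by blast
      show "\<exists>N. \<forall>K\<ge>N. norm (integral {0..2 * pi} (f K) - integral {0..2 * pi} g) < e"
      proof (intro exI[of _ N] allI impI)
        fix K assume K: "K \<ge> N"
        have "norm (integral {0..2 * pi} (f K) - integral {0..2 * pi} g) = norm (integral {0..2 * pi} (\<lambda>x. f K x - g x))"
          by (subst Henstock_Kurzweil_Integration.integral_diff) (auto intro!: integrable_continuous_interval f g)
        also have "\<dots> \<le> (e / (4 * pi)) * (2 * pi - 0)"
        proof (rule integral_bound)
          show "norm (f K x - g x) \<le> e / (4 * pi)" if "x \<in> {0..2 * pi}" for x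
            using N[OF K that] by (simp add: dist_norm)
        qed (auto intro!: continuous_intros f g)
        also have "\<dots> < e" using e by simp
        finally show "norm (integral {0..2 * pi} (f K) - integral {0..2 * pi} g) < e" .
      qed
    qed
    then show ?thesis by simp
  qed
  then show ?thesis
    by (simp add: lebesgue_integral_eq_integral integrable_torus_continuous f g)
qed

lemma uniform_limit_mult_continuous:
  fixes f g :: "nat \<Rightarrow> real \<Rightarrow> complex"
  assumes f: "uniform_limit {0..2 * pi} f f' sequentially" "\<And>K. continuous_on {0..2 * pi} (f K)"
    and g: "uniform_limit {0..2 * pi} g g' sequentially" "\<And>K. continuous_on {0..2 * pi} (g K)"
  shows "uniform_limit {0..2 * pi} (\<lambda>K x. f K x * g K x) (\<lambda>x. f' x * g' x) sequentially"
proof (rule uniform_lim_mult[OF f(1) g(1)])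
  have "continuous_on {0..2 * pi} f'" "continuous_on {0..2 * pi} g'"
    by (rule uniform_limit_theorem[OF _ f(1)], simp add: f(2), simp)
       (rule uniform_limit_theorem[OF _ g(1)], simp add: g(2), simp)
  then show "bounded (f' ` {0..2 * pi})" "bounded (g' ` {0..2 * pi})"
    by (auto intro!: compact_imp_bounded compact_continuous_image)
qed

lemma fourier_coeff_tpoly_limit:
  assumes f: "uniform_limit UNIV (\<lambda>K. tpoly K a) f sequentially"
  shows "fourier_coeff f n = a n" "continuous_on S f"
proof -
  have "continuous_on UNIV f"
    by (rule uniform_limit_theorem[OF _ f]) (simp_all add: continuous_on_tpoly)
  then show "continuous_on S f" by (rule continuous_on_subset) simp
  show "fourier_coeff f n = a n"
  proof (rule LIMSEQ_unique)
    show "(\<lambda>K. fourier_coeff (tpoly K a) n) \<longlonglongrightarrow> a n"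
      unfolding fourier_coeff_tpoly
      by (intro tendsto_eventually) (auto simp: eventually_sequentially intro!: exI[of _ "nat \<bar>n\<bar>"])
    have "uniform_limit {0..2 * pi} (\<lambda>K x. tpoly K a x * mode (- n) x) (\<lambda>x. f x * mode (- n) x) sequentially"
      by (intro uniform_limit_mult_continuous uniform_limit_on_subset[OF f] uniform_limit_const continuous_intros) auto
    then show "(\<lambda>K. fourier_coeff (tpoly K a) n) \<longlonglongrightarrow> fourier_coeff f n"
      unfolding fourier_coeff_mode by (intro tendsto_intros LINT_uniform_limit continuous_intros)
  qed
qed

text \<open>The series converges to a continuous periodic function with the same coefficients as
  \<open>u\<close>; uniqueness identifies the two on one period and periodicity on the line.\<close>

lemma tpoly_uniform_limit_coeffs:
  assumes B: "\<And>K. (\<Sum>n\<in>freqs K. cmod (fourier_coeff u n)) \<le> B"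
    and u: "continuous_on UNIV u" "\<And>x. u (x + 2 * pi) = u x"
  shows "uniform_limit UNIV (\<lambda>K. tpoly K (fourier_coeff u)) u sequentially"
proof -
  let ?c = "fourier_coeff u"
  obtain f where f: "uniform_limit UNIV (\<lambda>K. tpoly K ?c) f sequentially"
    using uniform_limit_tpoly[OF B] by blast
  have cf: "continuous_on UNIV f" by (rule fourier_coeff_tpoly_limit[OF f])
  have pf: "f (x + 2 * pi) = f x" for x
  proof (rule LIMSEQ_unique)
    show "(\<lambda>K. tpoly K ?c x) \<longlonglongrightarrow> f x" using tendsto_uniform_limitI[OF f] by simp
    show "(\<lambda>K. tpoly K ?c x) \<longlonglongrightarrow> f (x + 2 * pi)"
      using tendsto_uniform_limitI[OF f, of "x + 2 * pi"] by (simp add: tpoly_periodic)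
  qed
  have coef: "fourier_coeff f n = ?c n" for n by (rule fourier_coeff_tpoly_limit[OF f])
  have eq0: "u x = f x" if "x \<in> {0..2 * pi}" for x
  proof -
    have "u x - f x = 0"
    proof (rule fourier_uniqueness[OF _ _ that])
      show "continuous_on {0..2 * pi} (\<lambda>x. u x - f x)"
        by (intro continuous_intros continuous_on_subset[OF u(1)] continuous_on_subset[OF cf]) auto
      show "fourier_coeff (\<lambda>x. u x - f x) n = 0" for n
        using fourier_coeff_diff[of u f n] coef[of n]
        by (simp add: L2_continuous continuous_on_subset[OF u(1)] continuous_on_subset[OF cf])
    qed
    then show ?thesis by simp
  qed
  have shift: "h (x + of_int k * (2 * pi)) = h x" if "\<And>x. h (x + 2 * pi) = h x" for h :: "real \<Rightarrow> complex" and k x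
  proof (induction k rule: int_induct[where k=0])
    case base
    then show ?case by simp
  next
    case (step1 i)
    then show ?case using that[of "x + of_int i * (2 * pi)"] by (simp add: algebra_simps)
  next
    case (step2 i)
    then show ?case using that[of "x + of_int (i - 1) * (2 * pi)"] by (simp add: algebra_simps)
  qed
  have "u x = f x" for x
  proof -
    define k where "k = \<lfloor>x / (2 * pi)\<rfloor>"
    have "of_int k \<le> x / (2 * pi)" "x / (2 * pi) \<le> of_int k + 1"
      unfolding k_def by (auto intro: less_imp_le)
    then have "of_int k * (2 * pi) \<le> x" "x \<le> (of_int k + 1) * (2 * pi)"
      by (simp_all add: field_simps)
    then have "x + of_int (- k) * (2 * pi) \<in> {0..2 * pi}" by (simp add: algebra_simps)
    then show ?thesis using eq0 shift[of u x "- k"] shift[of f x "- k"] u(2) pf by metis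
  qed
  then have "u = f" by auto
  with f show ?thesis by simp
qed

section \<open>Sobolev norms through Fourier coefficients\<close>

lemma Lp_norm_2_sq: "(Lp_norm 2 g)\<^sup>2 = (LINT x|torus. (cmod (g x))\<^sup>2)"
proof -
  have e: "cmod (g x) powr 2 = (cmod (g x))\<^sup>2" for x
    by (cases "g x = 0") (auto simp: powr_numeral)
  have "0 \<le> (LINT x|torus. (cmod (g x))\<^sup>2)" by (rule Bochner_Integration.integral_nonneg) simp
  then show ?thesis unfolding Lp_norm_def e by (simp add: powr_half_sqrt)
qed

lemma jap_powr: "(1 + (real_of_int n)\<^sup>2) powr (real s / 2) = jap n ^ s"
proof -
  have p: "0 < 1 + (real_of_int n)\<^sup>2" by (simp add: add_pos_nonneg)
  have "(1 + (real_of_int n)\<^sup>2) powr (real s / 2) = ((1 + (real_of_int n)\<^sup>2) powr (1/2)) powr real s"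
    by (simp add: powr_powr)
  also have "\<dots> = jap n powr real s" using p by (simp add: powr_half_sqrt jap_def)
  also have "\<dots> = jap n ^ s" by (rule powr_realpow) simp
  finally show ?thesis .
qed

lemma is_bessel_jap: "is_bessel s u g \<longleftrightarrow> g \<in> L2_torus \<and> (\<forall>n. fourier_coeff g n = of_real (jap n ^ s) * fourier_coeff u n)"
  unfolding is_bessel_def jap_powr ..

lemma Hs_bessel:
  assumes "u \<in> Hs s"
  shows "is_bessel s u (bessel s u)"
proof -
  have "\<exists>g. is_bessel s u g" using assms by (simp add: Hs_def)
  then show ?thesis unfolding bessel_def by (rule someI_ex)
qed

lemma Hs_norm_nonneg [simp]: "0 \<le> Hs_norm s u"
  by (simp add: Hs_norm_def Lp_norm_def)

lemma hnorm_sq_Hs: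
  assumes "u \<in> Hs s"
  shows "(hnorm K s (fourier_coeff u))\<^sup>2 = (\<Sum>n\<in>freqs K. (cmod (fourier_coeff (bessel s u) n))\<^sup>2)"
  using Hs_bessel[OF assms] unfolding is_bessel_jap hnorm_sq by (simp add: norm_mult norm_power)

lemma hnorm_tendsto_Hs:
  assumes "u \<in> Hs s"
  shows "(\<lambda>K. 2 * pi * (hnorm K s (fourier_coeff u))\<^sup>2) \<longlonglongrightarrow> (Hs_norm s u)\<^sup>2"
proof -
  have "bessel s u \<in> L2_torus" using Hs_bessel[OF assms] by (simp add: is_bessel_def)
  from tendsto_mult[OF tendsto_const[of "2 * pi"] parseval[OF this]] show ?thesis
    unfolding hnorm_sq_Hs[OF assms] Hs_norm_def Lp_norm_2_sq by simp
qed

text \<open>Bessel's inequality for the potential; the factor \<open>2 * pi >= 1\<close> on the left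
  is discarded.\<close>

lemma hnorm_le_Hs_norm:
  assumes "u \<in> Hs s"
  shows "hnorm K s (fourier_coeff u) \<le> Hs_norm s u"
proof (rule power2_le_imp_le)
  have "bessel s u \<in> L2_torus" using Hs_bessel[OF assms] by (simp add: is_bessel_def)
  then have "2 * pi * (hnorm K s (fourier_coeff u))\<^sup>2 \<le> (Hs_norm s u)\<^sup>2"
    unfolding hnorm_sq_Hs[OF assms] Hs_norm_def Lp_norm_2_sq by (rule bessel_inequality)
  moreover have "1 * (hnorm K s (fourier_coeff u))\<^sup>2 \<le> 2 * pi * (hnorm K s (fourier_coeff u))\<^sup>2"
    using pi_gt3 by (intro mult_right_mono) auto
  ultimately show "(hnorm K s (fourier_coeff u))\<^sup>2 \<le> (Hs_norm s u)\<^sup>2" by linarith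
qed simp

lemma Hs_continuous: "u \<in> Hs s \<Longrightarrow> continuous_on S u"
  unfolding Hs_def using continuous_on_subset by blast

lemma Hs_L2: "u \<in> Hs s \<Longrightarrow> u \<in> L2_torus"
  by (intro L2_continuous Hs_continuous)

lemma fourier_coeff_Hs_diff:
  "u \<in> Hs s \<Longrightarrow> v \<in> Hs s \<Longrightarrow> fourier_coeff (u - v) n = fourier_coeff u n - fourier_coeff v n"
  unfolding fun_diff_def by (intro fourier_coeff_diff Hs_L2)

lemma Hs_diff:
  assumes "u \<in> Hs s" "v \<in> Hs s"
  shows "u - v \<in> Hs s"
proof -
  obtain g h where "is_bessel s u g" "is_bessel s v h" using assms by (auto simp: Hs_def)
  then have "is_bessel s (u - v) (\<lambda>x. g x - h x)"
    unfolding is_bessel_jap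
    by (simp add: L2_diff fourier_coeff_diff fourier_coeff_Hs_diff[OF assms] right_diff_distrib)
  moreover have "continuous_on UNIV (u - v)"
    unfolding fun_diff_def using assms by (intro continuous_intros Hs_continuous)
  ultimately show ?thesis using assms by (auto simp: Hs_def)
qed

lemma tpoly_in_Hs: "tpoly K a \<in> Hs s"
proof -
  have "is_bessel s (tpoly K a) (tpoly K (\<lambda>n. of_real (jap n ^ s) * a n))"
    unfolding is_bessel_jap by (auto simp: fourier_coeff_tpoly intro!: L2_continuous continuous_intros)
  then show ?thesis
    unfolding Hs_def using tpoly_periodic by (auto intro!: continuous_intros)
qed

lemma l1_fourier_Hs:
  assumes "u \<in> Hs s" "1 \<le> s"
  shows "(\<Sum>n\<in>freqs K. cmod (fourier_coeff u n)) \<le> 3 * Hs_norm s u"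
proof -
  have "hnorm K 1 (fourier_coeff u) \<le> Hs_norm s u"
    using hnorm_mono_s[OF assms(2), of K "fourier_coeff u"] hnorm_le_Hs_norm[OF assms(1), of K] by simp
  then show ?thesis using l1_le_hnorm[where a="fourier_coeff u" and K=K] by simp
qed

lemma tpoly_uniform_limit_Hs:
  assumes "u \<in> Hs s" "1 \<le> s"
  shows "uniform_limit UNIV (\<lambda>K. tpoly K (fourier_coeff u)) u sequentially"
  by (rule tpoly_uniform_limit_coeffs[OF l1_fourier_Hs[OF assms]])
     (use assms in \<open>auto simp: Hs_def\<close>)

text \<open>The spare derivative makes the Fourier series of the Bessel potential converge absolutely, so that no
  Riesz-Fischer theorem is needed.\<close>

lemma Hs_Suc_subset: "Hs (Suc s) \<subseteq> Hs s"
proof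
  fix u assume u: "u \<in> Hs (Suc s)"
  let ?b = "\<lambda>n. of_real (jap n ^ s) * fourier_coeff u n"
  have "(\<Sum>n\<in>freqs K. cmod (?b n)) \<le> 3 * Hs_norm (Suc s) u" for K
  proof -
    have "(\<Sum>n\<in>freqs K. cmod (?b n)) \<le> 3 * hnorm K 1 ?b" by (rule l1_le_hnorm)
    also have "hnorm K 1 ?b = hnorm K (Suc s) (fourier_coeff u)"
      unfolding hnorm_def by (intro L2_set_cong) (auto simp: norm_mult norm_power)
    also have "\<dots> \<le> Hs_norm (Suc s) u" by (rule hnorm_le_Hs_norm[OF u])
    finally show ?thesis by simp
  qed
  then obtain g where g: "uniform_limit UNIV (\<lambda>K. tpoly K ?b) g sequentially"
    using uniform_limit_tpoly[where a="?b"] by blast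
  have "is_bessel s u g"
    unfolding is_bessel_jap
    using fourier_coeff_tpoly_limit[OF g] L2_continuous by blast
  then show "u \<in> Hs s" using u by (auto simp: Hs_def)
qed

section \<open>The quintic nonlinearity\<close>

lemma prod_mode: "finite I \<Longrightarrow> (\<Prod>j\<in>I. mode (f j) x) = mode (\<Sum>j\<in>I. f j) x"
  by (induction I rule: finite_induct) (simp_all add: mode_mult)

text \<open>Expanding the product and integrating, orthogonality of the modes keeps exactly the
  tuples of zero momentum. The sign \<open>csign\<close> gives the last three slots reversed
  frequencies, as conjugation does.\<close>

lemma sextic_integral:
  "sextic K (\<lambda>_. 1) a = 1 / (2 * pi) * (LINT x|torus. (\<Prod>j<6. \<Sum>n\<in>freqs K. a j n * mode (csign j * n) x))"
proof -
  let ?P = "PiE {..<6::nat} (\<lambda>_. (freqs K))"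
  let ?s = "\<lambda>n. \<Sum>j<6. csign j * n j"
  have fin: "finite ?P" by (simp add: finite_PiE)
  have "(\<Prod>j<6. \<Sum>n\<in>freqs K. a j n * mode (csign j * n) x) = (\<Sum>n\<in>?P. (\<Prod>j<6. a j (n j)) * mode (?s n) x)" for x
    by (subst prod_sum_PiE) (simp_all add: prod.distrib prod_mode)
  then have "(LINT x|torus. (\<Prod>j<6. \<Sum>n\<in>freqs K. a j n * mode (csign j * n) x))
     = (LINT x|torus. (\<Sum>n\<in>?P. (\<Prod>j<6. a j (n j)) * mode (?s n) x))"
    by simp
  also have "\<dots> = (\<Sum>n\<in>?P. LINT x|torus. (\<Prod>j<6. a j (n j)) * mode (?s n) x)"
    by (intro Bochner_Integration.integral_sum integrable_torus_continuous continuous_intros)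
  also have "\<dots> = (\<Sum>n\<in>?P. if zero_mom n then 2 * pi * (\<Prod>j<6. a j (n j)) else 0)"
    by (intro sum.cong refl) (simp add: LINT_mode zero_mom_def)
  also have "\<dots> = (\<Sum>n\<in>tuples K. 2 * pi * (\<Prod>j<6. a j (n j)))"
    unfolding tuples_def using fin by (simp add: sum.If_cases Int_def)
  finally show ?thesis unfolding sextic_def by (simp flip: sum_distrib_left)
qed

definition quintic :: "(real \<Rightarrow> complex) \<Rightarrow> real \<Rightarrow> complex" where
  "quintic w x = of_real (cmod (w x) ^ 4) * w x"

lemma quintic_eq: "quintic w x = w x * w x * w x * cnj (w x) * cnj (w x)"
proof -
  have "complex_of_real (cmod (w x) ^ 4) = of_real ((cmod (w x))\<^sup>2) * of_real ((cmod (w x))\<^sup>2)"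
    by (simp flip: of_real_mult power_add)
  then show ?thesis unfolding quintic_def complex_norm_square by (simp add: mult_ac)
qed

lemma tpoly_cnj: "(\<Sum>n\<in>freqs K. cnj (a n) * mode (- n) x) = cnj (tpoly K a x)"
  unfolding tpoly_def by (simp add: cnj_mode)

lemma entries_sum: "(\<Sum>n\<in>freqs K. entries a j n * mode (csign j * n) x) = (if j < 3 then tpoly K a x else cnj (tpoly K a x))"
  by (simp add: entries_def csign_def tpoly_cnj tpoly_def)

lemma prod6: "(\<Prod>j<6::nat. f j) = f 0 * f 1 * f 2 * f 3 * f 4 * f (5::nat)"
  by (simp add: numeral_eq_Suc)

text \<open>The unit sequence in slot \<open>5\<close> becomes the factor \<open>mode (- n)\<close>,
  so the integral of the six factors is a Fourier coefficient of the product of five.\<close>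

lemma qconv_quintic:
  assumes n: "n \<in> (freqs K)"
  shows "qconv K a n = fourier_coeff (quintic (tpoly K a)) n"
proof -
  let ?b = "(entries a)(5 := (\<lambda>i. if i = n then 1 else 0))"
  have "(\<Prod>j<6. \<Sum>i\<in>freqs K. ?b j i * mode (csign j * i) x) = quintic (tpoly K a) x * mode (- n) x" for x
  proof -
    have "(\<Sum>i\<in>freqs K. ?b 5 i * mode (csign 5 * i) x) = (\<Sum>i\<in>freqs K. if i = n then mode (- n) x else 0)"
      by (intro sum.cong refl) (auto simp: csign_def)
    also have "\<dots> = mode (- n) x" using n by (simp add: sum.delta)
    finally have 5: "(\<Sum>i\<in>freqs K. ?b 5 i * mode (csign 5 * i) x) = mode (- n) x" .
    have "(\<Sum>i\<in>freqs K. ?b j i * mode (csign j * i) x) = (if j < 3 then tpoly K a x else cnj (tpoly K a x))" if "j \<noteq> 5" for j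
      using that by (simp add: entries_sum)
    with 5 show ?thesis unfolding prod6 quintic_eq by (simp add: mult_ac del: fun_upd_apply)
  qed
  then show ?thesis
    using n unfolding qconv_def trunc_def fourier_coeff_mode sextic_integral by simp
qed

lemma uniform_limit_cnj:
  assumes "uniform_limit S f g F"
  shows "uniform_limit S (\<lambda>K x. cnj (f K x)) (\<lambda>x. cnj (g x)) F"
  by (rule bounded_linear.uniform_limit[OF bounded_linear_cnj assms])

text \<open>Partial sums converge uniformly on a period, hence so do the products of five. The
  identification with \<open>qconv K\<close> holds once \<open>K\<close> reaches the modulus of
  \<open>n\<close>, which suffices for a limit.\<close>

lemma quintic_lim_Hs:
  assumes w: "w \<in> Hs s" "1 \<le> s"
  shows "quintic_lim (fourier_coeff w) (fourier_coeff (quintic w))"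
  unfolding quintic_lim_def
proof
  fix n
  let ?S = "\<lambda>K. tpoly K (fourier_coeff w)"
  have u: "uniform_limit {0..2 * pi} ?S w sequentially"
    by (rule uniform_limit_on_subset[OF tpoly_uniform_limit_Hs[OF w]]) simp
  have uc: "uniform_limit {0..2 * pi} (\<lambda>K x. cnj (?S K x)) (\<lambda>x. cnj (w x)) sequentially"
    by (rule uniform_limit_cnj[OF u])
  have ue: "uniform_limit {0..2 * pi} (\<lambda>K::nat. mode (- n)) (mode (- n)) sequentially"
    by (rule uniform_limit_const)
  have "uniform_limit {0..2 * pi} (\<lambda>K x. quintic (?S K) x * mode (- n) x) (\<lambda>x. quintic w x * mode (- n) x) sequentially"
    unfolding quintic_eq
    by (intro uniform_limit_mult_continuous u uc ue continuous_intros)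
  then have "(\<lambda>K. LINT x|torus. quintic (?S K) x * mode (- n) x) \<longlonglongrightarrow> (LINT x|torus. quintic w x * mode (- n) x)"
    by (rule LINT_uniform_limit) (unfold quintic_eq, intro continuous_intros)
  then have "(\<lambda>K. fourier_coeff (quintic (?S K)) n) \<longlonglongrightarrow> fourier_coeff (quintic w) n"
    unfolding fourier_coeff_mode by (rule tendsto_mult_left)
  moreover have "\<forall>\<^sub>F K in sequentially. fourier_coeff (quintic (?S K)) n = qconv K (fourier_coeff w) n"
    unfolding eventually_sequentially
    by (intro exI[of _ "nat \<bar>n\<bar>"] allI impI qconv_quintic[symmetric]) auto
  ultimately show "(\<lambda>J. qconv J (fourier_coeff w) n) \<longlonglongrightarrow> fourier_coeff (quintic w) n"
    by (rule Lim_transform_eventually)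
qed

section \<open>The Dirichlet projection on the Fourier side\<close>

definition proj_modes :: "enat \<Rightarrow> int set" where
  "proj_modes M = (case M of enat N \<Rightarrow> {- int N..int N} | \<infinity> \<Rightarrow> UNIV)"

lemma dirichlet_proj_enat: "dirichlet_proj (enat N) u = tpoly N (fourier_coeff u)"
  by (simp add: dirichlet_proj_def tpoly_def mode_def fun_eq_iff)

lemma dirichlet_proj_infinity: "dirichlet_proj \<infinity> u = u"
  by (simp add: dirichlet_proj_def)

lemma fourier_coeff_dirichlet_proj:
  "fourier_coeff (dirichlet_proj M u) n = (if n \<in> proj_modes M then fourier_coeff u n else 0)"
  by (cases M) (simp_all add: dirichlet_proj_enat dirichlet_proj_infinity fourier_coeff_tpoly proj_modes_def)

lemma dirichlet_proj_Hs: "u \<in> Hs s \<Longrightarrow> dirichlet_proj M u \<in> Hs s"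
  by (cases M) (simp_all add: dirichlet_proj_enat dirichlet_proj_infinity tpoly_in_Hs)

lemma fourier_coeff_nls_nonlinearity:
  "fourier_coeff (nls_nonlinearity M u) n = (if n \<in> proj_modes M then fourier_coeff (quintic (dirichlet_proj M u)) n else 0)"
  unfolding nls_nonlinearity_def fourier_coeff_dirichlet_proj quintic_def[abs_def] ..

lemma norm_tpoly_le: "cmod (tpoly K a x) \<le> (\<Sum>n\<in>freqs K. cmod (a n))"
  unfolding tpoly_def by (rule order_trans[OF norm_sum]) (simp add: norm_mult)

text \<open>A factor \<open>of_int (n j)\<close> differentiates slot \<open>j\<close> up to a
  unimodular constant. The four differentiated factors all have the same modulus, so they form a
  fourth power, and the two others are bounded by \<open>A\<close>.\<close>

lemma sextic_quartic_bound:
  assumes Q: "Q \<subseteq> {..<6}" "card Q = 4" and A: "\<And>x. cmod (tpoly K a x) \<le> A"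
  shows "cmod (sextic K (\<lambda>n. \<Prod>j\<in>Q. of_int (n j)) (entries a))
    \<le> A\<^sup>2 / (2 * pi) * (LINT x|torus. cmod (tpoly K (\<lambda>n. of_int n * a n) x) ^ 4)"
proof -
  let ?d = "\<lambda>n. of_int n * a n"
  let ?b = "\<lambda>j. if j \<in> Q then entries ?d j else entries a j"
  have "sextic K (\<lambda>n. \<Prod>j\<in>Q. of_int (n j)) (entries a) = sextic K (\<lambda>_. 1) ?b"
    unfolding sextic_def
  proof (intro sum.cong refl)
    fix n
    have "(\<Prod>j<6. ?b j (n j)) = (\<Prod>j<6. (if j \<in> Q then of_int (n j) else 1) * entries a j (n j))"
      by (intro prod.cong) (auto simp: entries_def)
    also have "\<dots> = (\<Prod>j<6. if j \<in> Q then of_int (n j) else 1) * (\<Prod>j<6. entries a j (n j))"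
      by (rule prod.distrib)
    also have "(\<Prod>j<6. if j \<in> Q then of_int (n j) else 1) = (\<Prod>j\<in>Q. complex_of_int (n j))"
      using Q by (intro prod.mono_neutral_cong_right) auto
    finally show "complex_of_real (\<Prod>j\<in>Q. of_int (n j)) * (\<Prod>j<6. entries a j (n j)) = complex_of_real 1 * (\<Prod>j<6. ?b j (n j))"
      by simp
  qed
  also have "\<dots> = 1 / (2 * pi) * (LINT x|torus. (\<Prod>j<6. \<Sum>n\<in>freqs K. ?b j n * mode (csign j * n) x))"
    by (rule sextic_integral)
  finally have e: "sextic K (\<lambda>n. \<Prod>j\<in>Q. of_int (n j)) (entries a) = \<dots>" .
  have A0: "0 \<le> A" using A[of 0] norm_ge_zero order_trans by blast
  have "norm (LINT x|torus. (\<Prod>j<6. \<Sum>n\<in>freqs K. ?b j n * mode (csign j * n) x))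
      \<le> (LINT x|torus. A\<^sup>2 * cmod (tpoly K ?d x) ^ 4)"
  proof (rule order_trans[OF integral_norm_bound], rule Bochner_Integration.integral_mono')
    show "integrable torus (\<lambda>x. A\<^sup>2 * cmod (tpoly K ?d x) ^ 4)"
      by (intro integrable_torus_continuous continuous_intros)
    fix x
    have "norm (\<Prod>j<6. \<Sum>n\<in>freqs K. ?b j n * mode (csign j * n) x) = (\<Prod>j<6. if j \<in> Q then cmod (tpoly K ?d x) else cmod (tpoly K a x))"
      unfolding prod_norm[symmetric] by (intro prod.cong refl) (auto simp: entries_sum)
    also have "\<dots> = cmod (tpoly K ?d x) ^ card ({..<6} \<inter> {j. j \<in> Q}) * cmod (tpoly K a x) ^ card ({..<6} \<inter> - {j. j \<in> Q})"
      by (subst prod.If_cases) auto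
    also have "{..<6} \<inter> {j. j \<in> Q} = Q" using Q by auto
    also have "{..<6} \<inter> - {j. j \<in> Q} = {..<6} - Q" by auto
    also have "card ({..<6} - Q) = 2" using Q by (subst card_Diff_subset) (auto intro: finite_subset)
    also have "cmod (tpoly K ?d x) ^ card Q * (cmod (tpoly K a x))\<^sup>2 \<le> cmod (tpoly K ?d x) ^ 4 * A\<^sup>2"
      unfolding Q by (intro mult_left_mono power_mono A) auto
    finally show "norm (\<Prod>j<6. \<Sum>n\<in>freqs K. ?b j n * mode (csign j * n) x) \<le> A\<^sup>2 * cmod (tpoly K ?d x) ^ 4"
      by (simp add: mult.commute)
  qed (simp add: A0)
  then show ?thesis unfolding e norm_mult by (simp add: field_simps norm_divide)
qed

lemma sextic_h2_remainder_bound: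
  assumes A: "\<And>x. cmod (tpoly K a x) \<le> A"
  shows "cmod (sextic K h2_remainder (entries a)) \<le> 12 * A\<^sup>2 / pi * (LINT x|torus. cmod (tpoly K (\<lambda>n. of_int n * a n) x) ^ 4)"
proof -
  let ?p = "\<lambda>Q n. \<Prod>j\<in>Q. real_of_int (n j)"
  let ?m = "\<lambda>Q. sextic K (?p Q) (entries a)"
  let ?X = "A\<^sup>2 / (2 * pi) * (LINT x|torus. cmod (tpoly K (\<lambda>n. of_int n * a n) x) ^ 4)"
  \<comment> \<open>Written with differences and scalings only, to match
    \<open>sextic_diff_symb\<close> and \<open>sextic_scale_symb\<close>.\<close>
  have h2_remainder: "h2_remainder = (\<lambda>n. 4 * (((?p {0,1,2,3} n - (- 1) * ?p {0,1,2,4} n) - (- 1) * ?p {0,1,2,5} n) - (?p {3,4,5,0} n - (- 1) * ?p {3,4,5,1} n - (- 1) * ?p {3,4,5,2} n)))"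
    by (rule ext) (simp add: h2_remainder_def algebra_simps)
  have eq: "sextic K h2_remainder (entries a) = 4 * (?m {0,1,2,3} + ?m {0,1,2,4} + ?m {0,1,2,5} - (?m {3,4,5,0} + ?m {3,4,5,1} + ?m {3,4,5,2}))"
    unfolding h2_remainder sextic_scale_symb sextic_diff_symb by (simp del: prod.insert)
  have "cmod (?m Q) \<le> ?X" if "Q \<subseteq> {..<6}" "card Q = 4" for Q
    by (rule sextic_quartic_bound[OF that A])
  then have b: "cmod (?m {0,1,2,3}) \<le> ?X" "cmod (?m {0,1,2,4}) \<le> ?X" "cmod (?m {0,1,2,5}) \<le> ?X"
     "cmod (?m {3,4,5,0}) \<le> ?X" "cmod (?m {3,4,5,1}) \<le> ?X" "cmod (?m {3,4,5,2}) \<le> ?X"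
    by (simp_all del: prod.insert)
  have tri: "cmod (4 * (z1 + z2 + z3 - (z4 + z5 + z6))) \<le> 24 * X"
    if "cmod z1 \<le> X" "cmod z2 \<le> X" "cmod z3 \<le> X" "cmod z4 \<le> X" "cmod z5 \<le> X" "cmod z6 \<le> X"
    for z1 z2 z3 z4 z5 z6 X
  proof -
    have "cmod (z1 + z2 + z3 - (z4 + z5 + z6)) \<le> cmod z1 + cmod z2 + cmod z3 + (cmod z4 + cmod z5 + cmod z6)"
      by (intro order_trans[OF norm_triangle_ineq4] add_mono order_trans[OF norm_triangle_ineq] order_refl)
    moreover have "cmod (4 * (z1 + z2 + z3 - (z4 + z5 + z6))) = 4 * cmod (z1 + z2 + z3 - (z4 + z5 + z6))"
      by (simp only: norm_mult norm_numeral)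
    ultimately show ?thesis using that by linarith
  qed
  \<comment> \<open>Six monomials times the factor \<open>4\<close>; with the
    \<open>1 / (2 * pi)\<close> in \<open>?X\<close> this becomes \<open>12 / pi\<close>.\<close>
  have "cmod (sextic K h2_remainder (entries a)) \<le> 24 * ?X"
    unfolding eq by (rule tri[OF b])
  also have "24 * ?X = 12 * A\<^sup>2 / pi * (LINT x|torus. cmod (tpoly K (\<lambda>n. of_int n * a n) x) ^ 4)"
    by (simp add: field_simps)
  finally show ?thesis .
qed

text \<open>The second order of regularity makes the differentiated series absolutely convergent, so
  termwise differentiation is justified and \<open>deriv_x u\<close> is a genuine classical
  derivative.\<close>

lemma deriv_x_Hs2:
  assumes u: "u \<in> Hs 2"
  shows "uniform_limit UNIV (\<lambda>K. tpoly K (\<lambda>n. \<i> * (of_int n * fourier_coeff u n))) (deriv_x u) sequentially"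
proof -
  let ?c = "fourier_coeff u" and ?d = "\<lambda>n. \<i> * (of_int n * fourier_coeff u n)"
  have bd: "(\<Sum>n\<in>freqs K. cmod (?d n)) \<le> 3 * Hs_norm 2 u" for K
  proof -
    have "(\<Sum>n\<in>freqs K. cmod (?d n)) \<le> 3 * hnorm K 1 ?d" by (rule l1_le_hnorm)
    also have "hnorm K 1 ?d \<le> hnorm K 2 ?c"
      unfolding hnorm_def
    proof (intro L2_set_mono)
      fix n
      have "jap n * (\<bar>of_int n\<bar> * cmod (?c n)) \<le> jap n * (jap n * cmod (?c n))"
        by (intro mult_left_mono mult_right_mono abs_le_jap) auto
      then show "jap n ^ 1 * cmod (?d n) \<le> jap n ^ 2 * cmod (?c n)"
        by (simp add: norm_mult power2_eq_square mult.assoc)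
    qed simp
    also have "\<dots> \<le> Hs_norm 2 u" by (rule hnorm_le_Hs_norm[OF u])
    finally show ?thesis by simp
  qed
  obtain f where f: "uniform_limit UNIV (\<lambda>K. tpoly K ?d) f sequentially"
    using uniform_limit_tpoly[OF bd] by blast
  have lim: "(\<lambda>K. tpoly K ?c x) \<longlonglongrightarrow> u x" for x
    using tendsto_uniform_limitI[OF tpoly_uniform_limit_Hs[OF u]] by simp
  have "\<exists>g. \<forall>x\<in>UNIV. (\<lambda>K. tpoly K ?c x) \<longlonglongrightarrow> g x \<and> (g has_derivative (\<lambda>h. h *\<^sub>R f x)) (at x within UNIV)"
  proof (rule has_derivative_sequence[where f'="\<lambda>K x h. h *\<^sub>R tpoly K ?d x"])
    show "(tpoly K ?c has_derivative (\<lambda>h. h *\<^sub>R tpoly K ?d x)) (at x within UNIV)" for K x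
    proof -
      have "(tpoly K ?c has_vector_derivative (\<Sum>n\<in>freqs K. ?c n * (\<i> * of_int n * mode n x))) (at x)"
        unfolding tpoly_def[abs_def]
        by (intro has_vector_derivative_sum has_vector_derivative_mult_right mode_has_vector_derivative)
      also have "(\<Sum>n\<in>freqs K. ?c n * (\<i> * of_int n * mode n x)) = tpoly K ?d x"
        unfolding tpoly_def by (intro sum.cong refl) (simp add: mult_ac)
      finally show ?thesis by (simp add: has_vector_derivative_def)
    qed
    show "\<forall>\<^sub>F K in sequentially. \<forall>x\<in>UNIV. \<forall>h. norm (h *\<^sub>R tpoly K ?d x - h *\<^sub>R f x) \<le> e * norm h"
      if "0 < e" for e
      using uniform_limitD[OF f that]
    proof eventually_elim
      case (elim K)
      show ?case
      proof (intro ballI allI)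
        fix x h :: real
        have "norm (tpoly K ?d x - f x) \<le> e" using elim by (simp add: dist_norm less_imp_le)
        then have "norm h * norm (tpoly K ?d x - f x) \<le> norm h * e" by (rule mult_left_mono) simp
        then show "norm (h *\<^sub>R tpoly K ?d x - h *\<^sub>R f x) \<le> e * norm h"
          by (simp only: scaleR_diff_right[symmetric] norm_scaleR real_norm_def mult.commute)
      qed
    qed
    show "(\<lambda>K. tpoly K ?c 0) \<longlonglongrightarrow> u 0" by (rule lim)
  qed auto
  then obtain g where g: "\<And>x. (\<lambda>K. tpoly K ?c x) \<longlonglongrightarrow> g x" "\<And>x. (g has_derivative (\<lambda>h. h *\<^sub>R f x)) (at x)"
    by auto
  have "g = u" using LIMSEQ_unique[OF g(1) lim] by auto
  then have "(u has_vector_derivative f x) (at x)" for x using g(2) by (simp add: has_vector_derivative_def)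
  then have "deriv_x u x = f x" for x unfolding deriv_x_def by (rule vector_derivative_at)
  then have "deriv_x u = f" by (rule ext)
  with f show ?thesis by simp
qed

lemma Lp_norm_4_pow: "Lp_norm 4 f ^ 4 = (LINT x|torus. cmod (f x) ^ 4)"
proof -
  have e: "cmod (f x) powr 4 = cmod (f x) ^ 4" for x
    by (cases "f x = 0") (auto simp: powr_numeral)
  have I: "0 \<le> (LINT x|torus. cmod (f x) ^ 4)" by (rule Bochner_Integration.integral_nonneg) simp
  show ?thesis
  proof (cases "(LINT x|torus. cmod (f x) ^ 4) = 0")
    case False
    then have "0 < (LINT x|torus. cmod (f x) ^ 4)" by (intro le_neq_trans[OF I]) (rule not_sym)
    then show ?thesis unfolding Lp_norm_def e by (simp add: powr_powr flip: powr_realpow)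
  qed (simp add: Lp_norm_def e)
qed

lemma LINT_tpoly_deriv_tendsto:
  assumes u: "u \<in> Hs 2"
  shows "(\<lambda>K. LINT x|torus. cmod (tpoly K (\<lambda>n. of_int n * fourier_coeff u n) x) ^ 4) \<longlonglongrightarrow> Lp_norm 4 (deriv_x u) ^ 4"
proof -
  let ?d = "\<lambda>n. \<i> * (of_int n * fourier_coeff u n)"
  have n: "cmod (tpoly K (\<lambda>n. of_int n * fourier_coeff u n) x) = cmod (tpoly K ?d x)" for K x
  proof -
    have "tpoly K ?d x = \<i> * tpoly K (\<lambda>n. of_int n * fourier_coeff u n) x"
      unfolding tpoly_def sum_distrib_left by (intro sum.cong refl) (simp add: mult_ac)
    then show ?thesis by (simp add: norm_mult)
  qed
  have ul: "uniform_limit {0..2 * pi} (\<lambda>K. tpoly K ?d) (deriv_x u) sequentially"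
    by (rule uniform_limit_on_subset[OF deriv_x_Hs2[OF u]]) simp
  \<comment> \<open>As a polynomial in \<open>z\<close> and \<open>cnj z\<close>, the fourth power
    passes through uniform limits of products.\<close>
  have z4: "cmod z ^ 4 = Re (z * cnj z * (z * cnj z))" for z
  proof -
    have "z * cnj z * (z * cnj z) = of_real ((cmod z)\<^sup>2 * (cmod z)\<^sup>2)"
      by (simp flip: complex_norm_square)
    then have "Re (z * cnj z * (z * cnj z)) = (cmod z)\<^sup>2 * (cmod z)\<^sup>2" by (simp only: Re_complex_of_real)
    then show ?thesis by (simp flip: power_add)
  qed
  have "uniform_limit {0..2 * pi} (\<lambda>K x. tpoly K ?d x * cnj (tpoly K ?d x) * (tpoly K ?d x * cnj (tpoly K ?d x)))
     (\<lambda>x. deriv_x u x * cnj (deriv_x u x) * (deriv_x u x * cnj (deriv_x u x))) sequentially"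
    by (intro uniform_limit_mult_continuous uniform_limit_cnj ul continuous_intros)
  then have "uniform_limit {0..2 * pi} (\<lambda>K x. cmod (tpoly K ?d x) ^ 4) (\<lambda>x. cmod (deriv_x u x) ^ 4) sequentially"
    unfolding z4 by (rule bounded_linear.uniform_limit[OF bounded_linear_Re])
  then show ?thesis
    unfolding n Lp_norm_4_pow by (rule LINT_uniform_limit) (intro continuous_intros)
qed

section \<open>The modified energy\<close>

lemma zero_Hs: "(\<lambda>x. 0) \<in> Hs s"
proof -
  have "(\<lambda>x. 0) = tpoly 0 (\<lambda>_. 0)" by (simp add: tpoly_def fun_eq_iff)
  then show ?thesis by (simp only: tpoly_in_Hs)
qed

lemma fourier_coeff_zero [simp]: "fourier_coeff (\<lambda>x. 0) n = 0"
  by (simp add: fourier_coeff_def)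

lemma Hs_norm_zero: "Hs_norm s (\<lambda>x. 0) = 0"
proof -
  have "(\<lambda>K. 2 * pi * (hnorm K s (fourier_coeff (\<lambda>x. 0)))\<^sup>2) \<longlonglongrightarrow> (Hs_norm s (\<lambda>x. 0))\<^sup>2"
    by (rule hnorm_tendsto_Hs[OF zero_Hs])
  moreover have "hnorm K s (fourier_coeff (\<lambda>x. 0)) = 0" for K by (simp add: hnorm_def L2_set_def)
  ultimately have "(Hs_norm s (\<lambda>x. 0))\<^sup>2 = 0" using LIMSEQ_unique[OF tendsto_const] by force
  then show ?thesis by simp
qed

definition correction :: "((nat \<Rightarrow> int) \<Rightarrow> real) \<Rightarrow> (real \<Rightarrow> complex) \<Rightarrow> real" where
  "correction r u = 2 * pi / 3 * lim (\<lambda>K. Re (sextic K r (entries (fourier_coeff u))))"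

lemma correction_tendsto:
  assumes r: "symb_le r s C" "1 \<le> s" "0 \<le> C" and u: "\<And>K. hnorm K s (fourier_coeff u) \<le> B"
  shows "(\<lambda>K. 2 * pi / 3 * Re (sextic K r (entries (fourier_coeff u)))) \<longlonglongrightarrow> correction r u"
proof -
  have "convergent (\<lambda>K. sextic K r (entries (fourier_coeff u)))"
    by (rule convergent_sextic[OF r u])
  then obtain z where "(\<lambda>K. sextic K r (entries (fourier_coeff u))) \<longlonglongrightarrow> z" by (auto simp: convergent_def)
  then have "(\<lambda>K. Re (sextic K r (entries (fourier_coeff u)))) \<longlonglongrightarrow> Re z" by (rule tendsto_Re)
  then show ?thesis unfolding correction_def by (subst limI) (auto intro: tendsto_mult_left simp del: times_divide_eq_left)
qed

text \<open>Ten is the highest degree in the flux bounds, so this absorbs every lower power and a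
  single exponent serves all estimates.\<close>

lemma power_le_1_plus_power10:
  fixes x :: real
  assumes "0 \<le> x" "n \<le> 10"
  shows "x ^ n \<le> 1 + x ^ 10"
proof (cases "x \<le> 1")
  case True
  then have "x ^ n \<le> 1" using assms by (intro power_le_one)
  then show ?thesis using assms by (simp add: add_increasing2)
next
  case False
  then have "x ^ n \<le> x ^ 10" using assms by (intro power_increasing) auto
  then show ?thesis by simp
qed

lemma power5_sum_le:
  fixes a b :: real
  assumes "0 \<le> a" "0 \<le> b"
  shows "(a + b) ^ 5 \<le> 32 * (1 + a ^ 10 + b ^ 10)"
proof -
  define c where "c = max a b"
  have "(a + b) ^ 5 \<le> (2 * c) ^ 5" using assms by (intro power_mono) (auto simp: c_def)
  also have "\<dots> = 32 * c ^ 5" by (simp add: power_mult_distrib)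
  also have "c ^ 5 \<le> 1 + c ^ 10" using assms by (intro power_le_1_plus_power10) (auto simp: c_def)
  also have "1 + c ^ 10 \<le> 1 + a ^ 10 + b ^ 10" using assms by (auto simp: c_def max_def)
  finally show ?thesis by simp
qed

lemma correction_lipschitz:
  assumes r: "symb_le r s C" "1 \<le> s" "0 \<le> C" and u: "u \<in> Hs s" and v: "v \<in> Hs s"
  shows "\<bar>correction r u - correction r v\<bar> \<le>
    2 * pi / 3 * (14580 * C * 32) * Hs_norm s (u - v) * (1 + Hs_norm s u ^ 10 + Hs_norm s v ^ 10)"
proof (rule LIMSEQ_le_const2)
  let ?B = "Hs_norm s u + Hs_norm s v" and ?D = "Hs_norm s (u - v)"
  let ?f = "\<lambda>K u. 2 * pi / 3 * Re (sextic K r (entries (fourier_coeff u)))"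
  have hu: "hnorm K s (fourier_coeff u) \<le> ?B" and hv: "hnorm K s (fourier_coeff v) \<le> ?B" for K
    using hnorm_le_Hs_norm[OF u, of K] hnorm_le_Hs_norm[OF v, of K] Hs_norm_nonneg[of s u] Hs_norm_nonneg[of s v] by linarith+
  show "(\<lambda>K. \<bar>?f K u - ?f K v\<bar>) \<longlonglongrightarrow> \<bar>correction r u - correction r v\<bar>"
    by (intro tendsto_intros correction_tendsto[OF r hu] correction_tendsto[OF r hv])
  show "\<exists>N. \<forall>K\<ge>N. \<bar>?f K u - ?f K v\<bar> \<le> 2 * pi / 3 * (14580 * C * 32) * ?D * (1 + Hs_norm s u ^ 10 + Hs_norm s v ^ 10)"
  proof (intro exI[of _ 0] allI impI)
    fix K :: nat
    have "cmod (sextic K r (entries (fourier_coeff u)) - sextic K r (entries (fourier_coeff v))) \<le> 14580 * C * ?B ^ 5 * ?D"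
    proof (rule sextic_lipschitz_uniform[OF r])
      show "hnorm K s (\<lambda>n. entries (fourier_coeff u) j n - entries (fourier_coeff v) j n) \<le> ?D" for j
        using hnorm_le_Hs_norm[OF Hs_diff[OF u v], of K]
        unfolding entries_diff[symmetric] hnorm_entries fourier_coeff_Hs_diff[OF u v, abs_def] .
    qed (simp_all only: hnorm_entries hu hv)
    also have "\<dots> \<le> 14580 * C * (32 * (1 + Hs_norm s u ^ 10 + Hs_norm s v ^ 10)) * ?D"
      by (intro mult_right_mono mult_left_mono power5_sum_le) (use r in auto)
    finally have *: "\<bar>Re (sextic K r (entries (fourier_coeff u)) - sextic K r (entries (fourier_coeff v)))\<bar>
       \<le> 14580 * C * (32 * (1 + Hs_norm s u ^ 10 + Hs_norm s v ^ 10)) * ?D"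
      by (rule order_trans[OF abs_Re_le_cmod])
    have "\<bar>?f K u - ?f K v\<bar> = 2 * pi / 3 * \<bar>Re (sextic K r (entries (fourier_coeff u)) - sextic K r (entries (fourier_coeff v)))\<bar>"
    proof -
      have "?f K u - ?f K v = 2 * pi / 3 * Re (sextic K r (entries (fourier_coeff u)) - sextic K r (entries (fourier_coeff v)))"
        by (simp only: minus_complex.sel right_diff_distrib)
      then show ?thesis by (simp only: abs_mult) simp
    qed
    also have "\<dots> \<le> 2 * pi / 3 * (14580 * C * (32 * (1 + Hs_norm s u ^ 10 + Hs_norm s v ^ 10)) * ?D)"
      by (rule mult_left_mono[OF *]) simp
    also have "\<dots> = 2 * pi / 3 * (14580 * C * 32) * ?D * (1 + Hs_norm s u ^ 10 + Hs_norm s v ^ 10)"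
      by (simp only: mult_ac)
    finally show "\<bar>?f K u - ?f K v\<bar> \<le> 2 * pi / 3 * (14580 * C * 32) * ?D * (1 + Hs_norm s u ^ 10 + Hs_norm s v ^ 10)" .
  qed
qed

section \<open>The flux and its bounds\<close>

text \<open>The value \<open>0\<close> for a divergent sequence only secures the bounds on all of \<open>H\<^sup>m\<close>; along solutions
  the sequence converges.\<close>

definition flux :: "((nat \<Rightarrow> int) \<Rightarrow> real) \<Rightarrow> nat \<Rightarrow> enat \<Rightarrow> (real \<Rightarrow> complex) \<Rightarrow> real" where
  "flux r m M w = (let f = \<lambda>K. rate r m (proj_modes M) K (fourier_coeff w) (fourier_coeff (quintic w))
     in if convergent f then lim f else 0)"

text \<open>The bound is a convergent sequence rather than a constant because for
  \<open>k = 1\<close> it contains the \<open>L^4\<close> integral of a truncated derivative, which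
  reaches its final value only in the limit.\<close>

lemma flux_bound:
  assumes f: "\<And>K. \<bar>rate r m (proj_modes M) K (fourier_coeff w) (fourier_coeff (quintic w))\<bar> \<le> b K"
    and b: "b \<longlonglongrightarrow> B"
  shows "\<bar>flux r m M w\<bar> \<le> B"
proof -
  let ?f = "\<lambda>K. rate r m (proj_modes M) K (fourier_coeff w) (fourier_coeff (quintic w))"
  \<comment> \<open>Nonnegativity of \<open>B\<close> covers the default value \<open>0\<close> of
    the flux.\<close>
  have "0 \<le> b K" for K using order_trans[OF abs_ge_zero f] .
  then have B: "0 \<le> B" by (intro LIMSEQ_le_const[OF b]) auto
  show ?thesis
  proof (cases "convergent ?f")
    case True
    then have "(\<lambda>K. \<bar>?f K\<bar>) \<longlonglongrightarrow> \<bar>lim ?f\<bar>" by (intro tendsto_rabs) (simp add: convergent_LIMSEQ_iff)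
    then have "\<bar>lim ?f\<bar> \<le> B" by (rule LIMSEQ_le[OF _ b]) (use f in auto)
    then show ?thesis using True by (simp add: flux_def)
  qed (simp add: flux_def B)
qed

text \<open>The limit theorem is applied to the coefficients of the projected solution, with
  \<open>proj_modes M\<close> as the set \<open>S\<close>; continuity in time is taken from the flow
  in \<open>H^m\<close>.\<close>

lemma modified_energy_derivative:
  assumes r: "symb_le r (m - 1) C" and g: "symb_le (\<lambda>n. psi m n - reson n * r n) m C" and m: "2 \<le> m" and C: "0 \<le> C"
    and sol: "nls_solution m M u\<^sub>0 u"
  shows "((\<lambda>\<tau>. (Hs_norm m (dirichlet_proj M (u \<tau>)))\<^sup>2 + correction r (dirichlet_proj M (u \<tau>)))
    has_real_derivative flux r m M (dirichlet_proj M (u t))) (at t)"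
proof -
  let ?w = "\<lambda>t. dirichlet_proj M (u t)"
  let ?c = "\<lambda>t. fourier_coeff (?w t)"
  let ?v = "\<lambda>t. fourier_coeff (quintic (?w t))"
  have u: "u t \<in> Hs m" for t using sol by (simp add: nls_solution_def)
  have w: "?w t \<in> Hs m" for t by (rule dirichlet_proj_Hs[OF u])
  have m1: "1 \<le> m" and m11: "1 \<le> m - 1" using m by auto
  have c: "?c t n = (if n \<in> proj_modes M then fourier_coeff (u t) n else 0)" for t n
    by (rule fourier_coeff_dirichlet_proj)
  have "(\<lambda>K. rate r m (proj_modes M) K (?c t) (?v t)) \<longlonglongrightarrow> lim (\<lambda>K. rate r m (proj_modes M) K (?c t) (?v t)) \<and>
    ((\<lambda>\<tau>. (Hs_norm m (?w \<tau>))\<^sup>2 + correction r (?w \<tau>)) has_real_derivative lim (\<lambda>K. rate r m (proj_modes M) K (?c t) (?v t))) (at t)"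
  proof (rule truncation_limit_derivative[where c="?c" and v="?v" and D="\<lambda>\<tau>. Hs_norm m (u \<tau> - u t)", OF r g m C])
    show "((\<lambda>\<tau>. ?c \<tau> n) has_vector_derivative - \<i> * (of_int n ^ 2 * ?c t n + (if n \<in> proj_modes M then ?v t n else 0))) (at t)" for t n
    proof (cases "n \<in> proj_modes M")
      case True
      obtain D where D: "((\<lambda>\<tau>. fourier_coeff (u \<tau>) n) has_vector_derivative D) (at t)"
        "\<i> * D - (of_int n)\<^sup>2 * fourier_coeff (u t) n = fourier_coeff (nls_nonlinearity M (u t)) n"
        using sol unfolding nls_solution_def by blast
      have "\<i> * D = of_int n ^ 2 * ?c t n + ?v t n"
        using D(2) True by (simp add: c fourier_coeff_nls_nonlinearity algebra_simps)
      then have "D = - \<i> * (of_int n ^ 2 * ?c t n + ?v t n)"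
        by (metis (no_types, lifting) i_squared mult.assoc mult_minus1 mult_minus_left neg_equal_iff_equal minus_minus)
      then show ?thesis using D(1) True by (simp add: c)
    qed (simp add: c)
    show "?c t n = 0" if "n \<notin> proj_modes M" for t n using that by (simp add: c)
    show "hnorm K m (?c t) \<le> Hs_norm m (?w t)" for K by (rule hnorm_le_Hs_norm[OF w])
    show "hnorm K m (\<lambda>n. ?c \<tau> n - ?c t n) \<le> Hs_norm m (u \<tau> - u t)" for \<tau> K
    proof -
      \<comment> \<open>Projecting only deletes modes, so the distance of the unprojected solutions
        controls this difference.\<close>
      have "hnorm K m (\<lambda>n. ?c \<tau> n - ?c t n) \<le> hnorm K m (fourier_coeff (u \<tau> - u t))"
        by (rule hnorm_mono) (simp add: c fourier_coeff_Hs_diff[OF u u])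
      also have "\<dots> \<le> Hs_norm m (u \<tau> - u t)" by (rule hnorm_le_Hs_norm[OF Hs_diff[OF u u]])
      finally show ?thesis .
    qed
    show "((\<lambda>\<tau>. Hs_norm m (u \<tau> - u t)) \<longlongrightarrow> 0) (at t)" using sol by (simp add: nls_solution_def)
    have "u t - u t = (\<lambda>x. 0)" by (simp add: fun_eq_iff)
    then show "Hs_norm m (u t - u t) = 0" by (simp only: Hs_norm_zero)
    show "quintic_lim (?c t) (?v t)" for t by (rule quintic_lim_Hs[OF w m1])
    show "(\<lambda>K. energy_trunc r m K (?c t)) \<longlonglongrightarrow> (Hs_norm m (?w t))\<^sup>2 + correction r (?w t)" for t
      unfolding energy_trunc_def
    proof (rule tendsto_add[OF hnorm_tendsto_Hs[OF w] correction_tendsto[OF r m11 C]])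
      show "hnorm K (m - 1) (?c t) \<le> Hs_norm m (?w t)" for K
        by (rule order_trans[OF hnorm_mono_s hnorm_le_Hs_norm[OF w]]) simp
    qed
  qed
  then show ?thesis
    unfolding flux_def Let_def by (auto simp: convergent_def)
qed

lemma flux_bound_explicit:
  assumes r: "symb_le r (m - 1) C" and m: "2 \<le> m" and C: "0 \<le> C" and w: "w \<in> Hs (m - 1)"
    and G: "\<And>K. cmod (sextic K (\<lambda>n. psi m n - reson n * r n) (entries (fourier_coeff w))) \<le> G K" and lim: "G \<longlonglongrightarrow> G0"
  shows "\<bar>flux r m M w\<bar> \<le> 2 * pi / 3 * (G0 + 14580 * C * (12150 * 5 ^ (m - 1)) * Hs_norm (m - 1) w ^ 10)"
proof (rule flux_bound)
  let ?A = "Hs_norm (m - 1) w"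
  have m1: "1 \<le> m - 1" using m by simp
  have h: "hnorm K (m - 1) (fourier_coeff w) \<le> ?A" for K by (rule hnorm_le_Hs_norm[OF w])
  have q: "hnorm K (m - 1) (fourier_coeff (quintic w)) \<le> 12150 * 5 ^ (m - 1) * ?A ^ 5" for K
    by (rule hnorm_quintic_lim_bound[OF m1 h quintic_lim_Hs[OF w m1]])
  show "\<bar>rate r m (proj_modes M) K (fourier_coeff w) (fourier_coeff (quintic w))\<bar>
      \<le> 2 * pi / 3 * (G K + 14580 * C * ?A ^ 5 * (12150 * 5 ^ (m - 1) * ?A ^ 5))" for K
    by (rule rate_bound[OF r m C h q G])
  have e: "14580 * C * ?A ^ 5 * (12150 * 5 ^ (m - 1) * ?A ^ 5) = 14580 * C * (12150 * 5 ^ (m - 1)) * ?A ^ 10"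
    by (simp add: mult_ac flip: power_add)
  show "(\<lambda>K. 2 * pi / 3 * (G K + 14580 * C * ?A ^ 5 * (12150 * 5 ^ (m - 1) * ?A ^ 5)))
      \<longlonglongrightarrow> 2 * pi / 3 * (G0 + 14580 * C * (12150 * 5 ^ (m - 1)) * ?A ^ 10)"
    unfolding e by (intro tendsto_intros lim)
qed

lemma flux_bound_high:
  assumes r: "symb_le r (m - 1) C" and g: "symb_le (\<lambda>n. psi m n - reson n * r n) (m - 1) C"
    and m: "2 \<le> m" and C: "0 \<le> C" and w: "w \<in> Hs (m - 1)"
  shows "\<bar>flux r m M w\<bar> \<le> 2 * pi / 3 * C * (2430 + 14580 * 12150 * 5 ^ (m - 1)) * (1 + Hs_norm (m - 1) w ^ 10)"
proof -
  let ?A = "Hs_norm (m - 1) w"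
  have G: "cmod (sextic K (\<lambda>n. psi m n - reson n * r n) (entries (fourier_coeff w))) \<le> 2430 * C * (1 + ?A ^ 10)" for K
  proof -
    have "cmod (sextic K (\<lambda>n. psi m n - reson n * r n) (entries (fourier_coeff w)))
       \<le> 2430 * C * (\<Prod>j<6. hnorm K (m - 1) (entries (fourier_coeff w) j))"
      by (rule sextic_bound[OF g _ C]) (use m in simp)
    also have "(\<Prod>j<6. hnorm K (m - 1) (entries (fourier_coeff w) j)) = hnorm K (m - 1) (fourier_coeff w) ^ 6"
      by simp
    also have "2430 * C * \<dots> \<le> 2430 * C * ?A ^ 6"
      by (intro mult_left_mono power_mono hnorm_le_Hs_norm[OF w]) (use C in auto)
    also have "\<dots> \<le> 2430 * C * (1 + ?A ^ 10)"
    proof (intro mult_left_mono)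
      show "?A ^ 6 \<le> 1 + ?A ^ 10" by (intro power_le_1_plus_power10) auto
    qed (use C in auto)
    finally show ?thesis .
  qed
  have "\<bar>flux r m M w\<bar> \<le> 2 * pi / 3 * (2430 * C * (1 + ?A ^ 10) + 14580 * C * (12150 * 5 ^ (m - 1)) * ?A ^ 10)"
    by (rule flux_bound_explicit[OF r m C w G tendsto_const])
  also have "\<dots> \<le> 2 * pi / 3 * (2430 * C * (1 + ?A ^ 10) + 14580 * C * (12150 * 5 ^ (m - 1)) * (1 + ?A ^ 10))"
    by (intro mult_left_mono add_left_mono) (use C in auto)
  finally show ?thesis by (simp add: algebra_simps)
qed

text \<open>\<open>108 = 12 * 3^2\<close>, with the embedding constant \<open>3\<close> for the
  supremum and \<open>1 / pi\<close> bounded by \<open>1\<close>. Membership in \<open>H^2\<close>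
  gives meaning to the derivative series, while only the \<open>H^1\<close> norm and the
  \<open>L^4\<close> norm remain in the bound.\<close>

lemma flux_bound_H1:
  assumes r: "symb_le r 1 C" and g: "\<And>n. zero_mom n \<Longrightarrow> psi 2 n - reson n * r n = h2_remainder n"
    and C: "0 \<le> C" and w: "w \<in> Hs 2" and w1: "w \<in> Hs 1"
  shows "\<bar>flux r 2 M w\<bar> \<le> 2 * pi / 3 * (108 + 14580 * C * (12150 * 5)) * (1 + Hs_norm 1 w ^ 10) * (1 + Lp_norm 4 (deriv_x w) ^ 4)"
proof -
  let ?A = "Hs_norm 1 w" and ?L = "Lp_norm 4 (deriv_x w) ^ 4"
  let ?I = "\<lambda>K. LINT x|torus. cmod (tpoly K (\<lambda>n. of_int n * fourier_coeff w n) x) ^ 4"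
  have L: "0 \<le> ?L" by simp
  have G: "cmod (sextic K (\<lambda>n. psi 2 n - reson n * r n) (entries (fourier_coeff w))) \<le> 12 * (3 * ?A)\<^sup>2 / pi * ?I K" for K
  proof -
    have "sextic K (\<lambda>n. psi 2 n - reson n * r n) (entries (fourier_coeff w)) = sextic K h2_remainder (entries (fourier_coeff w))"
      by (rule sextic_cong) (simp_all add: g)
    moreover have "cmod (sextic K h2_remainder (entries (fourier_coeff w))) \<le> 12 * (3 * ?A)\<^sup>2 / pi * ?I K"
      by (rule sextic_h2_remainder_bound, rule order_trans[OF norm_tpoly_le l1_fourier_Hs[OF w1]]) simp
    ultimately show ?thesis by simp
  qed
  have lim: "(\<lambda>K. 12 * (3 * ?A)\<^sup>2 / pi * ?I K) \<longlonglongrightarrow> 12 * (3 * ?A)\<^sup>2 / pi * ?L"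
    by (intro tendsto_intros LINT_tpoly_deriv_tendsto[OF w])
  have w1': "w \<in> Hs (2 - 1)" and r': "symb_le r (2 - 1) C" using w1 r by auto
  have "\<bar>flux r 2 M w\<bar> \<le> 2 * pi / 3 * (12 * (3 * ?A)\<^sup>2 / pi * ?L + 14580 * C * (12150 * 5 ^ (2 - 1)) * Hs_norm (2 - 1) w ^ 10)"
    by (rule flux_bound_explicit[OF r' order_refl C w1' G lim])
  also have "\<dots> \<le> 2 * pi / 3 * (108 * ((1 + ?A ^ 10) * (1 + ?L)) + 14580 * C * (12150 * 5) * ((1 + ?A ^ 10) * (1 + ?L)))"
  proof (intro mult_left_mono add_mono)
    have A2: "?A\<^sup>2 \<le> 1 + ?A ^ 10" by (intro power_le_1_plus_power10) auto
    have "12 * (3 * ?A)\<^sup>2 / pi * ?L \<le> 12 * (3 * ?A)\<^sup>2 / 1 * ?L"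
      using pi_gt3 by (intro mult_right_mono divide_left_mono) auto
    also have "\<dots> = 108 * (?A\<^sup>2 * ?L)" by (simp add: power_mult_distrib)
    also have "\<dots> \<le> 108 * ((1 + ?A ^ 10) * (1 + ?L))"
      using A2 by (intro mult_left_mono mult_mono) auto
    finally show "12 * (3 * ?A)\<^sup>2 / pi * ?L \<le> 108 * ((1 + ?A ^ 10) * (1 + ?L))" .
    have "?A ^ 10 * 1 \<le> (1 + ?A ^ 10) * (1 + ?L)"
      by (intro mult_mono) auto
    then show "14580 * C * (12150 * 5 ^ (2 - 1)) * Hs_norm (2 - 1) w ^ 10 \<le> 14580 * C * (12150 * 5) * ((1 + ?A ^ 10) * (1 + ?L))"
      using C by (simp add: mult_left_mono)
  qed simp
  finally show ?thesis by (simp add: algebra_simps)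
qed

section \<open>Assembly of the functionals and constants\<close>

theorem theorem1p4:
  fixes k :: nat
  assumes "k \<ge> 1"
  shows "\<exists>(m\<^sub>0::nat) (C::real). m\<^sub>0 > 0 \<and> C > 0 \<and>
    (\<exists>(E :: (real \<Rightarrow> complex) \<Rightarrow> real) (R :: (real \<Rightarrow> complex) \<Rightarrow> real).
      (\<forall>u\<in>Hs (2 * k). E u = (Hs_norm (2 * k) u)\<^sup>2 + R u) \<and>
      E (\<lambda>x. 0) = 0 \<and>
      (\<forall>u\<in>Hs (2 * k - 1). \<forall>v\<in>Hs (2 * k - 1).
         \<bar>R u - R v\<bar> \<le> C * Hs_norm (2 * k - 1) (u - v) *
           (1 + Hs_norm (2 * k - 1) u ^ m\<^sub>0 + Hs_norm (2 * k - 1) v ^ m\<^sub>0)) \<and>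
      (\<forall>M::enat. \<exists>F :: (real \<Rightarrow> complex) \<Rightarrow> real.
         (\<forall>u\<^sub>0\<in>Hs (2 * k). \<forall>u. nls_solution (2 * k) M u\<^sub>0 u \<longrightarrow>
            (\<forall>t. ((\<lambda>\<tau>. E (dirichlet_proj M (u \<tau>))) has_real_derivative
                    F (dirichlet_proj M (u t))) (at t))) \<and>
         (k \<ge> 2 \<longrightarrow> (\<forall>u\<in>Hs (2 * k). \<bar>F u\<bar> \<le> C * (1 + Hs_norm (2 * k - 1) u ^ m\<^sub>0))) \<and>
         (k = 1 \<longrightarrow> (\<forall>u\<in>Hs 2. \<bar>F u\<bar> \<le>
            C * (1 + Hs_norm 1 u ^ m\<^sub>0) * (1 + Lp_norm 4 (deriv_x u) ^ 4)))))"
proof -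
  define m where "m = 2 * k"
  have m: "2 \<le> m" "1 \<le> m - 1" using assms by (auto simp: m_def)
  obtain r C where C: "0 \<le> C" and r: "symb_le r (m - 1) C" and g: "symb_le (\<lambda>n. psi m n - reson n * r n) m C"
    and g_high: "2 \<le> k \<Longrightarrow> symb_le (\<lambda>n. psi m n - reson n * r n) (m - 1) C"
    and g_low: "\<And>n. k = 1 \<Longrightarrow> zero_mom n \<Longrightarrow> psi m n - reson n * r n = h2_remainder n"
    using normal_form[OF assms] unfolding m_def by blast
  define C1 where "C1 = 2 * pi / 3 * (14580 * C * 32)"
  define C2 where "C2 = 2 * pi / 3 * C * (2430 + 14580 * 12150 * 5 ^ (m - 1))"
  define C3 where "C3 = 2 * pi / 3 * (108 + 14580 * C * (12150 * 5))"
  \<comment> \<open>One constant for the Lipschitz bound and both flux bounds; the summand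
    \<open>1\<close> makes it positive. None of the three depends on \<open>M\<close>.\<close>
  define Q where "Q = C1 + C2 + C3 + 1"
  have pos: "0 \<le> C1" "0 \<le> C2" "0 \<le> C3" using C by (auto simp: C1_def C2_def C3_def)
  then have Q: "C1 \<le> Q" "C2 \<le> Q" "C3 \<le> Q" "0 < Q" by (auto simp: Q_def)
  define R where "R = correction r"
  define E where "E u = (Hs_norm m u)\<^sup>2 + R u" for u
  have E0: "E (\<lambda>x. 0) = 0"
  proof -
    have "sextic K r (entries (fourier_coeff (\<lambda>x. 0))) = 0" for K
      by (simp add: sextic_def prod6 entries_def)
    then show ?thesis by (simp add: E_def R_def correction_def Hs_norm_zero)
  qed
  have lip: "\<bar>R u - R v\<bar> \<le> Q * Hs_norm (m - 1) (u - v) * (1 + Hs_norm (m - 1) u ^ 10 + Hs_norm (m - 1) v ^ 10)"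
    if "u \<in> Hs (m - 1)" "v \<in> Hs (m - 1)" for u v
  proof -
    have "\<bar>R u - R v\<bar> \<le> C1 * Hs_norm (m - 1) (u - v) * (1 + Hs_norm (m - 1) u ^ 10 + Hs_norm (m - 1) v ^ 10)"
      unfolding R_def C1_def by (rule correction_lipschitz[OF r m(2) C that])
    also have "\<dots> \<le> Q * Hs_norm (m - 1) (u - v) * (1 + Hs_norm (m - 1) u ^ 10 + Hs_norm (m - 1) v ^ 10)"
      by (intro mult_right_mono Q) auto
    finally show ?thesis .
  qed
  have flux: "\<exists>F. (\<forall>u\<^sub>0\<in>Hs m. \<forall>u. nls_solution m M u\<^sub>0 u \<longrightarrow>
            (\<forall>t. ((\<lambda>\<tau>. E (dirichlet_proj M (u \<tau>))) has_real_derivative F (dirichlet_proj M (u t))) (at t))) \<and>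
         (k \<ge> 2 \<longrightarrow> (\<forall>u\<in>Hs m. \<bar>F u\<bar> \<le> Q * (1 + Hs_norm (m - 1) u ^ 10))) \<and>
         (k = 1 \<longrightarrow> (\<forall>u\<in>Hs 2. \<bar>F u\<bar> \<le> Q * (1 + Hs_norm 1 u ^ 10) * (1 + Lp_norm 4 (deriv_x u) ^ 4)))" for M
  proof (intro exI[of _ "flux r m M"] conjI ballI allI impI)
    show "((\<lambda>\<tau>. E (dirichlet_proj M (u \<tau>))) has_real_derivative flux r m M (dirichlet_proj M (u t))) (at t)"
      if "nls_solution m M u\<^sub>0 u" for u\<^sub>0 u t
      unfolding E_def R_def by (rule modified_energy_derivative[OF r g m(1) C that])
    show "\<bar>flux r m M u\<bar> \<le> Q * (1 + Hs_norm (m - 1) u ^ 10)" if "k \<ge> 2" "u \<in> Hs m" for u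
    proof -
      have "u \<in> Hs (m - 1)" using that Hs_Suc_subset[of "m - 1"] m by auto
      then have "\<bar>flux r m M u\<bar> \<le> C2 * (1 + Hs_norm (m - 1) u ^ 10)"
        unfolding C2_def by (rule flux_bound_high[OF r g_high[OF that(1)] m(1) C])
      also have "\<dots> \<le> Q * (1 + Hs_norm (m - 1) u ^ 10)" by (intro mult_right_mono Q) auto
      finally show ?thesis .
    qed
    show "\<bar>flux r m M u\<bar> \<le> Q * (1 + Hs_norm 1 u ^ 10) * (1 + Lp_norm 4 (deriv_x u) ^ 4)"
      if "k = 1" "u \<in> Hs 2" for u
    proof -
      have m2: "m = 2" using that by (simp add: m_def)
      have u1: "u \<in> Hs 1" using that Hs_Suc_subset[of 1] by (auto simp: numeral_2_eq_2)
      have "\<bar>flux r m M u\<bar> \<le> C3 * (1 + Hs_norm 1 u ^ 10) * (1 + Lp_norm 4 (deriv_x u) ^ 4)"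
        unfolding C3_def m2
        by (rule flux_bound_H1[OF _ _ C that(2) u1]) (use r g_low that(1) m2 in auto)
      also have "\<dots> \<le> Q * (1 + Hs_norm 1 u ^ 10) * (1 + Lp_norm 4 (deriv_x u) ^ 4)"
        by (intro mult_right_mono Q) auto
      finally show ?thesis .
    qed
  qed
  show ?thesis
    unfolding m_def[symmetric]
  proof (rule exI[of _ "10::nat"], rule exI[of _ Q], intro conjI, simp, rule Q(4),
      rule exI[of _ E], rule exI[of _ R], intro conjI ballI allI)
    show "E u = (Hs_norm m u)\<^sup>2 + R u" for u by (rule E_def)
  qed (fact E0 lip flux)+
qed

end
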